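(* Suppose $\sigma^2(x)\equiv\sigma^2$ and the following hold. (i) There is a constant $c_\pi>0$ such that $0\le \pi(x),\sigma^2(x)\le c_\pi$ for all $x\in\mathcal{X}$. (ii) There is a constant $\tau>0$ such that $E\{\epsilon^4|X\}<\tau$ almost surely. (iii) $c_\varphi:=\sup_{j\ge1}\|\varphi_j\|_{\sup}<\infty$ and $\sup_{k\ge1}\frac{\sum_{\nu=k+1}^\infty\mu_\nu}{k\mu_k}<\infty$. (iv) There exist nonnegative constants $a,b$ such that $\max_{1\le j\le s}\xi_j=O_P\left(\sqrt{\frac{\log^b N}{nh^a}}\right)$. (v) As $N\to\infty$, $h=o(1)$, $Nh^2\to\infty$ and $\log^bN=o(nh^{a+1})$. For $f\in\mathcal{H}$ define $$b_{N,\lambda}=\left(\lambda^{1/2}\|f\|_{\mathcal{H}}+(Nh)^{-1/2}\right)\sqrt{\frac{\log^bN}{nh^a}},$$ $$d_{N,\lambda}=\lambda^{1/2}\|f\|_{\mathcal{H}}+(Nh^{1/2})^{-1/2}+N^{-1/2}+b_{N,\lambda}^{1/2}(Nh)^{-1/4}+b_{N,\lambda}$$ (both depending on $f$). Then for any $\varepsilon>0$ there exist $C_\varepsilon$ and $N_\varepsilon$ such that $$\inf_{f\in\mathcal{H}:\ \|f\|\ge C_\varepsilon d_{N,\lambda}}P_f(\psi_{N,\lambda}=1)\ge1-\varepsilon\qquad\text{for any }N\ge N_\varepsilon .$$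
   Context: Model: $(Y_i,X_i)$, $i=1,\dots,N$, are i.i.d. from $Y_i=f(X_i)+\epsilon_i$, with $E\{\epsilon_i|X_i\}=0$, $E\{\epsilon_i^2|X_i\}=\sigma^2(X_i)>0$, $X_i\in\mathcal{X}\subseteq\mathbb{R}^d$ with distribution (density) $\pi$, $Y_i\in\mathbb{R}$, and $f\in\mathcal{H}$ unknown; $P_f$ is probability when $f$ is the true regression function. RKHS: $\mathcal{H}\subset L^2_\pi(\mathcal{X})$ is a reproducing kernel Hilbert space with inner product $\langle\cdot,\cdot\rangle_{\mathcal{H}}$ and kernel $R(x,x')=\sum_{i\ge1}\mu_i\varphi_i(x)\varphi_i(x')$, $\mu_1\ge\mu_2\ge\cdots\ge0$, where $\{\varphi_i\}$ is a basis of $L^2_\pi(\mathcal{X})$ with $\langle\varphi_i,\varphi_j\rangle_{L^2_\pi}=\delta_{ij}$ and $\langle\varphi_i,\varphi_j\rangle_{\mathcal{H}}=\delta_{ij}/\mu_i$. For $\lambda>0$ define $\langle f,g\rangle=V(f,g)+\lambda\langle f,g\rangle_{\mathcal{H}}$, $V(f,g)=E\{f(X)g(X)\}$, with norm $\|\cdot\|$; $(\mathcal{H},\langle\cdot,\cdot\rangle)$ is an RKHS with kernel $K(x,y)=\sum_{\nu\ge1}\frac{\varphi_\nu(x)\varphi_\nu(y)}{1+\lambda/\mu_\nu}$. $h^{-1}:=\sum_{\nu\ge1}\frac{1}{1+\lambda/\mu_\nu}$. $\|f\|_{\sup}=\sup_{x\in\mathcal{X}}|f(x)|$. Divide and conquer: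 the $N$ samples are randomly divided into $s$ subsamples with index sets $I_1,\dots,I_s$, $|I_j|=n$, $N=ns$. $\widehat f_j=\arg\min_{f\in\mathcal{H}}\frac1{2n}\sum_{i\in I_j}(Y_i-f(X_i))^2+\frac\lambda2\|f\|_{\mathcal{H}}^2$, $\bar f=\frac1s\sum_{j=1}^s\widehat f_j$, and $T_{N,\lambda}=\|\bar f\|^2$. Empirical process: $Pf=E_X\{f(X)\}$, $P_jf=n^{-1}\sum_{i\in I_j}f(X_i)$, $\xi_j=\sup_{f,g\in\mathcal{H},\,\|f\|=\|g\|=1}|P_jfg-Pfg|$. Test: $W(N)=\sum_{1\le i<k\le N}2\epsilon_i\epsilon_kK(X_i,X_k)$, $\sigma^2(N)=\mathrm{Var}(W(N))$; $\psi_{N,\lambda}=I\left(|T_{N,\lambda}-\sigma^2/(Nh)|\ge z_{1-\alpha/2}\,\sigma(N)/N^2\right)$, where $\alpha\in(0,1)$ is fixed and $z_{1-\alpha/2}$ is the $(1-\alpha/2)\times100$ percentile of the standard normal distribution. The quantities $s,n,\lambda,h$ depend on $N$. *)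

theory Defs
  imports "HOL-Probability.Probability" "HOL-Library.Landau_Symbols"
begin

section \<open>Reproducing kernel Hilbert spaces of functions on a set\<close>

text \<open>A function on \<open>\<X>\<close> is encoded as a total function that vanishes outside \<open>\<X>\<close>, so that
  equality of functions on \<open>\<X>\<close> is equality in HOL.\<close>

locale rkhs =
  fixes \<X> :: "'a set"
    and H :: "('a \<Rightarrow> real) set"
    and ip :: "('a \<Rightarrow> real) \<Rightarrow> ('a \<Rightarrow> real) \<Rightarrow> real"
    and R :: "'a \<Rightarrow> 'a \<Rightarrow> real"
  assumes supp: "\<And>f x. f \<in> H \<Longrightarrow> x \<notin> \<X> \<Longrightarrow> f x = 0"
    and zero_mem: "(\<lambda>_. 0) \<in> H"
    and add_mem: "\<And>f g. f \<in> H \<Longrightarrow> g \<in> H \<Longrightarrow> (\<lambda>x. f x + g x) \<in> H"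
    and scale_mem: "\<And>c f. f \<in> H \<Longrightarrow> (\<lambda>x. c * f x) \<in> H"
    and ip_commute: "\<And>f g. f \<in> H \<Longrightarrow> g \<in> H \<Longrightarrow> ip f g = ip g f"
    and ip_add: "\<And>f g k. f \<in> H \<Longrightarrow> g \<in> H \<Longrightarrow> k \<in> H \<Longrightarrow>
                   ip (\<lambda>x. f x + g x) k = ip f k + ip g k"
    and ip_scale: "\<And>c f g. f \<in> H \<Longrightarrow> g \<in> H \<Longrightarrow> ip (\<lambda>x. c * f x) g = c * ip f g"
    and ip_nonneg: "\<And>f. f \<in> H \<Longrightarrow> 0 \<le> ip f f"
    and ip_definite: "\<And>f. f \<in> H \<Longrightarrow> ip f f = 0 \<Longrightarrow> f = (\<lambda>_. 0)"
    and complete: "\<And>F. (\<And>m. F m \<in> H) \<Longrightarrow>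
           (\<And>e. e > 0 \<Longrightarrow> \<exists>m0. \<forall>m\<ge>m0. \<forall>l\<ge>m0.
              sqrt (ip (\<lambda>x. F m x - F l x) (\<lambda>x. F m x - F l x)) < e) \<Longrightarrow>
           \<exists>f\<in>H. (\<lambda>m. sqrt (ip (\<lambda>x. F m x - f x) (\<lambda>x. F m x - f x))) \<longlonglongrightarrow> 0"
    and kernel_mem: "\<And>x. x \<in> \<X> \<Longrightarrow> R x \<in> H"
    and reproducing: "\<And>f x. f \<in> H \<Longrightarrow> x \<in> \<X> \<Longrightarrow> ip f (R x) = f x"

definition L2_space :: "'a measure \<Rightarrow> ('a \<Rightarrow> real) set" where
  "L2_space Q = {f \<in> borel_measurable Q. integrable Q (\<lambda>x. (f x)\<^sup>2)}"

definition L2_inner :: "'a measure \<Rightarrow> ('a \<Rightarrow> real) \<Rightarrow> ('a \<Rightarrow> real) \<Rightarrow> real" where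
  "L2_inner Q f g = (\<integral>x. f x * g x \<partial>Q)"

text \<open>The sequences \<open>\<mu>\<close> and \<open>\<phi>\<close> are indexed from 1; their values at 0 are never used. An
  eigenfunction with eigenvalue 0 need not belong to \<open>H\<close> (formally its \<open>H\<close>-norm is infinite).\<close>

locale eigen_rkhs = rkhs \<X> H ip R
  for \<X> :: "'a set" and H ip R +
  fixes Q :: "'a measure"
    and \<mu> :: "nat \<Rightarrow> real"
    and \<phi> :: "nat \<Rightarrow> 'a \<Rightarrow> real"
  assumes H_L2: "H \<subseteq> L2_space Q"
    and \<mu>_nonneg: "\<And>i. i \<ge> 1 \<Longrightarrow> 0 \<le> \<mu> i"
    and \<mu>_decreasing: "\<And>i. i \<ge> 1 \<Longrightarrow> \<mu> (Suc i) \<le> \<mu> i"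
    and \<phi>_L2: "\<And>i. i \<ge> 1 \<Longrightarrow> \<phi> i \<in> L2_space Q"
    and \<phi>_orthonormal: "\<And>i j. i \<ge> 1 \<Longrightarrow> j \<ge> 1 \<Longrightarrow>
           L2_inner Q (\<phi> i) (\<phi> j) = (if i = j then 1 else 0)"
    and \<phi>_basis: "\<And>g. g \<in> L2_space Q \<Longrightarrow>
           (\<lambda>m. \<integral>x. (g x - (\<Sum>i=1..m. L2_inner Q g (\<phi> i) * \<phi> i x))\<^sup>2 \<partial>Q) \<longlonglongrightarrow> 0"
    and \<phi>_mem: "\<And>i. i \<ge> 1 \<Longrightarrow> \<mu> i \<noteq> 0 \<Longrightarrow> \<phi> i \<in> H"
    and \<phi>_ip: "\<And>i j. i \<ge> 1 \<Longrightarrow> j \<ge> 1 \<Longrightarrow> \<mu> i \<noteq> 0 \<Longrightarrow> \<mu> j \<noteq> 0 \<Longrightarrow>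
           ip (\<phi> i) (\<phi> j) = (if i = j then 1 / \<mu> i else 0)"
    and kernel_series: "\<And>x y. x \<in> \<X> \<Longrightarrow> y \<in> \<X> \<Longrightarrow>
           (\<lambda>k. \<mu> (Suc k) * \<phi> (Suc k) x * \<phi> (Suc k) y) sums R x y"

definition sup_norm :: "'a set \<Rightarrow> ('a \<Rightarrow> real) \<Rightarrow> ennreal" where
  "sup_norm \<X> f = (SUP x\<in>\<X>. ennreal \<bar>f x\<bar>)"

text \<open>The factor \<open>1 / (1 + lam / \<mu>)\<close>, whose value for \<open>\<mu> = 0\<close> is the limit 0 (with HOL's
  \<open>lam / 0 = 0\<close> the bare formula would give 1).\<close>

definition shrink :: "real \<Rightarrow> real \<Rightarrow> real" where
  "shrink lam m = (if m = 0 then 0 else 1 / (1 + lam / m))"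

text \<open>The quantity \<open>h\<close> (the real series converges when \<open>\<mu>\<close> is summable), and the kernel \<open>K\<close> of \<open>H\<close> under \<open>V(f,g) + lam \<langle>f,g\<rangle>\<^sub>H\<close>.\<close>

definition bandwidth :: "(nat \<Rightarrow> real) \<Rightarrow> real \<Rightarrow> real" where
  "bandwidth \<mu> lam = inverse (\<Sum>k. shrink lam (\<mu> (Suc k)))"

definition ridge_kernel :: "(nat \<Rightarrow> real) \<Rightarrow> (nat \<Rightarrow> 'a \<Rightarrow> real) \<Rightarrow> real \<Rightarrow> 'a \<Rightarrow> 'a \<Rightarrow> real" where
  "ridge_kernel \<mu> \<phi> lam x y = (\<Sum>k. shrink lam (\<mu> (Suc k)) * (\<phi> (Suc k) x * \<phi> (Suc k) y))"

definition ridge_norm ::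
    "'a measure \<Rightarrow> (('a \<Rightarrow> real) \<Rightarrow> ('a \<Rightarrow> real) \<Rightarrow> real) \<Rightarrow> real \<Rightarrow> ('a \<Rightarrow> real) \<Rightarrow> real" where
  "ridge_norm Q ip lam f = sqrt (L2_inner Q f f + lam * ip f f)"


section \<open>The regression model\<close>

definition covariate_law :: "'a::euclidean_space set \<Rightarrow> ('a \<Rightarrow> real) \<Rightarrow> 'a measure" where
  "covariate_law \<X> p = density (restrict_space lborel \<X>) (\<lambda>x. ennreal (p x))"

text \<open>Covariates \<open>X\<close> and errors \<open>\<epsilon>\<close>, with sample indices starting at 1. Their joint law does not
  depend on the regression function \<open>f\<close>, which only enters through \<open>Y\<^sub>i = f(X\<^sub>i) + \<epsilon>\<^sub>i\<close>; the
  probability \<open>P\<^sub>f\<close> of an event about the data is the probability under \<open>M\<close> of that event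
  for these \<open>Y\<^sub>i\<close>. The nonnegative conditional expectation is used for \<open>\<epsilon>\<^sub>i\<^sup>2\<close> so that no
  integrability has to be presupposed.\<close>

locale regression_design = prob_space M
  for M :: "'w measure" +
  fixes \<X> :: "(real ^ 'd) set"
    and p :: "real ^ 'd \<Rightarrow> real"
    and X :: "nat \<Rightarrow> 'w \<Rightarrow> real ^ 'd"
    and \<epsilon> :: "nat \<Rightarrow> 'w \<Rightarrow> real"
    and v :: "real ^ 'd \<Rightarrow> real"
  assumes domain_borel: "\<X> \<in> sets borel"
    and X_density: "\<And>i. i \<ge> 1 \<Longrightarrow>
           distributed M (restrict_space lborel \<X>) (X i) (\<lambda>x. ennreal (p x))"
    and indep: "indep_vars (\<lambda>_. restrict_space borel \<X> \<Otimes>\<^sub>M borel)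
                  (\<lambda>i \<omega>. (X i \<omega>, \<epsilon> i \<omega>)) {1..}"
    and ident: "\<And>i. i \<ge> 1 \<Longrightarrow>
           distr M (restrict_space borel \<X> \<Otimes>\<^sub>M borel) (\<lambda>\<omega>. (X i \<omega>, \<epsilon> i \<omega>)) =
           distr M (restrict_space borel \<X> \<Otimes>\<^sub>M borel) (\<lambda>\<omega>. (X 1 \<omega>, \<epsilon> 1 \<omega>))"
    and \<epsilon>_integrable: "\<And>i. i \<ge> 1 \<Longrightarrow> integrable M (\<epsilon> i)"
    and \<epsilon>_mean: "\<And>i. i \<ge> 1 \<Longrightarrow> AE \<omega> in M.
           real_cond_exp M (vimage_algebra (space M) (X i) (restrict_space borel \<X>)) (\<epsilon> i) \<omega> = 0"
    and v_measurable: "v \<in> borel_measurable (restrict_space borel \<X>)"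
    and v_pos: "\<And>x. x \<in> \<X> \<Longrightarrow> 0 < v x"
    and \<epsilon>_variance: "\<And>i. i \<ge> 1 \<Longrightarrow> AE \<omega> in M.
           nn_cond_exp M (vimage_algebra (space M) (X i) (restrict_space borel \<X>))
             (\<lambda>\<omega>. ennreal ((\<epsilon> i \<omega>)\<^sup>2)) \<omega> = ennreal (v (X i \<omega>))"


section \<open>Divide and conquer\<close>

text \<open>A division of the samples \<open>1..N\<close> is given by labels in \<open>1..s\<close>, each used \<open>n\<close> times.\<close>

definition block :: "nat \<Rightarrow> (nat \<Rightarrow> nat) \<Rightarrow> nat \<Rightarrow> nat set" where
  "block N g j = {i \<in> {1..N}. g i = j}"

definition divisions :: "nat \<Rightarrow> nat \<Rightarrow> nat \<Rightarrow> (nat \<Rightarrow> nat) set" where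
  "divisions N s n = {g \<in> {1..N} \<rightarrow>\<^sub>E {1..s}. \<forall>j\<in>{1..s}. card (block N g j) = n}"

text \<open>The division \<open>G\<close> is uniformly distributed and independent of the sample.\<close>

definition random_division ::
    "'w measure \<Rightarrow> 'a::topological_space set \<Rightarrow> (nat \<Rightarrow> 'w \<Rightarrow> 'a) \<Rightarrow> (nat \<Rightarrow> 'w \<Rightarrow> real) \<Rightarrow>
     nat \<Rightarrow> nat \<Rightarrow> nat \<Rightarrow> ('w \<Rightarrow> nat \<Rightarrow> nat) \<Rightarrow> bool" where
  "random_division M \<X> X \<epsilon> N s n G \<longleftrightarrow>
     G \<in> measurable M (count_space (divisions N s n)) \<and>
     distr M (count_space (divisions N s n)) G = uniform_count_measure (divisions N s n) \<and>
     prob_space.indep_set M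
       (sets (vimage_algebra (space M) G (count_space (divisions N s n))))
       (sets (vimage_algebra (space M)
         (\<lambda>\<omega>. \<lambda>i\<in>{1..N}. (X i \<omega>, \<epsilon> i \<omega>))
         (Pi\<^sub>M {1..N} (\<lambda>_. restrict_space borel \<X> \<Otimes>\<^sub>M borel))))"

definition krr_objective ::
    "(('a \<Rightarrow> real) \<Rightarrow> ('a \<Rightarrow> real) \<Rightarrow> real) \<Rightarrow> real \<Rightarrow> nat set \<Rightarrow>
     (nat \<Rightarrow> 'a) \<Rightarrow> (nat \<Rightarrow> real) \<Rightarrow> ('a \<Rightarrow> real) \<Rightarrow> real" where
  "krr_objective ip lam I xs ys f =
     1 / (2 * real (card I)) * (\<Sum>i\<in>I. (ys i - f (xs i))\<^sup>2) + lam / 2 * ip f f"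

definition krr ::
    "('a \<Rightarrow> real) set \<Rightarrow> (('a \<Rightarrow> real) \<Rightarrow> ('a \<Rightarrow> real) \<Rightarrow> real) \<Rightarrow> real \<Rightarrow> nat set \<Rightarrow>
     (nat \<Rightarrow> 'a) \<Rightarrow> (nat \<Rightarrow> real) \<Rightarrow> 'a \<Rightarrow> real" where
  "krr H ip lam I xs ys = arg_min_on (krr_objective ip lam I xs ys) H"

definition dc_krr ::
    "('a \<Rightarrow> real) set \<Rightarrow> (('a \<Rightarrow> real) \<Rightarrow> ('a \<Rightarrow> real) \<Rightarrow> real) \<Rightarrow> real \<Rightarrow> nat \<Rightarrow> nat \<Rightarrow>
     (nat \<Rightarrow> nat) \<Rightarrow> (nat \<Rightarrow> 'a) \<Rightarrow> (nat \<Rightarrow> real) \<Rightarrow> 'a \<Rightarrow> real" where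
  "dc_krr H ip lam N s g xs ys =
     (\<lambda>x. 1 / real s * (\<Sum>j=1..s. krr H ip lam (block N g j) xs ys x))"

text \<open>The quantity \<open>\<xi>\<^sub>j\<close> for the block \<open>I\<close>; \<open>nrm\<close> is the norm \<open>\<parallel>\<cdot>\<parallel>\<close>. The real supremum is only
  meaningful where point evaluations are uniformly bounded on the unit sphere, which is the case
  for uniformly bounded eigenfunctions and \<open>h > 0\<close>.\<close>

definition emp_deviation ::
    "'a measure \<Rightarrow> ('a \<Rightarrow> real) set \<Rightarrow> (('a \<Rightarrow> real) \<Rightarrow> real) \<Rightarrow> nat set \<Rightarrow> (nat \<Rightarrow> 'a) \<Rightarrow> real" where
  "emp_deviation Q H nrm I xs =
     (SUP (f, g) \<in> {f \<in> H. nrm f = 1} \<times> {g \<in> H. nrm g = 1}.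
        \<bar>1 / real (card I) * (\<Sum>i\<in>I. f (xs i) * g (xs i)) - (\<integral>x. f x * g x \<partial>Q)\<bar>)"

definition bigOP :: "'w measure \<Rightarrow> (nat \<Rightarrow> 'w \<Rightarrow> real) \<Rightarrow> (nat \<Rightarrow> real) \<Rightarrow> bool" where
  "bigOP M Z r \<longleftrightarrow>
     (\<forall>\<^sub>F N in sequentially. Z N \<in> borel_measurable M) \<and>
     (\<forall>\<delta>>0. \<exists>C>0. \<forall>\<^sub>F N in sequentially.
        measure M {\<omega> \<in> space M. \<bar>Z N \<omega>\<bar> > C * r N} \<le> \<delta>)"

definition std_normal_quantile :: "real \<Rightarrow> real" where
  "std_normal_quantile q = (THE z. cdf std_normal_distribution z = q)"

end

theory Submission
  imports Defs
begin

text \<open>Let \<open>A\<close> represent the form \<open>L2_inner Q f\<close> in \<open>H\<close> with the ridge inner product, and let \<open>U\<close> be the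
  average of \<open>\<epsilon>\<^sub>i K(X\<^sub>i, \<cdot>)\<close> over all \<open>N\<close> samples. On each block the normal equations of ridge regression
  differ from those solved by \<open>A\<close> plus the block average of \<open>\<epsilon>\<^sub>i K(X\<^sub>i, \<cdot>)\<close> only through the empirical
  deviation \<open>\<xi>\<^sub>j\<close>. Ridge regression is linear in the responses, so given the covariates and the
  division the errors of the blocks are independent and centred; averaging therefore gains a factor
  \<open>s\<close> in their second moment, and the average estimator is \<open>U + A + D\<close> with \<open>\<parallel>D\<parallel>\<close> of order
  \<open>b\<^sub>N\<close>. Moreover \<open>\<parallel>U\<parallel>\<^sup>2\<close> is \<open>\<sigma>\<^sup>2 / (N h)\<close> up to a diagonal fluctuation and the
  degenerate quadratic form \<open>W / N\<^sup>2\<close>, both of order \<open>1 / (N h\<^sup>1\<^sup>/\<^sup>2)\<close>, and \<open>\<langle>U, A\<rangle>\<close> is of order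
  \<open>N\<^sup>-\<^sup>1\<^sup>/\<^sup>2 \<parallel>f\<parallel>\<close>. Hence \<open>\<parallel>A\<parallel>\<^sup>2\<close>, which is close to \<open>\<parallel>f\<parallel>\<^sup>2\<close>, dominates once \<open>\<parallel>f\<parallel>\<close> is a
  large multiple of \<open>d\<^sub>N\<close>. Only the upper tail of the two-sided test is needed.\<close>

section \<open>Inner products on spaces of functions\<close>

text \<open>The obstacle is the second moment of the noise part of \<open>D\<close> on the event
  that all \<open>\<xi>\<^sub>j\<close> are small. Condition (iv) makes their maximum measurable on
  the probability space, but not with respect to the covariates alone, so this event cannot be
  inserted into a moment computation given the design. The event
  \<open>energy g \<omega> \<le> t\<close> replaces it: for a fixed division \<open>g\<close> the
  energy is a measurable function of the covariates, and it is bounded pointwise in terms of the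
  \<open>\<xi>\<^sub>j\<close>. The random division is averaged out afterwards, by its independence
  of the data.

  Uniformity in \<open>f\<close> comes from the exceptional events. Four of the five do not involve
  \<open>f\<close>; the fifth, which concerns the pairing of \<open>U\<close> with \<open>A\<close>,
  has a threshold proportional to the norm of \<open>f\<close>. The critical value of the test is
  controlled by an upper bound for the standard deviation of \<open>W\<close>, so no limit law for
  \<open>W\<close> enters.

  Measurability has to be proved as well, since the estimator is a Hilbert choice among minimizers
  in a function space without a sigma-algebra. It is recovered as a limit of explicit
  iterates.\<close>

locale fun_ip =
  fixes H :: "('a \<Rightarrow> real) set" and B :: "('a \<Rightarrow> real) \<Rightarrow> ('a \<Rightarrow> real) \<Rightarrow> real"
  assumes zero_in: "(\<lambda>_. 0) \<in> H"
    and add_in: "\<And>f g. f \<in> H \<Longrightarrow> g \<in> H \<Longrightarrow> (\<lambda>x. f x + g x) \<in> H"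
    and scale_in: "\<And>c f. f \<in> H \<Longrightarrow> (\<lambda>x. c * f x) \<in> H"
    and comm: "\<And>f g. f \<in> H \<Longrightarrow> g \<in> H \<Longrightarrow> B f g = B g f"
    and add_left: "\<And>f g k. f \<in> H \<Longrightarrow> g \<in> H \<Longrightarrow> k \<in> H \<Longrightarrow> B (\<lambda>x. f x + g x) k = B f k + B g k"
    and scale_left: "\<And>c f g. f \<in> H \<Longrightarrow> g \<in> H \<Longrightarrow> B (\<lambda>x. c * f x) g = c * B f g"
    and nonneg: "\<And>f. f \<in> H \<Longrightarrow> 0 \<le> B f f"
begin

definition nm :: "('a \<Rightarrow> real) \<Rightarrow> real" where "nm f = sqrt (B f f)"

lemma diff_in: "f \<in> H \<Longrightarrow> g \<in> H \<Longrightarrow> (\<lambda>x. f x - g x) \<in> H"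
  using add_in[OF _ scale_in[of g "-1"], of f] by simp

lemma sum_in: "finite I \<Longrightarrow> (\<And>i. i \<in> I \<Longrightarrow> F i \<in> H) \<Longrightarrow> (\<lambda>x. \<Sum>i\<in>I. F i x) \<in> H"
  by (induction I rule: finite_induct) (auto intro: zero_in add_in)

lemma zero_left: "g \<in> H \<Longrightarrow> B (\<lambda>_. 0) g = 0"
  using scale_left[OF zero_in, of g 0] by simp

lemma zero_right: "g \<in> H \<Longrightarrow> B g (\<lambda>_. 0) = 0"
  using zero_left[of g] comm[of g "\<lambda>_. 0"] by (simp add: zero_in)

lemma diff_left:
  assumes "f \<in> H" "g \<in> H" "k \<in> H" shows "B (\<lambda>x. f x - g x) k = B f k - B g k"
  using add_left[OF assms(1) scale_in[OF assms(2), of "-1"] assms(3)]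
    scale_left[OF assms(2,3), of "-1"] by simp

lemma sum_left: "finite I \<Longrightarrow> (\<And>i. i \<in> I \<Longrightarrow> F i \<in> H) \<Longrightarrow> g \<in> H \<Longrightarrow>
    B (\<lambda>x. \<Sum>i\<in>I. F i x) g = (\<Sum>i\<in>I. B (F i) g)"
proof (induction I rule: finite_induct)
  case (insert i I)
  have "B (\<lambda>x. \<Sum>i\<in>insert i I. F i x) g = B (\<lambda>x. F i x + (\<Sum>i\<in>I. F i x)) g"
    using insert by simp
  also have "\<dots> = B (F i) g + B (\<lambda>x. \<Sum>i\<in>I. F i x) g"
    using insert by (intro add_left sum_in) auto
  finally show ?case using insert by simp
qed (simp add: zero_left)

lemma lin_in: "finite I \<Longrightarrow> (\<And>i. i \<in> I \<Longrightarrow> F i \<in> H) \<Longrightarrow> (\<lambda>x. \<Sum>i\<in>I. c i * F i x) \<in> H"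
  by (intro sum_in scale_in)

lemma lin_left: "finite I \<Longrightarrow> (\<And>i. i \<in> I \<Longrightarrow> F i \<in> H) \<Longrightarrow> g \<in> H \<Longrightarrow>
    B (\<lambda>x. \<Sum>i\<in>I. c i * F i x) g = (\<Sum>i\<in>I. c i * B (F i) g)"
  by (subst sum_left) (auto intro: scale_in scale_left intro!: sum.cong)

lemma lin_right:
  assumes "finite I" "\<And>i. i \<in> I \<Longrightarrow> F i \<in> H" "g \<in> H"
  shows "B g (\<lambda>x. \<Sum>i\<in>I. c i * F i x) = (\<Sum>i\<in>I. c i * B g (F i))"
proof -
  have "B g (\<lambda>x. \<Sum>i\<in>I. c i * F i x) = (\<Sum>i\<in>I. c i * B (F i) g)"
    using assms by (subst comm) (auto intro: lin_in lin_left)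
  also have "\<dots> = (\<Sum>i\<in>I. c i * B g (F i))"
    using assms comm[of g] by (intro sum.cong refl) metis
  finally show ?thesis .
qed

lemma add_right: "f \<in> H \<Longrightarrow> g \<in> H \<Longrightarrow> k \<in> H \<Longrightarrow> B k (\<lambda>x. f x + g x) = B k f + B k g"
  using add_left[of f g k] comm[of k "\<lambda>x. f x + g x"] comm[of k f] comm[of k g] by (simp add: add_in)

lemma diff_right: "f \<in> H \<Longrightarrow> g \<in> H \<Longrightarrow> k \<in> H \<Longrightarrow> B k (\<lambda>x. f x - g x) = B k f - B k g"
  using diff_left[of f g k] comm[of k "\<lambda>x. f x - g x"] comm[of k f] comm[of k g] by (simp add: diff_in)

lemma scale_right: "f \<in> H \<Longrightarrow> g \<in> H \<Longrightarrow> B f (\<lambda>x. c * g x) = c * B f g"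
  using scale_left[of g f c] comm[of f "\<lambda>x. c * g x"] comm[of f g] by (simp add: scale_in)

lemma nm_nonneg: "f \<in> H \<Longrightarrow> 0 \<le> nm f"
  by (simp add: nm_def nonneg)

lemma nm_sq: "f \<in> H \<Longrightarrow> (nm f)\<^sup>2 = B f f"
  by (simp add: nm_def nonneg)

lemma B_add_sq:
  assumes "f \<in> H" "g \<in> H"
  shows "B (\<lambda>x. f x + g x) (\<lambda>x. f x + g x) = B f f + 2 * B f g + B g g"
  using assms by (simp add: add_left add_right add_in comm[of g f])

text \<open>The square of \<open>f + t g\<close> is a nonnegative polynomial in \<open>t\<close> of
  degree at most two. Forms in \<open>fun_ip\<close> are only required to be semidefinite, so
  \<open>B g g = 0\<close> does not give \<open>g = 0\<close> and needs its own argument.\<close>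

lemma cauchy_schwarz_sq:
  assumes f: "f \<in> H" and g: "g \<in> H" shows "(B f g)\<^sup>2 \<le> B f f * B g g"
proof -
  have q: "0 \<le> B f f + 2 * t * B f g + t\<^sup>2 * B g g" for t
  proof -
    have "0 \<le> B (\<lambda>x. f x + t * g x) (\<lambda>x. f x + t * g x)"
      using f g by (intro nonneg add_in scale_in)
    also have "\<dots> = B f f + 2 * t * B f g + t\<^sup>2 * B g g"
      using f g by (subst B_add_sq)
        (auto simp: scale_in scale_left scale_right power2_eq_square)
    finally show ?thesis .
  qed
  show ?thesis
  proof (cases "B g g = 0")
    case True
    have "B f g = 0"
    proof (rule ccontr)
      assume "B f g \<noteq> 0"
      \<comment> \<open>At this \<open>t\<close> the affine function
        \<open>B f f + 2 * t * B f g\<close> has the value -1.\<close>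
      then show False using q[of "-(B f f + 1) / (2 * B f g)"] True by (simp add: field_simps)
    qed
    then show ?thesis using True by simp
  next
    case False
    then have "B g g > 0" using nonneg[OF g] by simp
    then show ?thesis using q[of "- B f g / B g g"]
      by (simp add: field_simps power2_eq_square)
  qed
qed

lemma cauchy_schwarz: "f \<in> H \<Longrightarrow> g \<in> H \<Longrightarrow> \<bar>B f g\<bar> \<le> nm f * nm g"
  unfolding nm_def real_sqrt_mult[symmetric]
  by (rule real_le_rsqrt) (simp add: cauchy_schwarz_sq)

lemma nm_scale: "f \<in> H \<Longrightarrow> nm (\<lambda>x. c * f x) = \<bar>c\<bar> * nm f"
  by (simp add: nm_def scale_in scale_left scale_right real_sqrt_mult[symmetric] nonneg)
     (simp add: real_sqrt_mult mult.assoc[symmetric])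

lemma nm_triangle:
  assumes f: "f \<in> H" and g: "g \<in> H" shows "nm (\<lambda>x. f x + g x) \<le> nm f + nm g"
proof -
  have "(nm (\<lambda>x. f x + g x))\<^sup>2 = (nm f)\<^sup>2 + 2 * B f g + (nm g)\<^sup>2"
    using f g by (simp add: nm_sq add_in B_add_sq)
  also have "\<dots> \<le> (nm f + nm g)\<^sup>2"
    using cauchy_schwarz[OF f g] by (simp add: power2_sum)
  finally show ?thesis
    by (rule power2_le_imp_le) (simp add: f g nm_nonneg)
qed

lemma nm_minus: "f \<in> H \<Longrightarrow> g \<in> H \<Longrightarrow> nm (\<lambda>x. f x - g x) = nm (\<lambda>x. g x - f x)"
  using nm_scale[OF diff_in[of f g], of "-1"] by simp

lemma nm_triangle_diff:
  assumes f: "f \<in> H" and g: "g \<in> H" shows "nm f - nm g \<le> nm (\<lambda>x. f x - g x)"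
  using nm_triangle[OF diff_in[OF f g] g] by simp

lemma nm_triangle_mid:
  assumes "f \<in> H" "g \<in> H" "k \<in> H"
  shows "nm (\<lambda>x. f x - k x) \<le> nm (\<lambda>x. f x - g x) + nm (\<lambda>x. g x - k x)"
  using nm_triangle[OF diff_in[OF assms(1,2)] diff_in[OF assms(2,3)]] by simp

lemma nm_zero: "nm (\<lambda>_. 0) = 0"
  by (simp add: nm_def zero_left zero_in)

lemma nm_sum: "finite I \<Longrightarrow> (\<And>i. i \<in> I \<Longrightarrow> F i \<in> H) \<Longrightarrow> nm (\<lambda>x. \<Sum>i\<in>I. F i x) \<le> (\<Sum>i\<in>I. nm (F i))"
proof (induction I rule: finite_induct)
  case (insert i I)
  have "nm (\<lambda>x. F i x + (\<Sum>i\<in>I. F i x)) \<le> nm (F i) + nm (\<lambda>x. \<Sum>i\<in>I. F i x)"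
    using insert by (intro nm_triangle sum_in) auto
  then show ?case using insert by fastforce
qed (simp add: nm_zero)

lemma B_tendsto:
  assumes F: "\<And>m. F m \<in> H" and u: "u \<in> H" and g: "g \<in> H"
    and lim: "(\<lambda>m. nm (\<lambda>x. F m x - u x)) \<longlonglongrightarrow> 0"
  shows "(\<lambda>m. B (F m) g) \<longlonglongrightarrow> B u g"
proof -
  have "(\<lambda>m. nm (\<lambda>x. F m x - u x) * nm g) \<longlonglongrightarrow> 0"
    using tendsto_mult[OF lim tendsto_const] by simp
  then have "(\<lambda>m. B (F m) g - B u g) \<longlonglongrightarrow> 0"
    by (rule Lim_null_comparison[rotated])
       (use cauchy_schwarz[OF diff_in[OF F u] g] in \<open>simp add: diff_left F u g\<close>)
  then show ?thesis by (simp add: LIM_zero_iff)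
qed

lemma B_lin_sq:
  assumes "finite I" "\<And>i. i \<in> I \<Longrightarrow> F i \<in> H"
  shows "B (\<lambda>x. \<Sum>i\<in>I. c i * F i x) (\<lambda>x. \<Sum>i\<in>I. c i * F i x) = (\<Sum>i\<in>I. \<Sum>k\<in>I. c i * c k * B (F i) (F k))"
  using assms by (simp add: lin_left lin_right lin_in sum_distrib_left mult.assoc)

end

lemma abs_mult_le_squares: "\<bar>a * b\<bar> \<le> a\<^sup>2 + b\<^sup>2" for a b :: real
proof -
  have "0 \<le> (\<bar>a\<bar> - \<bar>b\<bar>)\<^sup>2" "0 \<le> \<bar>a\<bar> * \<bar>b\<bar>" by simp_all
  then show ?thesis unfolding power2_diff power2_abs abs_mult by linarith
qed

text \<open>Testing an equation with its own unknown bounds a squared norm by a multiple of that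
  norm. This lemma cancels one factor without asking whether it is zero.\<close>

lemma le_of_mult_self_le: "0 \<le> b \<Longrightarrow> a * a \<le> b * a \<Longrightarrow> a \<le> b" for a b :: real
  by (cases "a \<le> 0") (auto simp: mult_le_cancel_right)

lemma shrink_eq: "0 < lam \<Longrightarrow> 0 \<le> m \<Longrightarrow> shrink lam m = m / (m + lam)"
  by (cases "m = 0") (simp_all add: shrink_def add_divide_eq_iff)

lemma shrink_bounds: "0 < lam \<Longrightarrow> 0 \<le> m \<Longrightarrow> 0 \<le> shrink lam m \<and> shrink lam m \<le> 1"
  by (auto simp: shrink_eq field_simps)

lemma L2_mult_integrable:
  assumes "f \<in> L2_space Q" "g \<in> L2_space Q" shows "integrable Q (\<lambda>x. f x * g x)"
proof (rule Bochner_Integration.integrable_bound[of _ "\<lambda>x. (f x)\<^sup>2 + (g x)\<^sup>2"])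
  show "AE x in Q. norm (f x * g x) \<le> norm ((f x)\<^sup>2 + (g x)\<^sup>2)"
    using abs_mult_le_squares[of "f _" "g _"] by (intro AE_I2) simp
qed (use assms in \<open>auto simp: L2_space_def\<close>)

lemma (in rkhs) fun_ip_ip: "fun_ip H ip"
  using zero_mem add_mem scale_mem ip_commute ip_add ip_scale ip_nonneg
  by unfold_locales

lemma (in eigen_rkhs) fun_ip_L2: "fun_ip H (L2_inner Q)"
proof
  fix f g k assume H: "f \<in> H" "g \<in> H" "k \<in> H"
  then have "integrable Q (\<lambda>x. f x * k x)" "integrable Q (\<lambda>x. g x * k x)"
    using H_L2 by (auto intro: L2_mult_integrable)
  then show "L2_inner Q (\<lambda>x. f x + g x) k = L2_inner Q f k + L2_inner Q g k"
    by (simp add: L2_inner_def ring_distribs)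
qed (auto simp: L2_inner_def zero_mem add_mem scale_mem mult_ac)

definition ridge_ip :: "'a measure \<Rightarrow> (('a \<Rightarrow> real) \<Rightarrow> ('a \<Rightarrow> real) \<Rightarrow> real) \<Rightarrow> real \<Rightarrow> ('a \<Rightarrow> real) \<Rightarrow> ('a \<Rightarrow> real) \<Rightarrow> real"
  where "ridge_ip Q ip lam f g = L2_inner Q f g + lam * ip f g"

lemma (in eigen_rkhs) fun_ip_ridge:
  assumes "0 \<le> lam" shows "fun_ip H (ridge_ip Q ip lam)"
proof -
  interpret h: fun_ip H ip by (rule fun_ip_ip)
  interpret l: fun_ip H "L2_inner Q" by (rule fun_ip_L2)
  show ?thesis
  proof
    show "ridge_ip Q ip lam f g = ridge_ip Q ip lam g f" if "f \<in> H" "g \<in> H" for f g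
      unfolding ridge_ip_def using h.comm[OF that] l.comm[OF that] by simp
  qed (auto simp: ridge_ip_def h.zero_in h.add_in h.scale_in h.add_left l.add_left
        h.scale_left l.scale_left ring_distribs assms h.nonneg l.nonneg)
qed

section \<open>Expansions in a bounded eigenbasis\<close>

text \<open>Condition (iii) enters through \<open>\<phi>_bound\<close> and
  \<open>\<mu>_summable\<close>. Together they bound \<open>R x x\<close> uniformly, so that
  convergence in the norm of \<open>H\<close> is uniform convergence on \<open>\<X>\<close>.\<close>

locale bounded_eigen_rkhs = eigen_rkhs \<X> H ip R Q \<mu> \<phi> + prob_space Q
  for \<X> :: "'a set" and H ip R Q \<mu> \<phi> +
  fixes c\<phi> :: real
  assumes space_Q: "space Q = \<X>"
    and \<phi>_bound: "\<And>i x. i \<ge> 1 \<Longrightarrow> x \<in> \<X> \<Longrightarrow> \<bar>\<phi> i x\<bar> \<le> c\<phi>"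
    and \<mu>_summable: "summable (\<lambda>k. \<mu> (Suc k))"
begin

sublocale h: fun_ip H ip by (rule fun_ip_ip)
sublocale l: fun_ip H "L2_inner Q" by (rule fun_ip_L2)

text \<open>Directions of eigenvalue 0, which need not lie in \<open>H\<close>, are replaced by 0.\<close>

definition \<psi> :: "nat \<Rightarrow> 'a \<Rightarrow> real" where
  "\<psi> k = (if \<mu> (Suc k) = 0 then (\<lambda>_. 0) else \<phi> (Suc k))"

abbreviation m :: "nat \<Rightarrow> real" where "m k \<equiv> \<mu> (Suc k)"

lemma m_nonneg [simp]: "0 \<le> m k" by (simp add: \<mu>_nonneg)

lemma \<psi>_in [simp]: "\<psi> k \<in> H"
  by (auto simp: \<psi>_def zero_mem \<phi>_mem)

lemma ip_\<psi>: "ip (\<psi> j) (\<psi> k) = (if j = k then 1 / m k else 0)"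
  by (auto simp: \<psi>_def h.zero_left h.zero_right \<phi>_mem zero_mem \<phi>_ip)

lemma L2_\<psi>: "L2_inner Q (\<psi> j) (\<psi> k) = (if j = k \<and> m k \<noteq> 0 then 1 else 0)"
  by (auto simp: \<psi>_def l.zero_left l.zero_right \<phi>_mem zero_mem \<phi>_orthonormal)

lemma c\<phi>_nonneg: "0 \<le> c\<phi>"
proof -
  obtain x where "x \<in> \<X>" using not_empty space_Q by auto
  then show ?thesis using \<phi>_bound[of 1 x] by force
qed

lemma \<psi>_bound: "\<bar>\<psi> k x\<bar> \<le> c\<phi>"
proof (cases "x \<in> \<X>")
  case True then show ?thesis by (auto simp: \<psi>_def \<phi>_bound c\<phi>_nonneg)
next
  case False then show ?thesis using supp[OF \<psi>_in] by (simp add: c\<phi>_nonneg)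
qed

lemma \<psi>_sq_bound: "(\<psi> k x)\<^sup>2 \<le> c\<phi>\<^sup>2"
  using power_mono[OF \<psi>_bound[of k x], of 2] by simp

lemma summable_\<psi>:
  assumes "\<And>k. 0 \<le> w k" "summable w" shows "summable (\<lambda>k. w k * (\<psi> k x)\<^sup>2)"
proof (rule summable_comparison_test')
  show "summable (\<lambda>k. w k * c\<phi>\<^sup>2)" by (intro summable_mult2 assms)
qed (use assms \<psi>_sq_bound in \<open>auto intro: mult_left_mono\<close>)

text \<open>As \<open>ip (\<psi> k) (\<psi> k) = 1 / m k\<close>, the hypothesis says that the
  orthogonal terms have summable squared norms, and completeness gives the limit. An index with
  \<open>m k = 0\<close> contributes nothing on either side: \<open>\<psi> k\<close> is zero there,
  and HOL evaluates the quotient to 0.\<close>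

lemma series:
  assumes "summable (\<lambda>k. (c k)\<^sup>2 / m k)"
  obtains u where "u \<in> H" "(\<lambda>t. h.nm (\<lambda>x. (\<Sum>k<t. c k * \<psi> k x) - u x)) \<longlonglongrightarrow> 0"
proof -
  let ?S = "\<lambda>t x. \<Sum>k<t. c k * \<psi> k x"
  let ?q = "\<lambda>t. \<Sum>k<t. (c k)\<^sup>2 / m k"
  have S: "?S t \<in> H" for t by (intro h.lin_in) auto
  have dist: "ip (\<lambda>x. ?S t x - ?S l x) (\<lambda>x. ?S t x - ?S l x) = ?q t - ?q l" if "l \<le> t" for t l
  proof -
    have "(\<lambda>x. ?S t x - ?S l x) = (\<lambda>x. \<Sum>k\<in>{l..<t}. c k * \<psi> k x)"
      using that by (auto simp: fun_eq_iff lessThan_atLeast0 sum_diff_nat_ivl)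
    then have "ip (\<lambda>x. ?S t x - ?S l x) (\<lambda>x. ?S t x - ?S l x)
        = (\<Sum>i\<in>{l..<t}. \<Sum>k\<in>{l..<t}. c i * c k * ip (\<psi> i) (\<psi> k))"
      by (simp add: h.B_lin_sq)
    also have "\<dots> = (\<Sum>i\<in>{l..<t}. (c i)\<^sup>2 / m i)"
      by (intro sum.cong refl) (simp add: ip_\<psi> power2_eq_square if_distrib[of "\<lambda>u. _ * u"] sum.delta cong: if_cong)
    also have "\<dots> = ?q t - ?q l" using that by (simp add: lessThan_atLeast0 sum_diff_nat_ivl)
    finally show ?thesis .
  qed
  have dist': "ip (\<lambda>x. ?S t x - ?S l x) (\<lambda>x. ?S t x - ?S l x) = \<bar>?q t - ?q l\<bar>" for t l
  proof (cases "l \<le> t")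
    case True
    then show ?thesis using dist[OF True] h.nonneg[OF h.diff_in[OF S S], of t l] by simp
  next
    case False
    then have "l \<ge> t" by simp
    have "ip (\<lambda>x. ?S t x - ?S l x) (\<lambda>x. ?S t x - ?S l x) = ip (\<lambda>x. ?S l x - ?S t x) (\<lambda>x. ?S l x - ?S t x)"
      using h.nm_minus[OF S S, of t l] unfolding h.nm_def by simp
    then show ?thesis using dist[OF \<open>l \<ge> t\<close>] h.nonneg[OF h.diff_in[OF S S], of l t] by simp
  qed
  have "Cauchy ?q" using assms by (simp add: summable_iff_convergent convergent_Cauchy)
  have "\<exists>m0. \<forall>t\<ge>m0. \<forall>l\<ge>m0. sqrt (ip (\<lambda>x. ?S t x - ?S l x) (\<lambda>x. ?S t x - ?S l x)) < e" if "e > 0" for e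
  proof -
    have "0 < e\<^sup>2" using that by simp
    with \<open>Cauchy ?q\<close> obtain m0 where m0: "\<And>t l. t \<ge> m0 \<Longrightarrow> l \<ge> m0 \<Longrightarrow> dist (?q t) (?q l) < e\<^sup>2"
      unfolding Cauchy_def by blast
    have "sqrt \<bar>?q t - ?q l\<bar> < e" if "t \<ge> m0" "l \<ge> m0" for t l
      using m0[OF that] \<open>e > 0\<close> by (intro real_less_lsqrt) (auto simp: dist_real_def)
    then show ?thesis unfolding dist' by blast
  qed
  from complete[of ?S, OF S this] obtain u where "u \<in> H"
    "(\<lambda>t. sqrt (ip (\<lambda>x. ?S t x - u x) (\<lambda>x. ?S t x - u x))) \<longlonglongrightarrow> 0" by blast
  then show ?thesis using that[of u] unfolding h.nm_def by simp
qed

lemma lim_ip: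
  assumes "u \<in> H" "(\<lambda>t. h.nm (\<lambda>x. (\<Sum>k<t. c k * \<psi> k x) - u x)) \<longlonglongrightarrow> 0" "g \<in> H"
  shows "(\<lambda>k. c k * ip (\<psi> k) g) sums ip u g"
  using h.B_tendsto[of "\<lambda>t x. \<Sum>k<t. c k * \<psi> k x", OF h.lin_in assms(1,3,2)] unfolding sums_def
  by (simp add: h.lin_left assms(3))

lemma lim_eval:
  assumes u: "u \<in> H" and lim: "(\<lambda>t. h.nm (\<lambda>x. (\<Sum>k<t. c k * \<psi> k x) - u x)) \<longlonglongrightarrow> 0"
  shows "(\<lambda>k. c k * \<psi> k x) sums u x"
proof (cases "x \<in> \<X>")
  case True
  then show ?thesis
    using lim_ip[OF u lim kernel_mem[OF True]] by (simp add: reproducing u)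
next
  case False
  then show ?thesis using supp[OF \<psi>_in False] supp[OF u False] by simp
qed

lemma kernel_sums: "x \<in> \<X> \<Longrightarrow> y \<in> \<X> \<Longrightarrow> (\<lambda>k. m k * \<psi> k x * \<psi> k y) sums R x y"
  using kernel_series[of x y] by (rule sums_cong[THEN iffD1, rotated]) (auto simp: \<psi>_def)

text \<open>The series of the kernel is assumed to converge only pointwise. Its coefficients are
  admissible in \<open>series\<close>, so it also has a limit in norm, and equality of the pointwise
  values identifies this limit with \<open>R x\<close>.\<close>

lemma kernel_lim:
  assumes x: "x \<in> \<X>"
  shows "(\<lambda>t. h.nm (\<lambda>y. (\<Sum>k<t. (m k * \<psi> k x) * \<psi> k y) - R x y)) \<longlonglongrightarrow> 0"
proof -
  have "summable (\<lambda>k. m k * (\<psi> k x)\<^sup>2)" by (intro summable_\<psi> \<mu>_summable m_nonneg)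
  then have "summable (\<lambda>k. (m k * \<psi> k x)\<^sup>2 / m k)"
    by (rule summable_cong[THEN iffD1, rotated]) (auto intro!: always_eventually simp: power2_eq_square)
  from series[OF this] obtain u where u: "u \<in> H"
    and lim: "(\<lambda>t. h.nm (\<lambda>y. (\<Sum>k<t. (m k * \<psi> k x) * \<psi> k y) - u y)) \<longlonglongrightarrow> 0" .
  have "u y = R x y" for y
  proof (cases "y \<in> \<X>")
    case True
    from lim_eval[OF u lim, of y] kernel_sums[OF x True] show ?thesis by (rule sums_unique2)
  next
    case False
    then show ?thesis using supp[OF u] supp[OF kernel_mem[OF x]] by simp
  qed
  then show ?thesis using lim by simp
qed

text \<open>The norm convergent series of \<open>R x\<close> is paired with \<open>f\<close>. Since
  \<open>f\<close> is arbitrary, this says that the \<open>\<psi> k\<close> determine every element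
  of \<open>H\<close>.\<close>

lemma eval_sums:
  assumes "f \<in> H" "x \<in> \<X>" shows "(\<lambda>k. m k * \<psi> k x * ip (\<psi> k) f) sums f x"
  using lim_ip[OF kernel_mem[OF assms(2)] kernel_lim[OF assms(2)] assms(1)]
    h.comm[OF assms(1) kernel_mem[OF assms(2)]] reproducing[OF assms] by simp

lemma bessel:
  assumes f: "f \<in> H" shows "(\<Sum>k<t. m k * (ip (\<psi> k) f)\<^sup>2) \<le> ip f f"
proof -
  let ?c = "\<lambda>k. m k * ip (\<psi> k) f"
  let ?S = "\<lambda>x. \<Sum>k<t. ?c k * \<psi> k x"
  have S: "?S \<in> H" by (intro h.lin_in) auto
  have Sf: "ip ?S f = (\<Sum>k<t. m k * (ip (\<psi> k) f)\<^sup>2)"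
    by (subst h.lin_left) (auto simp: f power2_eq_square mult.assoc)
  have SS: "ip ?S ?S = (\<Sum>k<t. m k * (ip (\<psi> k) f)\<^sup>2)"
    by (subst h.B_lin_sq)
       (auto simp: ip_\<psi> power2_eq_square if_distrib[of "\<lambda>u. _ * u"] sum.delta intro!: sum.cong cong: if_cong)
  have "0 \<le> ip (\<lambda>x. f x - ?S x) (\<lambda>x. f x - ?S x)" using f S by (intro h.nonneg h.diff_in)
  also have "\<dots> = ip f f - 2 * ip ?S f + ip ?S ?S"
    using f S by (simp add: h.diff_left h.diff_right h.diff_in h.comm[of f ?S])
  finally show ?thesis unfolding Sf SS by simp
qed

lemma coef_summable:
  assumes f: "f \<in> H" shows "summable (\<lambda>k. m k * (ip (\<psi> k) f)\<^sup>2)"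
  by (rule summableI_nonneg_bounded[where x="ip f f"]) (auto intro: bessel[OF f])

text \<open>By \<open>bessel\<close> the coefficients of \<open>f\<close> are admissible in
  \<open>series\<close>. The limit has the same values as \<open>f\<close> by
  \<open>eval_sums\<close>, hence equals \<open>f\<close>; so the \<open>\<psi> k\<close> form a
  complete orthogonal system of \<open>H\<close>.\<close>

lemma expansion:
  assumes f: "f \<in> H"
  shows "(\<lambda>t. h.nm (\<lambda>y. (\<Sum>k<t. (m k * ip (\<psi> k) f) * \<psi> k y) - f y)) \<longlonglongrightarrow> 0"
proof -
  from coef_summable[OF f] have "summable (\<lambda>k. (m k * ip (\<psi> k) f)\<^sup>2 / m k)"
    by (rule summable_cong[THEN iffD1, rotated]) (auto intro!: always_eventually simp: power2_eq_square)
  from series[OF this] obtain u where u: "u \<in> H"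
    and lim: "(\<lambda>t. h.nm (\<lambda>y. (\<Sum>k<t. (m k * ip (\<psi> k) f) * \<psi> k y) - u y)) \<longlonglongrightarrow> 0" .
  have "u y = f y" for y
  proof (cases "y \<in> \<X>")
    case True
    from lim_eval[OF u lim, of y] eval_sums[OF f True] show ?thesis
      by (simp add: sums_unique2 mult_ac)
  next
    case False
    then show ?thesis using supp[OF u] supp[OF f] by simp
  qed
  then show ?thesis using lim by simp
qed

lemma parseval:
  "f \<in> H \<Longrightarrow> g \<in> H \<Longrightarrow> (\<lambda>k. m k * ip (\<psi> k) f * ip (\<psi> k) g) sums ip f g"
  using lim_ip[OF _ expansion] by simp

text \<open>A uniform bound for the norm of \<open>R x\<close>, hence for every point evaluation. It
  fixes the step size of the descent below.\<close>

definition \<kappa> :: real where "\<kappa> = sqrt (c\<phi>\<^sup>2 * (\<Sum>k. m k))"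

lemma \<kappa>_nonneg: "0 \<le> \<kappa>"
  by (simp add: \<kappa>_def suminf_nonneg \<mu>_summable)

lemma kernel_diag_le: "x \<in> \<X> \<Longrightarrow> R x x \<le> \<kappa>\<^sup>2"
proof -
  assume x: "x \<in> \<X>"
  have "R x x = (\<Sum>k. m k * (\<psi> k x)\<^sup>2)"
    using kernel_sums[OF x x] by (simp add: sums_iff power2_eq_square mult.assoc)
  also have "\<dots> \<le> (\<Sum>k. m k * c\<phi>\<^sup>2)"
    by (intro suminf_le summable_\<psi> summable_mult2 \<mu>_summable mult_left_mono \<psi>_sq_bound m_nonneg)
  also have "\<dots> = \<kappa>\<^sup>2"
    using suminf_nonneg[OF \<mu>_summable] by (simp add: \<kappa>_def suminf_mult2[symmetric] \<mu>_summable mult.commute)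
  finally show ?thesis .
qed

lemma nm_kernel_le: "x \<in> \<X> \<Longrightarrow> h.nm (R x) \<le> \<kappa>"
  using kernel_diag_le[of x] unfolding h.nm_def
  by (simp add: reproducing kernel_mem real_le_lsqrt \<kappa>_nonneg)

lemma eval_le: "f \<in> H \<Longrightarrow> x \<in> \<X> \<Longrightarrow> \<bar>f x\<bar> \<le> \<kappa> * h.nm f"
  using h.cauchy_schwarz[of f "R x"] nm_kernel_le[of x] h.nm_nonneg[of f]
  by (simp add: reproducing kernel_mem)
     (metis mult.commute mult_right_mono order_trans)

lemma H_measurable: "f \<in> H \<Longrightarrow> f \<in> borel_measurable Q"
  using H_L2 by (auto simp: L2_space_def)

lemma L2_nm_le:
  assumes f: "f \<in> H" shows "l.nm f \<le> \<kappa> * h.nm f"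
proof -
  have "L2_inner Q f f \<le> (\<integral>x. (\<kappa> * h.nm f)\<^sup>2 \<partial>Q)"
    unfolding L2_inner_def
  proof (rule integral_mono_AE)
    show "AE x in Q. f x * f x \<le> (\<kappa> * h.nm f)\<^sup>2"
      using eval_le[OF f] by (intro AE_I2) (auto simp: space_Q power2_eq_square[symmetric] abs_le_square_iff[symmetric]
        intro: order_trans[OF _ abs_ge_self])
  qed (use f H_L2 in \<open>auto intro: L2_mult_integrable\<close>)
  then show ?thesis unfolding l.nm_def
    using f by (intro real_le_lsqrt) (auto simp: prob_space \<kappa>_nonneg h.nm_nonneg)
qed

lemma L2_lim:
  assumes F: "\<And>t. F t \<in> H" and u: "u \<in> H" and g: "g \<in> H"
    and lim: "(\<lambda>t. h.nm (\<lambda>x. F t x - u x)) \<longlonglongrightarrow> 0"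
  shows "(\<lambda>t. L2_inner Q (F t) g) \<longlonglongrightarrow> L2_inner Q u g"
proof (rule l.B_tendsto[OF F u g])
  have "(\<lambda>t. \<kappa> * h.nm (\<lambda>x. F t x - u x)) \<longlonglongrightarrow> 0"
    using tendsto_mult[OF tendsto_const lim] by simp
  then show "(\<lambda>t. l.nm (\<lambda>x. F t x - u x)) \<longlonglongrightarrow> 0"
    by (rule Lim_null_comparison[rotated])
       (simp add: L2_nm_le l.nm_nonneg h.diff_in F u)
qed

text \<open>The forms \<open>ip\<close> and \<open>L2_inner Q\<close> are diagonal in the same
  system. Hence the ridge form is diagonal too, with the factor \<open>m k + lam\<close> relative to
  \<open>ip\<close>, and its problems are solved coefficient by coefficient.\<close>

lemma L2_\<psi>_eq: "f \<in> H \<Longrightarrow> L2_inner Q (\<psi> k) f = m k * ip (\<psi> k) f"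
proof -
  assume f: "f \<in> H"
  let ?c = "\<lambda>k. m k * ip (\<psi> k) f"
  have "(\<lambda>t. L2_inner Q (\<lambda>x. \<Sum>j<t. ?c j * \<psi> j x) (\<psi> k)) \<longlonglongrightarrow> L2_inner Q f (\<psi> k)"
    by (rule L2_lim[OF _ f _ expansion[OF f]]) (auto intro: h.lin_in)
  then have "(\<lambda>j. ?c j * L2_inner Q (\<psi> j) (\<psi> k)) sums L2_inner Q f (\<psi> k)"
    by (simp add: l.lin_left sums_def)
  moreover have "(\<lambda>j. if j = k then ?c j else 0) sums ?c k" by (rule sums_single)
  moreover have "(\<lambda>j. ?c j * L2_inner Q (\<psi> j) (\<psi> k)) = (\<lambda>j. if j = k then ?c j else 0)"
    by (auto simp: L2_\<psi>)
  ultimately show ?thesis using f by (simp add: sums_unique2 l.comm[of f "\<psi> k"])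
qed

lemma L2_sums:
  assumes "f \<in> H" "g \<in> H"
  shows "(\<lambda>k. m k * ip (\<psi> k) f * (m k * ip (\<psi> k) g)) sums L2_inner Q f g"
proof -
  have "(\<lambda>t. L2_inner Q (\<lambda>x. \<Sum>j<t. (m j * ip (\<psi> j) f) * \<psi> j x) g) \<longlonglongrightarrow> L2_inner Q f g"
    by (rule L2_lim[OF _ _ _ expansion]) (auto intro: h.lin_in assms)
  then show ?thesis by (simp add: l.lin_left sums_def L2_\<psi>_eq assms)
qed

end

section \<open>The ridge inner product, its kernel and the population smoother\<close>

context bounded_eigen_rkhs
begin

lemma shrink_summable: "0 < lam \<Longrightarrow> summable (\<lambda>k. shrink lam (m k))"
proof (rule summable_comparison_test')
  assume lam: "0 < lam"
  show "summable (\<lambda>k. m k * (1 / lam))" by (intro summable_mult2 \<mu>_summable)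
  fix k show "norm (shrink lam (m k)) \<le> m k * (1 / lam)"
    using lam by (auto simp: shrink_eq divide_simps) (auto simp: algebra_simps intro: mult_right_mono)
qed

context
  fixes lam :: real
  assumes lam: "0 < lam"
begin

interpretation r: fun_ip H "ridge_ip Q ip lam" using lam by (intro fun_ip_ridge) simp

abbreviation K :: "'a \<Rightarrow> 'a \<Rightarrow> real" where "K \<equiv> ridge_kernel \<mu> \<phi> lam"

lemma ridge_\<psi>: "f \<in> H \<Longrightarrow> ridge_ip Q ip lam (\<psi> k) f = (m k + lam) * ip (\<psi> k) f"
  by (simp add: ridge_ip_def L2_\<psi>_eq ring_distribs)

lemma ridge_nm_le: "f \<in> H \<Longrightarrow> sqrt lam * h.nm f \<le> r.nm f"
  unfolding h.nm_def r.nm_def ridge_ip_def using l.nonneg[of f]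
  by (simp add: real_sqrt_mult[symmetric])

lemma L2_le_ridge: "f \<in> H \<Longrightarrow> l.nm f \<le> r.nm f"
  unfolding l.nm_def r.nm_def ridge_ip_def using h.nonneg[of f] lam by simp

lemma ridge_lim:
  assumes "u \<in> H" "(\<lambda>t. h.nm (\<lambda>x. (\<Sum>k<t. c k * \<psi> k x) - u x)) \<longlonglongrightarrow> 0" "g \<in> H"
  shows "(\<lambda>k. c k * (m k + lam) * ip (\<psi> k) g) sums ridge_ip Q ip lam u g"
proof -
  have "(\<lambda>t. L2_inner Q (\<lambda>x. \<Sum>k<t. c k * \<psi> k x) g) \<longlonglongrightarrow> L2_inner Q u g"
    by (rule L2_lim) (auto intro: h.lin_in assms)
  then have "(\<lambda>k. c k * L2_inner Q (\<psi> k) g) sums L2_inner Q u g"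
    by (simp add: l.lin_left sums_def assms)
  moreover have "(\<lambda>k. lam * (c k * ip (\<psi> k) g)) sums (lam * ip u g)"
    by (intro sums_mult lim_ip assms)
  ultimately have "(\<lambda>k. c k * L2_inner Q (\<psi> k) g + lam * (c k * ip (\<psi> k) g)) sums ridge_ip Q ip lam u g"
    unfolding ridge_ip_def by (rule sums_add)
  then show ?thesis by (simp add: L2_\<psi>_eq assms algebra_simps)
qed

lemma shrink_mult: "shrink lam (m k) * (m k + lam) = m k"
proof -
  have "0 < m k + lam" using lam m_nonneg[of k] by linarith
  then show ?thesis using lam by (simp add: shrink_eq)
qed

lemma shrink_sq_le: "(shrink lam (m k))\<^sup>2 / m k \<le> m k * (1 / lam\<^sup>2)"
proof -
  have "shrink lam (m k) \<le> m k / lam"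
    using lam m_nonneg[of k] by (simp add: shrink_eq frac_le)
  then have "(shrink lam (m k))\<^sup>2 \<le> (m k / lam)\<^sup>2"
    using shrink_bounds[OF lam, of "m k"] by (intro power_mono) auto
  then have "(shrink lam (m k))\<^sup>2 / m k \<le> (m k / lam)\<^sup>2 / m k"
    by (intro divide_right_mono) auto
  also have "\<dots> = m k * (1 / lam\<^sup>2)" by (simp add: power2_eq_square)
  finally show ?thesis .
qed

lemma ridge_kernel_eq: "K x y = (\<Sum>k. shrink lam (m k) * \<psi> k x * \<psi> k y)"
  unfolding ridge_kernel_def by (rule suminf_cong) (auto simp: \<psi>_def shrink_def)

text \<open>By \<open>shrink_sq_le\<close> the squared coefficients of \<open>K x\<close>, divided
  by \<open>m k\<close>, are at most a multiple of \<open>m k * (\<psi> k x)\<^sup>2\<close>, which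
  is summable because the eigenfunctions are bounded. So the pointwise series that defines
  \<open>K x\<close> also converges in \<open>H\<close>.\<close>

lemma ridge_kernel_lim:
  shows ridge_kernel_mem: "K x \<in> H"
    and "(\<lambda>t. h.nm (\<lambda>y. (\<Sum>k<t. (shrink lam (m k) * \<psi> k x) * \<psi> k y) - K x y)) \<longlonglongrightarrow> 0"
proof -
  have "summable (\<lambda>k. (m k * (1 / lam\<^sup>2)) * (\<psi> k x)\<^sup>2)"
    by (intro summable_\<psi> summable_mult2 \<mu>_summable) simp
  then have "summable (\<lambda>k. (shrink lam (m k) * \<psi> k x)\<^sup>2 / m k)"
  proof (rule summable_comparison_test'[where N=0])
    fix k
    show "norm ((shrink lam (m k) * \<psi> k x)\<^sup>2 / m k) \<le> (m k * (1 / lam\<^sup>2)) * (\<psi> k x)\<^sup>2"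
      using mult_right_mono[OF shrink_sq_le[of k], of "(\<psi> k x)\<^sup>2"]
      by (simp add: power_mult_distrib)
  qed
  from series[OF this] obtain u where u: "u \<in> H"
    and lim: "(\<lambda>t. h.nm (\<lambda>y. (\<Sum>k<t. (shrink lam (m k) * \<psi> k x) * \<psi> k y) - u y)) \<longlonglongrightarrow> 0" .
  have "u y = K x y" for y
    using lim_eval[OF u lim, of y] unfolding ridge_kernel_eq by (simp add: sums_iff)
  then have "u = K x" by auto
  then show "K x \<in> H" "(\<lambda>t. h.nm (\<lambda>y. (\<Sum>k<t. (shrink lam (m k) * \<psi> k x) * \<psi> k y) - K x y)) \<longlonglongrightarrow> 0"
    using u lim by auto
qed

text \<open>\<open>shrink lam (m k)\<close> turns the factor \<open>m k + lam\<close> of the ridge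
  form into \<open>m k\<close>, and what remains is the series of \<open>g x\<close> from
  \<open>eval_sums\<close>.\<close>

lemma ridge_kernel_reproducing:
  assumes g: "g \<in> H" and x: "x \<in> \<X>" shows "ridge_ip Q ip lam (K x) g = g x"
proof -
  have "(\<lambda>k. shrink lam (m k) * \<psi> k x * (m k + lam) * ip (\<psi> k) g) sums ridge_ip Q ip lam (K x) g"
    by (rule ridge_lim[OF ridge_kernel_lim g])
  moreover have "shrink lam (m k) * \<psi> k x * (m k + lam) * ip (\<psi> k) g = m k * \<psi> k x * ip (\<psi> k) g" for k
    using shrink_mult[of k] by (metis mult.assoc mult.commute)
  ultimately show ?thesis using eval_sums[OF g x] by (simp add: sums_unique2)
qed

lemma ridge_kernel_sym: "K x y = K y x"
  unfolding ridge_kernel_eq by (simp add: mult_ac)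

text \<open>This is the population version of ridge regression without noise. The solution is
  explicit: the coefficients of \<open>f\<close> are multiplied by \<open>shrink lam (m k)\<close>.
  This factor lies between 0 and 1, so summability is inherited from \<open>f\<close>.\<close>

lemma smoother:
  assumes f: "f \<in> H"
  obtains A where "A \<in> H" "\<And>g. g \<in> H \<Longrightarrow> ridge_ip Q ip lam A g = L2_inner Q f g"
proof -
  have "summable (\<lambda>k. (shrink lam (m k) * m k * ip (\<psi> k) f)\<^sup>2 / m k)"
  proof (rule summable_comparison_test'[OF coef_summable[OF f], where N=0])
    fix k
    have "(shrink lam (m k))\<^sup>2 \<le> 1"
      using shrink_bounds[OF lam, of "m k"] by (intro power_le_one) auto
    then have "(shrink lam (m k))\<^sup>2 * (m k * (ip (\<psi> k) f)\<^sup>2) \<le> m k * (ip (\<psi> k) f)\<^sup>2"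
      by (intro mult_left_le_one_le) auto
    moreover have "(shrink lam (m k) * m k * ip (\<psi> k) f)\<^sup>2 / m k = (shrink lam (m k))\<^sup>2 * (m k * (ip (\<psi> k) f)\<^sup>2)"
      by (simp add: power_mult_distrib power2_eq_square)
    ultimately show "norm ((shrink lam (m k) * m k * ip (\<psi> k) f)\<^sup>2 / m k) \<le> m k * (ip (\<psi> k) f)\<^sup>2"
      by simp
  qed
  from series[OF this] obtain A where A: "A \<in> H"
    and lim: "(\<lambda>t. h.nm (\<lambda>y. (\<Sum>k<t. (shrink lam (m k) * m k * ip (\<psi> k) f) * \<psi> k y) - A y)) \<longlonglongrightarrow> 0" .
  have "ridge_ip Q ip lam A g = L2_inner Q f g" if g: "g \<in> H" for g
  proof -
    have "(\<lambda>k. shrink lam (m k) * m k * ip (\<psi> k) f * (m k + lam) * ip (\<psi> k) g) sums ridge_ip Q ip lam A g"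
      by (rule ridge_lim[OF A lim g])
    moreover have "shrink lam (m k) * m k * ip (\<psi> k) f * (m k + lam) * ip (\<psi> k) g
        = m k * ip (\<psi> k) f * (m k * ip (\<psi> k) g)" for k
    proof -
      have "shrink lam (m k) * m k * ip (\<psi> k) f * (m k + lam) * ip (\<psi> k) g
        = (shrink lam (m k) * (m k + lam)) * (m k * ip (\<psi> k) f * ip (\<psi> k) g)" by (simp only: mult_ac)
      then show ?thesis unfolding shrink_mult by (simp only: mult_ac)
    qed
    ultimately show ?thesis using L2_sums[OF f g] by (simp add: sums_unique2)
  qed
  then show ?thesis using A that by blast
qed

lemma inverse_bandwidth: "inverse (bandwidth \<mu> lam) = (\<Sum>k. shrink lam (m k))"
  by (simp add: bandwidth_def)

lemma ridge_kernel_diag_le: "K x x \<le> c\<phi>\<^sup>2 * inverse (bandwidth \<mu> lam)"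
proof -
  have "K x x = (\<Sum>k. shrink lam (m k) * (\<psi> k x)\<^sup>2)"
    by (simp add: ridge_kernel_eq power2_eq_square mult.assoc)
  also have "\<dots> \<le> (\<Sum>k. shrink lam (m k) * c\<phi>\<^sup>2)"
    using shrink_bounds[OF lam]
    by (intro suminf_le summable_\<psi> summable_mult2 shrink_summable lam mult_left_mono \<psi>_sq_bound) auto
  also have "\<dots> = c\<phi>\<^sup>2 * inverse (bandwidth \<mu> lam)"
    by (simp add: inverse_bandwidth suminf_mult2[symmetric] shrink_summable lam mult.commute)
  finally show ?thesis .
qed

lemma nm_ridge_kernel_sq: "x \<in> \<X> \<Longrightarrow> (r.nm (K x))\<^sup>2 = K x x"
  by (simp add: r.nm_sq ridge_kernel_mem ridge_kernel_reproducing)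

lemma ridge_kernel_diag_nonneg: "x \<in> \<X> \<Longrightarrow> 0 \<le> K x x"
  using r.nonneg[OF ridge_kernel_mem[of x]] by (simp add: ridge_kernel_reproducing ridge_kernel_mem)

lemma ridge_eval_sq_le:
  assumes "f \<in> H" "x \<in> \<X>" shows "(f x)\<^sup>2 \<le> K x x * ridge_ip Q ip lam f f"
  using r.cauchy_schwarz_sq[OF ridge_kernel_mem[of x] assms(1)] assms
  by (simp add: ridge_kernel_reproducing ridge_kernel_mem)

lemma ridge_kernel_abs_le:
  assumes "x \<in> \<X>" "y \<in> \<X>" shows "\<bar>K x y\<bar> \<le> c\<phi>\<^sup>2 * inverse (bandwidth \<mu> lam)" (is "_ \<le> ?c")
proof -
  have "(K x y)\<^sup>2 \<le> K y y * K x x"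
    using ridge_eval_sq_le[OF ridge_kernel_mem[of x] assms(2)] assms
    by (simp add: ridge_kernel_reproducing ridge_kernel_mem)
  also have "\<dots> \<le> ?c * ?c"
    using assms by (intro mult_mono ridge_kernel_diag_le ridge_kernel_diag_nonneg)
      (auto intro: order_trans[OF ridge_kernel_diag_nonneg ridge_kernel_diag_le])
  finally show ?thesis
    using order_trans[OF ridge_kernel_diag_nonneg ridge_kernel_diag_le] assms
    by (metis abs_le_square_iff abs_of_nonneg power2_eq_square)
qed

text \<open>The left side is the squared norm of \<open>K x\<close> in \<open>L2\<close>, which its
  squared ridge norm \<open>K x x\<close> dominates. The bound is of order \<open>1 / h\<close>,
  whereas the pointwise bound for \<open>(K x y)\<^sup>2\<close> is of order
  \<open>1 / h\<^sup>2\<close>; this gives the quadratic form \<open>W\<close> its order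
  \<open>N / h\<^sup>1\<^sup>/\<^sup>2\<close>.\<close>

lemma ridge_kernel_sq_integral:
  assumes x: "x \<in> \<X>" shows "(\<integral>y. (K x y)\<^sup>2 \<partial>Q) \<le> K x x"
proof -
  have "(\<integral>y. (K x y)\<^sup>2 \<partial>Q) = L2_inner Q (K x) (K x)"
    by (simp add: L2_inner_def power2_eq_square)
  also have "\<dots> \<le> ridge_ip Q ip lam (K x) (K x)"
    using lam h.nonneg[OF ridge_kernel_mem] by (simp add: ridge_ip_def)
  also have "\<dots> = K x x" using x by (simp add: ridge_kernel_reproducing ridge_kernel_mem)
  finally show ?thesis .
qed

text \<open>The series is integrated term by term: each \<open>\<psi> k\<close> has unit norm in
  \<open>L2\<close>, except where \<open>shrink\<close> vanishes. The value explains the centring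
  \<open>\<sigma>2 / (N * h)\<close> of the test statistic.\<close>

lemma ridge_kernel_trace:
  shows "integrable Q (\<lambda>x. K x x)" "(\<integral>x. K x x \<partial>Q) = inverse (bandwidth \<mu> lam)"
proof -
  let ?f = "\<lambda>k x. shrink lam (m k) * (\<psi> k x)\<^sup>2"
  have int: "integrable Q (?f k)" for k
    using subsetD[OF H_L2 \<psi>_in[of k]] by (auto simp: L2_space_def)
  have val: "(\<integral>x. ?f k x \<partial>Q) = shrink lam (m k)" for k
    using L2_\<psi>[of k k] by (auto simp: L2_inner_def power2_eq_square shrink_def)
  have s1: "AE x in Q. summable (\<lambda>k. norm (?f k x))"
  proof (rule AE_I2)
    fix x
    have "norm (?f k x) = ?f k x" for k
      using shrink_bounds[OF lam, of "m k"] by simp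
    then show "summable (\<lambda>k. norm (?f k x))"
      using summable_\<psi>[of "\<lambda>k. shrink lam (m k)" x] shrink_bounds[OF lam] shrink_summable[OF lam] by simp
  qed
  have "(\<integral>x. norm (?f k x) \<partial>Q) = shrink lam (m k)" for k
    using val[of k] shrink_bounds[OF lam, of "m k"] by simp
  then have s2: "summable (\<lambda>k. \<integral>x. norm (?f k x) \<partial>Q)" by (simp add: shrink_summable lam)
  have eq: "K x x = (\<Sum>k. ?f k x)" for x
    by (simp add: ridge_kernel_eq power2_eq_square mult.assoc)
  show "integrable Q (\<lambda>x. K x x)" unfolding eq by (rule integrable_suminf[OF int s1 s2])
  have "(\<integral>x. K x x \<partial>Q) = (\<Sum>k. \<integral>x. ?f k x \<partial>Q)"
    unfolding eq by (rule integral_suminf[OF int s1 s2])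
  then show "(\<integral>x. K x x \<partial>Q) = inverse (bandwidth \<mu> lam)"
    unfolding val inverse_bandwidth .
qed

end

section \<open>Kernel ridge regression\<close>

text \<open>The normal equations in weak form: the derivative of \<open>krr_objective\<close> at
  \<open>w\<close> vanishes in every direction \<open>g\<close>.\<close>

definition solves :: "real \<Rightarrow> nat set \<Rightarrow> (nat \<Rightarrow> 'a) \<Rightarrow> (nat \<Rightarrow> real) \<Rightarrow> ('a \<Rightarrow> real) \<Rightarrow> bool" where
  "solves lam I xs ys w \<longleftrightarrow> w \<in> H \<and> (\<forall>g\<in>H.
     1 / real (card I) * (\<Sum>i\<in>I. w (xs i) * g (xs i)) + lam * ip w g =
     1 / real (card I) * (\<Sum>i\<in>I. ys i * g (xs i)))"

text \<open>Gradient descent with a step size that does not depend on the data. It proves existence of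
  the minimizer and shows that it depends measurably on the data.\<close>

definition step :: "real \<Rightarrow> real" where "step lam = 1 / (\<kappa>\<^sup>2 + 2 * lam)"

definition descent_step :: "real \<Rightarrow> nat set \<Rightarrow> (nat \<Rightarrow> 'a) \<Rightarrow> (nat \<Rightarrow> real) \<Rightarrow> ('a \<Rightarrow> real) \<Rightarrow> 'a \<Rightarrow> real" where
  "descent_step lam I xs ys u = (\<lambda>z. (1 - step lam * lam) * u z
     - (\<Sum>i\<in>I. (step lam / real (card I) * (u (xs i) - ys i)) * R (xs i) z))"

fun descent :: "real \<Rightarrow> nat set \<Rightarrow> (nat \<Rightarrow> 'a) \<Rightarrow> (nat \<Rightarrow> real) \<Rightarrow> nat \<Rightarrow> 'a \<Rightarrow> real" where
  "descent lam I xs ys 0 = (\<lambda>_. 0)"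
| "descent lam I xs ys (Suc t) = descent_step lam I xs ys (descent lam I xs ys t)"

context
  fixes lam :: real and I :: "nat set" and xs :: "nat \<Rightarrow> 'a"
  assumes lam: "0 < lam" and I: "finite I" "I \<noteq> {}" and xs: "\<And>i. i \<in> I \<Longrightarrow> xs i \<in> \<X>"
begin

lemma card_I: "0 < real (card I)" using I by (simp add: card_gt_0_iff)

text \<open>The third inequality is the one that the choice of the step is made for. It lets the
  cross term in the squared norm of a gradient step absorb the quadratic term.\<close>

lemma step_bounds: "0 < step lam" "step lam * lam < 1" "step lam * \<kappa>\<^sup>2 \<le> 2 * (1 - step lam * lam)"
proof -
  have p: "0 < \<kappa>\<^sup>2 + 2 * lam" using lam by (simp add: add_nonneg_pos)
  show "0 < step lam" using p by (simp add: step_def)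
  have "lam < \<kappa>\<^sup>2 + 2 * lam" using lam zero_le_power2[of \<kappa>] by linarith
  then show "step lam * lam < 1" using p by (simp add: step_def)
  show "step lam * \<kappa>\<^sup>2 \<le> 2 * (1 - step lam * lam)"
    using p lam by (simp add: step_def field_simps)
qed

lemma descent_mem: "descent lam I xs ys t \<in> H"
proof (induction t)
  case (Suc t)
  then show ?case unfolding descent.simps descent_step_def
    by (intro h.diff_in h.scale_in h.lin_in I kernel_mem xs)
qed (simp add: zero_mem)

text \<open>The map is \<open>b u - e Au\<close> with \<open>b = 1 - step lam * lam\<close>,
  \<open>e = step lam / n\<close> and \<open>Au\<close> the sum of the
  \<open>u (xs i) R (xs i)\<close>. In its squared norm the cross term is \<open>- 2 b e q\<close>
  with \<open>q = ip Au u\<close>, and the quadratic term is at most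
  \<open>e\<^sup>2 n \<kappa>\<^sup>2 q\<close>, which does not exceed \<open>2 b e q\<close>. Only
  \<open>b\<^sup>2\<close> times the squared norm of \<open>u\<close> remains.\<close>

lemma gradient_step_contracts:
  assumes u: "u \<in> H"
  shows "h.nm (\<lambda>z. (1 - step lam * lam) * u z - (\<Sum>i\<in>I. (step lam / real (card I) * u (xs i)) * R (xs i) z))
    \<le> (1 - step lam * lam) * h.nm u"
proof -
  define n where "n = real (card I)"
  define b where "b = 1 - step lam * lam"
  define Au where "Au = (\<lambda>z. \<Sum>i\<in>I. u (xs i) * R (xs i) z)"
  define q where "q = (\<Sum>i\<in>I. (u (xs i))\<^sup>2)"
  have n: "0 < n" using card_I by (simp add: n_def)
  have b: "0 < b" using step_bounds by (simp add: b_def)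
  have Au: "Au \<in> H" unfolding Au_def by (intro h.lin_in I kernel_mem xs)
  have Auu: "ip Au u = q"
  proof -
    have "ip Au u = (\<Sum>i\<in>I. u (xs i) * ip (R (xs i)) u)"
      unfolding Au_def by (intro h.lin_left I kernel_mem xs u)
    also have "\<dots> = q" unfolding q_def
    proof (rule sum.cong)
      fix i assume "i \<in> I"
      then show "u (xs i) * ip (R (xs i)) u = (u (xs i))\<^sup>2"
        using h.comm[OF u kernel_mem[OF xs]] reproducing[OF u xs] by (simp add: power2_eq_square)
    qed simp
    finally show ?thesis .
  qed
  \<comment> \<open>The squared norm of \<open>Au\<close> is the sum of the
    \<open>u (xs i) * Au (xs i)\<close>. Bounding each \<open>Au (xs i)\<close> by
    \<open>\<kappa>\<close> times the norm of \<open>Au\<close> and cancelling one factor bounds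
    this norm by an \<open>l1\<close> sum of the values of \<open>u\<close>; Cauchy-Schwarz over the
    sample then brings in \<open>q\<close>.\<close>
  have AuAu: "ip Au Au \<le> n * \<kappa>\<^sup>2 * q"
  proof -
    have "ip Au Au = (\<Sum>i\<in>I. u (xs i) * ip (R (xs i)) Au)"
      unfolding Au_def using I xs by (subst h.lin_left) (auto intro: Au[unfolded Au_def] kernel_mem)
    also have "\<dots> = (\<Sum>i\<in>I. u (xs i) * Au (xs i))"
    proof (rule sum.cong)
      fix i assume "i \<in> I"
      then show "u (xs i) * ip (R (xs i)) Au = u (xs i) * Au (xs i)"
        using h.comm[OF Au kernel_mem[OF xs]] reproducing[OF Au xs] by simp
    qed simp
    also have "\<dots> \<le> (\<Sum>i\<in>I. \<bar>u (xs i)\<bar> * (\<kappa> * h.nm Au))"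
    proof (rule sum_mono)
      fix i assume "i \<in> I"
      have "u (xs i) * Au (xs i) \<le> \<bar>u (xs i)\<bar> * \<bar>Au (xs i)\<bar>"
        by (simp add: abs_mult[symmetric])
      also have "\<dots> \<le> \<bar>u (xs i)\<bar> * (\<kappa> * h.nm Au)"
        by (intro mult_left_mono eval_le Au xs \<open>i \<in> I\<close>) simp
      finally show "u (xs i) * Au (xs i) \<le> \<bar>u (xs i)\<bar> * (\<kappa> * h.nm Au)" .
    qed
    also have "\<dots> = (\<Sum>i\<in>I. \<bar>u (xs i)\<bar>) * \<kappa> * h.nm Au"
      by (simp add: sum_distrib_right mult.assoc)
    finally have 1: "(h.nm Au)\<^sup>2 \<le> (\<Sum>i\<in>I. \<bar>u (xs i)\<bar>) * \<kappa> * h.nm Au" by (simp add: h.nm_sq Au)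
    have "h.nm Au \<le> (\<Sum>i\<in>I. \<bar>u (xs i)\<bar>) * \<kappa>"
      by (rule le_of_mult_self_le) (use 1 in \<open>simp_all add: \<kappa>_nonneg sum_nonneg power2_eq_square\<close>)
    then have "(h.nm Au)\<^sup>2 \<le> ((\<Sum>i\<in>I. \<bar>u (xs i)\<bar>) * \<kappa>)\<^sup>2"
      using h.nm_nonneg[OF Au] by (intro power_mono)
    also have "\<dots> = (\<Sum>i\<in>I. \<bar>u (xs i)\<bar>)\<^sup>2 * \<kappa>\<^sup>2" by (simp add: power_mult_distrib)
    also have "\<dots> \<le> ((\<Sum>i\<in>I. \<bar>u (xs i)\<bar>\<^sup>2) * (\<Sum>i\<in>I. 1\<^sup>2)) * \<kappa>\<^sup>2"
      using Cauchy_Schwarz_ineq_sum[of "\<lambda>i. \<bar>u (xs i)\<bar>" "\<lambda>_. 1" I] by (intro mult_right_mono) auto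
    also have "\<dots> = n * \<kappa>\<^sup>2 * q" by (simp add: q_def n_def)
    finally show ?thesis by (simp add: h.nm_sq Au)
  qed
  define e where "e = step lam / n"
  have mem: "(\<lambda>z. b * u z - e * Au z) \<in> H" using u Au by (intro h.diff_in h.scale_in)
  have "(h.nm (\<lambda>z. b * u z - e * Au z))\<^sup>2 = b\<^sup>2 * ip u u - 2 * b * e * ip Au u + e\<^sup>2 * ip Au Au"
    unfolding h.nm_sq[OF mem] using u Au
    by (simp add: h.diff_in h.scale_in h.diff_left h.diff_right h.scale_left h.scale_right
        h.comm[of u Au] algebra_simps power2_eq_square)
  also have "\<dots> \<le> b\<^sup>2 * ip u u"
  proof -
    have "e\<^sup>2 * ip Au Au \<le> e\<^sup>2 * (n * \<kappa>\<^sup>2 * q)" using AuAu by (intro mult_left_mono) auto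
    also have "\<dots> = (step lam * \<kappa>\<^sup>2) * (e * q)" using n by (simp add: e_def power2_eq_square)
    also have "\<dots> \<le> (2 * b) * (e * q)"
    proof (rule mult_right_mono)
      show "step lam * \<kappa>\<^sup>2 \<le> 2 * b" using step_bounds by (simp add: b_def)
      have "0 \<le> q" "0 \<le> e" using n step_bounds by (simp_all add: q_def e_def sum_nonneg)
      then show "0 \<le> e * q" by simp
    qed
    finally show ?thesis by (simp add: Auu)
  qed
  also have "\<dots> = (b * h.nm u)\<^sup>2" by (simp add: power_mult_distrib h.nm_sq u)
  finally have "h.nm (\<lambda>z. b * u z - e * Au z) \<le> b * h.nm u"
    by (rule power2_le_imp_le) (use b h.nm_nonneg[OF u] in simp)
  moreover have "e * Au z = (\<Sum>i\<in>I. (e * u (xs i)) * R (xs i) z)" for z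
    by (simp add: Au_def sum_distrib_left mult.assoc)
  ultimately show ?thesis by (simp add: b_def e_def n_def)
qed

text \<open>The responses cancel in the difference of two successive iterates, so the difference
  evolves by the homogeneous gradient step.\<close>

lemma descent_step_le:
  "h.nm (\<lambda>z. descent lam I xs ys (Suc t) z - descent lam I xs ys t z)
     \<le> (1 - step lam * lam) ^ t * h.nm (descent lam I xs ys 1)"
proof (induction t)
  case (Suc t)
  let ?d = "\<lambda>t. descent lam I xs ys t"
  let ?u = "\<lambda>z. ?d (Suc t) z - ?d t z"
  have "(\<lambda>z. ?d (Suc (Suc t)) z - ?d (Suc t) z) = (\<lambda>z. (1 - step lam * lam) * ?u z
       - (\<Sum>i\<in>I. (step lam / real (card I) * ?u (xs i)) * R (xs i) z))"
  proof
    fix z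
    have "descent_step lam I xs ys p z - descent_step lam I xs ys q z = (1 - step lam * lam) * (p z - q z)
       - (\<Sum>i\<in>I. (step lam / real (card I) * (p (xs i) - q (xs i))) * R (xs i) z)" for p q
    proof -
      have "(\<Sum>i\<in>I. (step lam / real (card I) * (p (xs i) - ys i)) * R (xs i) z)
        - (\<Sum>i\<in>I. (step lam / real (card I) * (q (xs i) - ys i)) * R (xs i) z)
        = (\<Sum>i\<in>I. (step lam / real (card I) * (p (xs i) - q (xs i))) * R (xs i) z)"
      proof -
        have "c * (x - y) * r - c * (x' - y) * r = c * (x - x') * r" for c x x' y r :: real
          by (simp add: algebra_simps)
        then show ?thesis unfolding sum_subtractf[symmetric] by (intro sum.cong refl)
      qed
      then show ?thesis unfolding descent_step_def by (simp only: ring_distribs)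
    qed
    from this[of "?d (Suc t)" "?d t"] show "?d (Suc (Suc t)) z - ?d (Suc t) z = (1 - step lam * lam) * ?u z
       - (\<Sum>i\<in>I. (step lam / real (card I) * ?u (xs i)) * R (xs i) z)" by simp
  qed
  then have "h.nm (\<lambda>z. ?d (Suc (Suc t)) z - ?d (Suc t) z) \<le> (1 - step lam * lam) * h.nm ?u"
    using gradient_step_contracts[OF h.diff_in[OF descent_mem descent_mem], of ys "Suc t" ys t] by metis
  also have "\<dots> \<le> (1 - step lam * lam) * ((1 - step lam * lam) ^ t * h.nm (?d 1))"
    using Suc.IH step_bounds by (intro mult_left_mono) auto
  finally show ?case by simp
qed simp

lemma descent_lim:
  obtains w where "w \<in> H" "(\<lambda>t. h.nm (\<lambda>z. descent lam I xs ys t z - w z)) \<longlonglongrightarrow> 0"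
proof -
  let ?d = "\<lambda>t. descent lam I xs ys t"
  define b where "b = 1 - step lam * lam"
  have b: "0 < b" "b < 1" using step_bounds lam by (auto simp: b_def)
  \<comment> \<open>The sum of the geometric series that bounds the lengths of all steps.\<close>
  define C where "C = h.nm (?d 1) / (1 - b)"
  have C: "0 \<le> C" unfolding C_def using b by (intro divide_nonneg_pos h.nm_nonneg descent_mem) auto
  have le: "h.nm (\<lambda>z. ?d (t + l) z - ?d t z) \<le> C * b ^ t * (1 - b ^ l)" for t l
  proof (induction l)
    case 0 then show ?case by (simp add: h.nm_zero)
  next
    case (Suc l)
    have "h.nm (\<lambda>z. ?d (t + Suc l) z - ?d t z) \<le> h.nm (\<lambda>z. ?d (t + Suc l) z - ?d (t + l) z) + h.nm (\<lambda>z. ?d (t + l) z - ?d t z)"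
      by (intro h.nm_triangle_mid descent_mem)
    also have "\<dots> \<le> b ^ (t + l) * h.nm (?d 1) + C * b ^ t * (1 - b ^ l)"
      using descent_step_le[of ys "t + l"] Suc.IH by (intro add_mono) (simp_all add: b_def)
    also have "h.nm (?d 1) = C * (1 - b)" using b by (simp add: C_def)
    finally show ?case by (simp add: algebra_simps power_add)
  qed
  have le': "h.nm (\<lambda>z. ?d l z - ?d t z) \<le> C * b ^ t0" if "t0 \<le> t" "t0 \<le> l" for t l t0
  proof -
    have *: "h.nm (\<lambda>z. ?d l z - ?d t z) \<le> C * b ^ t0" if "t0 \<le> t" "t \<le> l" for t l
    proof -
      have "h.nm (\<lambda>z. ?d l z - ?d t z) \<le> C * b ^ t * (1 - b ^ (l - t))"
        using le[of t "l - t"] that by simp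
      also have "\<dots> \<le> C * b ^ t * 1" using b C by (intro mult_left_mono) auto
      also have "\<dots> \<le> C * b ^ t0" using b C that by (simp add: mult_left_mono power_decreasing)
      finally show ?thesis .
    qed
    show ?thesis
    proof (cases "t \<le> l")
      case True then show ?thesis using * that by blast
    next
      case False
      then show ?thesis using *[of l t] that h.nm_minus[OF descent_mem descent_mem, of ys l ys t] by simp
    qed
  qed
  have "(\<lambda>t. C * b ^ t) \<longlonglongrightarrow> C * 0" using b by (intro tendsto_intros LIMSEQ_realpow_zero) auto
  then have z: "(\<lambda>t. C * b ^ t) \<longlonglongrightarrow> 0" by simp
  have "\<exists>m0. \<forall>t\<ge>m0. \<forall>l\<ge>m0. sqrt (ip (\<lambda>x. ?d t x - ?d l x) (\<lambda>x. ?d t x - ?d l x)) < e" if "e > 0" for e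
  proof -
    from order_tendstoD(2)[OF z that] obtain m0 where "C * b ^ m0 < e"
      by (auto simp: eventually_sequentially)
    then show ?thesis using le' unfolding h.nm_def by (meson le_less_trans)
  qed
  from complete[of ?d, OF descent_mem this] obtain w where
    "w \<in> H" "(\<lambda>t. sqrt (ip (\<lambda>x. ?d t x - w x) (\<lambda>x. ?d t x - w x))) \<longlonglongrightarrow> 0" by blast
  then show ?thesis using that[of w] unfolding h.nm_def by simp
qed

text \<open>The recursion, tested with \<open>g\<close>, passes to the limit because point
  evaluations are continuous. A fixed point of the recursion satisfies the normal equations, up to
  the positive factor \<open>step lam\<close>.\<close>

lemma descent_lim_solves:
  assumes w: "w \<in> H" and lim: "(\<lambda>t. h.nm (\<lambda>z. descent lam I xs ys t z - w z)) \<longlonglongrightarrow> 0"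
  shows "solves lam I xs ys w"
  unfolding solves_def
proof (intro conjI ballI w)
  fix g assume g: "g \<in> H"
  let ?d = "\<lambda>t. descent lam I xs ys t"
  have conv: "(\<lambda>t. ip (?d t) g) \<longlonglongrightarrow> ip w g" if "g \<in> H" for g
    by (rule h.B_tendsto[OF descent_mem w that lim])
  have ev: "(\<lambda>t. ?d t (xs i)) \<longlonglongrightarrow> w (xs i)" if "i \<in> I" for i
    using conv[OF kernel_mem[OF xs[OF that]]] by (simp add: reproducing descent_mem w xs that)
  have "ip (?d (Suc t)) g = (1 - step lam * lam) * ip (?d t) g
     - (\<Sum>i\<in>I. (step lam / real (card I) * (?d t (xs i) - ys i)) * g (xs i))" for t
  proof -
    have "ip (R (xs i)) g = g (xs i)" if "i \<in> I" for i
      using h.comm[OF g kernel_mem[OF xs]] reproducing[OF g xs] that by simp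
    moreover have "(\<lambda>z. \<Sum>i\<in>I. (step lam / real (card I) * (?d t (xs i) - ys i)) * R (xs i) z) \<in> H"
      by (intro h.lin_in I kernel_mem xs)
    moreover have "ip (\<lambda>z. \<Sum>i\<in>I. (step lam / real (card I) * (?d t (xs i) - ys i)) * R (xs i) z) g
        = (\<Sum>i\<in>I. (step lam / real (card I) * (?d t (xs i) - ys i)) * ip (R (xs i)) g)"
      by (intro h.lin_left I kernel_mem xs g)
    ultimately show ?thesis
      using g by (simp add: descent_step_def h.diff_left h.scale_left h.scale_in descent_mem cong: sum.cong)
  qed
  moreover have "(\<lambda>t. (1 - step lam * lam) * ip (?d t) g
     - (\<Sum>i\<in>I. (step lam / real (card I) * (?d t (xs i) - ys i)) * g (xs i))) \<longlonglongrightarrow>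
     (1 - step lam * lam) * ip w g - (\<Sum>i\<in>I. (step lam / real (card I) * (w (xs i) - ys i)) * g (xs i))"
    by (intro tendsto_intros conv g ev)
  moreover have "(\<lambda>t. ip (?d (Suc t)) g) \<longlonglongrightarrow> ip w g"
    using conv[OF g] by (rule LIMSEQ_Suc)
  ultimately have "ip w g = (1 - step lam * lam) * ip w g - (\<Sum>i\<in>I. (step lam / real (card I) * (w (xs i) - ys i)) * g (xs i))"
    by (simp only: LIMSEQ_unique)
  then have "step lam * (lam * ip w g + 1 / real (card I) * (\<Sum>i\<in>I. (w (xs i) - ys i) * g (xs i))) = 0"
    by (simp add: ring_distribs sum_distrib_left mult.assoc)
  then have "lam * ip w g + 1 / real (card I) * (\<Sum>i\<in>I. (w (xs i) - ys i) * g (xs i)) = 0"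
    using step_bounds by simp
  then show "1 / real (card I) * (\<Sum>i\<in>I. w (xs i) * g (xs i)) + lam * ip w g =
     1 / real (card I) * (\<Sum>i\<in>I. ys i * g (xs i))"
    by (simp add: left_diff_distrib sum_subtractf right_diff_distrib)
qed

text \<open>The objective is quadratic, and the normal equations remove its linear term at
  \<open>w\<close>. The remaining gap is nonnegative and controls the norm of \<open>g - w\<close>,
  so it yields both minimality and uniqueness.\<close>

lemma objective_gap:
  assumes w: "solves lam I xs ys w" and g: "g \<in> H"
  shows "krr_objective ip lam I xs ys g = krr_objective ip lam I xs ys w
     + (1 / (2 * real (card I)) * (\<Sum>i\<in>I. (g (xs i) - w (xs i))\<^sup>2) + lam / 2 * ip (\<lambda>x. g x - w x) (\<lambda>x. g x - w x))"
proof -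
  define n where "n = real (card I)"
  define d where "d = (\<lambda>x. g x - w x)"
  have n: "0 < n" using card_I by (simp add: n_def)
  have wH: "w \<in> H" using w by (simp add: solves_def)
  have dH: "d \<in> H" unfolding d_def using g wH by (rule h.diff_in)
  have gd: "g = (\<lambda>x. w x + d x)" by (simp add: d_def)
  have eq: "1 / n * (\<Sum>i\<in>I. w (xs i) * d (xs i)) + lam * ip w d = 1 / n * (\<Sum>i\<in>I. ys i * d (xs i))"
    using w dH by (simp add: solves_def n_def)
  have s: "(\<Sum>i\<in>I. (ys i - g (xs i))\<^sup>2) = (\<Sum>i\<in>I. (ys i - w (xs i))\<^sup>2) - 2 * (\<Sum>i\<in>I. ys i * d (xs i))
      + 2 * (\<Sum>i\<in>I. w (xs i) * d (xs i)) + (\<Sum>i\<in>I. (d (xs i))\<^sup>2)"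
    unfolding sum_distrib_left sum_subtractf[symmetric] sum.distrib[symmetric]
    by (intro sum.cong) (auto simp: d_def power2_eq_square algebra_simps)
  have i: "ip g g = ip w w + 2 * ip w d + ip d d"
    unfolding gd by (rule h.B_add_sq[OF wH dH])
  have ld: "lam * ip w d = 1 / n * (\<Sum>i\<in>I. ys i * d (xs i)) - 1 / n * (\<Sum>i\<in>I. w (xs i) * d (xs i))"
    using eq by simp
  have "lam / 2 * ip g g = lam / 2 * ip w w + lam * ip w d + lam / 2 * ip d d"
    unfolding i by (simp add: algebra_simps)
  note gg = this
  have split: "1 / (2 * n) * (p - 2 * q + 2 * r + u) = 1 / (2 * n) * p - 1 / n * q + 1 / n * r + 1 / (2 * n) * u" for p q r u
    using n by (simp add: field_simps)
  have dd: "(g (xs i) - w (xs i))\<^sup>2 = (d (xs i))\<^sup>2" for i by (simp add: d_def)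
  show ?thesis
    unfolding krr_objective_def n_def[symmetric] s dd d_def[symmetric] split
    using ld gg by linarith
qed

text \<open>\<open>krr\<close> is a Hilbert choice, which says something only once a minimizer is
  known to exist. The limit of the descent supplies one, and any other minimizer has gap 0 to it,
  hence equals it.\<close>

lemma krr_solves: "solves lam I xs ys (krr H ip lam I xs ys)"
  and krr_unique: "solves lam I xs ys w \<Longrightarrow> w = krr H ip lam I xs ys"
proof -
  obtain w0 where w0: "solves lam I xs ys w0" using descent_lim descent_lim_solves by metis
  have *: "krr H ip lam I xs ys = w" if w: "solves lam I xs ys w" for w
  proof -
    have wH: "w \<in> H" using w by (simp add: solves_def)
    have min: "is_arg_min (krr_objective ip lam I xs ys) (\<lambda>x. x \<in> H) w"
      unfolding is_arg_min_def
    proof (intro conjI wH notI, elim exE conjE)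
      fix g assume g: "g \<in> H" and less: "krr_objective ip lam I xs ys g < krr_objective ip lam I xs ys w"
      have "0 \<le> 1 / (2 * real (card I)) * (\<Sum>i\<in>I. (g (xs i) - w (xs i))\<^sup>2) + lam / 2 * ip (\<lambda>x. g x - w x) (\<lambda>x. g x - w x)"
        using lam by (intro add_nonneg_nonneg mult_nonneg_nonneg sum_nonneg h.nonneg h.diff_in g wH) auto
      then show False using less objective_gap[OF w g] by simp
    qed
    have "is_arg_min (krr_objective ip lam I xs ys) (\<lambda>x. x \<in> H) (krr H ip lam I xs ys)"
      unfolding krr_def arg_min_on_def arg_min_def by (rule someI[of "is_arg_min _ _", OF min])
    then have kH: "krr H ip lam I xs ys \<in> H"
      and le: "krr_objective ip lam I xs ys (krr H ip lam I xs ys) \<le> krr_objective ip lam I xs ys w"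
      using wH by (auto simp: is_arg_min_def not_less)
    let ?d = "\<lambda>x. krr H ip lam I xs ys x - w x"
    have "lam / 2 * ip ?d ?d \<le> 0"
    proof -
      have "0 \<le> 1 / (2 * real (card I)) * (\<Sum>i\<in>I. (krr H ip lam I xs ys (xs i) - w (xs i))\<^sup>2)"
        by (intro mult_nonneg_nonneg sum_nonneg) auto
      then show ?thesis using le objective_gap[OF w kH] by linarith
    qed
    then have "ip ?d ?d = 0"
      using lam h.nonneg[OF h.diff_in[OF kH wH]] by (simp add: mult_le_0_iff)
    then have "?d = (\<lambda>_. 0)" by (rule ip_definite[OF h.diff_in[OF kH wH]])
    then show ?thesis by (simp add: fun_eq_iff)
  qed
  show "solves lam I xs ys (krr H ip lam I xs ys)" using *[OF w0] w0 by simp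
  show "solves lam I xs ys w \<Longrightarrow> w = krr H ip lam I xs ys" using * by simp
qed

lemma krr_mem: "krr H ip lam I xs ys \<in> H"
  using krr_solves[of ys] by (simp add: solves_def)

lemma descent_tendsto_krr:
  "(\<lambda>t. h.nm (\<lambda>z. descent lam I xs ys t z - krr H ip lam I xs ys z)) \<longlonglongrightarrow> 0"
  using descent_lim[of ys] descent_lim_solves[of _ ys] krr_unique[of ys] by metis

text \<open>With uniqueness this becomes the linearity of \<open>krr\<close> in the
  responses.\<close>

lemma solves_lin:
  assumes "finite J" "\<And>j. j \<in> J \<Longrightarrow> solves lam I xs (Y j) (w j)"
  shows "solves lam I xs (\<lambda>i. \<Sum>j\<in>J. c j * Y j i) (\<lambda>x. \<Sum>j\<in>J. c j * w j x)"
  unfolding solves_def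
proof (intro conjI ballI)
  have wH: "w j \<in> H" if "j \<in> J" for j using assms(2)[OF that] by (simp add: solves_def)
  then show "(\<lambda>x. \<Sum>j\<in>J. c j * w j x) \<in> H" using assms by (intro h.lin_in)
  fix g assume g: "g \<in> H"
  let ?n = "real (card I)"
  have "1 / ?n * (\<Sum>i\<in>I. (\<Sum>j\<in>J. c j * w j (xs i)) * g (xs i)) + lam * ip (\<lambda>x. \<Sum>j\<in>J. c j * w j x) g
    = (\<Sum>j\<in>J. c j * (1 / ?n * (\<Sum>i\<in>I. w j (xs i) * g (xs i)) + lam * ip (w j) g))"
    using assms(1) wH g
    by (simp add: h.lin_left ring_distribs sum.distrib sum_distrib_left sum_distrib_right sum.swap[of _ I J] mult_ac)
  also have "\<dots> = (\<Sum>j\<in>J. c j * (1 / ?n * (\<Sum>i\<in>I. Y j i * g (xs i))))"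
    using assms(2) g by (intro sum.cong refl) (simp add: solves_def)
  also have "\<dots> = 1 / ?n * (\<Sum>i\<in>I. (\<Sum>j\<in>J. c j * Y j i) * g (xs i))"
    by (simp add: sum_distrib_left sum_distrib_right sum.swap[of _ I J] mult_ac)
  finally show "1 / ?n * (\<Sum>i\<in>I. (\<Sum>j\<in>J. c j * w j (xs i)) * g (xs i)) + lam * ip (\<lambda>x. \<Sum>j\<in>J. c j * w j x) g
    = 1 / ?n * (\<Sum>i\<in>I. (\<Sum>j\<in>J. c j * Y j i) * g (xs i))" .
qed

end

end

context bounded_eigen_rkhs
begin

section \<open>Measurable families in the Hilbert space\<close>

text \<open>\<open>H\<close> carries no sigma-algebra. Measurability of a random element is imposed
  on its countably many coefficients; by \<open>parseval\<close> and \<open>L2_sums\<close> all the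
  inner products of such elements are then measurable.\<close>

definition Hmeas :: "'b measure \<Rightarrow> ('b \<Rightarrow> 'a \<Rightarrow> real) \<Rightarrow> bool" where
  "Hmeas N W \<longleftrightarrow> (\<forall>\<omega>\<in>space N. W \<omega> \<in> H) \<and> (\<forall>k. (\<lambda>\<omega>. ip (\<psi> k) (W \<omega>)) \<in> borel_measurable N)"

lemma Hmeas_mem: "Hmeas N W \<Longrightarrow> \<omega> \<in> space N \<Longrightarrow> W \<omega> \<in> H"
  by (simp add: Hmeas_def)

lemma Hmeas_coef: "Hmeas N W \<Longrightarrow> (\<lambda>\<omega>. ip (\<psi> k) (W \<omega>)) \<in> borel_measurable N"
  by (simp add: Hmeas_def)

lemma Hmeas_const: "f \<in> H \<Longrightarrow> Hmeas N (\<lambda>_. f)"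
  by (simp add: Hmeas_def)

lemma Hmeas_lin:
  assumes J: "finite J" and W: "\<And>j. j \<in> J \<Longrightarrow> Hmeas N (W j)"
    and c: "\<And>j. j \<in> J \<Longrightarrow> c j \<in> borel_measurable N"
  shows "Hmeas N (\<lambda>\<omega> x. \<Sum>j\<in>J. c j \<omega> * W j \<omega> x)"
  unfolding Hmeas_def
proof (intro conjI ballI allI)
  fix \<omega> assume "\<omega> \<in> space N"
  then show "(\<lambda>x. \<Sum>j\<in>J. c j \<omega> * W j \<omega> x) \<in> H" by (intro h.lin_in J Hmeas_mem[OF W])
next
  fix k
  have "(\<lambda>\<omega>. \<Sum>j\<in>J. c j \<omega> * ip (\<psi> k) (W j \<omega>)) \<in> borel_measurable N"
    by (intro borel_measurable_sum borel_measurable_times c Hmeas_coef W)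
  moreover have "ip (\<psi> k) (\<lambda>x. \<Sum>j\<in>J. c j \<omega> * W j \<omega> x) = (\<Sum>j\<in>J. c j \<omega> * ip (\<psi> k) (W j \<omega>))"
    if "\<omega> \<in> space N" for \<omega> using that by (intro h.lin_right J Hmeas_mem[OF W] \<psi>_in)
  ultimately show "(\<lambda>\<omega>. ip (\<psi> k) (\<lambda>x. \<Sum>j\<in>J. c j \<omega> * W j \<omega> x)) \<in> borel_measurable N"
    by (simp cong: measurable_cong)
qed

lemma Hmeas_scale:
  assumes W: "Hmeas N W" and c: "c \<in> borel_measurable N" shows "Hmeas N (\<lambda>\<omega> x. c \<omega> * W \<omega> x)"
  using Hmeas_lin[of "{0::nat}" N "\<lambda>_. W" "\<lambda>_. c"] assms by simp

lemma Hmeas_diff: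
  assumes "Hmeas N W" "Hmeas N W'" shows "Hmeas N (\<lambda>\<omega> x. W \<omega> x - W' \<omega> x)"
  using Hmeas_lin[of "UNIV::bool set" N "\<lambda>b. if b then W else W'" "\<lambda>b _. if b then 1 else -1"] assms
  by (simp add: UNIV_bool)

lemma Hmeas_ip:
  assumes "Hmeas N W" "Hmeas N W'" shows "(\<lambda>\<omega>. ip (W \<omega>) (W' \<omega>)) \<in> borel_measurable N"
proof -
  have "(\<lambda>\<omega>. \<Sum>k. m k * ip (\<psi> k) (W \<omega>) * ip (\<psi> k) (W' \<omega>)) \<in> borel_measurable N"
    by (intro borel_measurable_suminf borel_measurable_times borel_measurable_const Hmeas_coef assms)
  moreover have "ip (W \<omega>) (W' \<omega>) = (\<Sum>k. m k * ip (\<psi> k) (W \<omega>) * ip (\<psi> k) (W' \<omega>))" if "\<omega> \<in> space N" for \<omega>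
    using parseval[OF Hmeas_mem[OF assms(1) that] Hmeas_mem[OF assms(2) that]] by (simp add: sums_iff)
  ultimately show ?thesis by (simp cong: measurable_cong)
qed

lemma Hmeas_L2:
  assumes "Hmeas N W" "Hmeas N W'" shows "(\<lambda>\<omega>. L2_inner Q (W \<omega>) (W' \<omega>)) \<in> borel_measurable N"
proof -
  have "(\<lambda>\<omega>. \<Sum>k. m k * ip (\<psi> k) (W \<omega>) * (m k * ip (\<psi> k) (W' \<omega>))) \<in> borel_measurable N"
    by (intro borel_measurable_suminf borel_measurable_times borel_measurable_const Hmeas_coef assms)
  moreover have "L2_inner Q (W \<omega>) (W' \<omega>) = (\<Sum>k. m k * ip (\<psi> k) (W \<omega>) * (m k * ip (\<psi> k) (W' \<omega>)))"
    if "\<omega> \<in> space N" for \<omega>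
    using L2_sums[OF Hmeas_mem[OF assms(1) that] Hmeas_mem[OF assms(2) that]] by (simp add: sums_iff)
  ultimately show ?thesis by (simp cong: measurable_cong)
qed

lemma Hmeas_ridge:
  assumes "Hmeas N W" "Hmeas N W'" shows "(\<lambda>\<omega>. ridge_ip Q ip lam (W \<omega>) (W' \<omega>)) \<in> borel_measurable N"
  unfolding ridge_ip_def
  by (intro borel_measurable_add borel_measurable_times borel_measurable_const Hmeas_ip Hmeas_L2 assms)

lemma Hmeas_kernel:
  assumes X: "X \<in> measurable N Q" shows "Hmeas N (\<lambda>\<omega>. R (X \<omega>))"
  unfolding Hmeas_def
proof (intro conjI ballI allI)
  have X\<X>: "X \<omega> \<in> \<X>" if "\<omega> \<in> space N" for \<omega> using measurable_space[OF X that] space_Q by simp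
  then show "R (X \<omega>) \<in> H" if "\<omega> \<in> space N" for \<omega> using that kernel_mem by blast
  fix k
  have "(\<lambda>\<omega>. \<psi> k (X \<omega>)) \<in> borel_measurable N"
    by (rule measurable_compose[OF X H_measurable[OF \<psi>_in]])
  then show "(\<lambda>\<omega>. ip (\<psi> k) (R (X \<omega>))) \<in> borel_measurable N"
    by (simp add: reproducing X\<X> cong: measurable_cong)
qed

text \<open>A random function at a random point: the value is the inner product with the random
  element \<open>R (X \<omega>)\<close>, so no joint measurability has to be assumed.\<close>

lemma Hmeas_eval:
  assumes X: "X \<in> measurable N Q" and W: "Hmeas N W" shows "(\<lambda>\<omega>. W \<omega> (X \<omega>)) \<in> borel_measurable N"
proof -
  have "X \<omega> \<in> \<X>" if "\<omega> \<in> space N" for \<omega> using measurable_space[OF X that] space_Q by simp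
  then show ?thesis using Hmeas_ip[OF W Hmeas_kernel[OF X]]
    by (simp add: reproducing Hmeas_mem[OF W] cong: measurable_cong)
qed

lemma Hmeas_lim:
  assumes F: "\<And>t. Hmeas N (F t)" and W: "\<And>\<omega>. \<omega> \<in> space N \<Longrightarrow> W \<omega> \<in> H"
    and lim: "\<And>\<omega>. \<omega> \<in> space N \<Longrightarrow> (\<lambda>t. h.nm (\<lambda>x. F t \<omega> x - W \<omega> x)) \<longlonglongrightarrow> 0"
  shows "Hmeas N W"
  unfolding Hmeas_def
proof (intro conjI ballI allI W)
  fix k
  show "(\<lambda>\<omega>. ip (\<psi> k) (W \<omega>)) \<in> borel_measurable N"
  proof (rule borel_measurable_LIMSEQ_real[of N "\<lambda>t \<omega>. ip (\<psi> k) (F t \<omega>)"])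
    fix \<omega> assume \<omega>: "\<omega> \<in> space N"
    have "(\<lambda>t. ip (F t \<omega>) (\<psi> k)) \<longlonglongrightarrow> ip (W \<omega>) (\<psi> k)"
      by (rule h.B_tendsto[OF Hmeas_mem[OF F \<omega>] W[OF \<omega>] \<psi>_in lim[OF \<omega>]])
    then show "(\<lambda>t. ip (\<psi> k) (F t \<omega>)) \<longlonglongrightarrow> ip (\<psi> k) (W \<omega>)"
      using h.comm[OF \<psi>_in Hmeas_mem[OF F \<omega>]] h.comm[OF \<psi>_in W[OF \<omega>]] by simp
  qed (rule Hmeas_coef[OF F])
qed

text \<open>The definition of \<open>krr\<close> by choice says nothing about its dependence on the
  data. The descent iterates are finite combinations of kernels with measurable coefficients, their
  step size is deterministic, and they converge to \<open>krr\<close> at every outcome.\<close>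

lemma Hmeas_krr:
  assumes lam: "0 < lam" and I: "finite I" "I \<noteq> {}"
    and xs: "\<And>i. i \<in> I \<Longrightarrow> (\<lambda>\<omega>. xs \<omega> i) \<in> measurable N Q"
    and ys: "\<And>i. i \<in> I \<Longrightarrow> (\<lambda>\<omega>. ys \<omega> i) \<in> borel_measurable N"
  shows "Hmeas N (\<lambda>\<omega>. krr H ip lam I (xs \<omega>) (ys \<omega>))"
proof -
  have x: "xs \<omega> i \<in> \<X>" if "i \<in> I" "\<omega> \<in> space N" for i \<omega>
    using measurable_space[OF xs[OF that(1)] that(2)] space_Q by simp
  have d: "Hmeas N (\<lambda>\<omega>. descent lam I (xs \<omega>) (ys \<omega>) t)" for t
  proof (induction t)
    case 0 then show ?case by (simp add: Hmeas_const zero_mem)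
  next
    case (Suc t)
    show ?case unfolding descent.simps descent_step_def
      by (intro Hmeas_diff Hmeas_scale Hmeas_lin I Suc.IH Hmeas_kernel xs borel_measurable_const
          borel_measurable_times borel_measurable_diff Hmeas_eval ys)
  qed
  show ?thesis
    by (rule Hmeas_lim[OF d]) (auto intro!: krr_mem descent_tendsto_krr lam I x)
qed

lemma Hmeas_ridge_kernel:
  assumes lam: "0 < lam" and X: "X \<in> measurable N Q" shows "Hmeas N (\<lambda>\<omega>. ridge_kernel \<mu> \<phi> lam (X \<omega>))"
  unfolding Hmeas_def
proof (intro conjI ballI allI ridge_kernel_mem lam)
  have X\<X>: "X \<omega> \<in> \<X>" if "\<omega> \<in> space N" for \<omega> using measurable_space[OF X that] space_Q by simp
  interpret r: fun_ip H "ridge_ip Q ip lam" using lam by (intro fun_ip_ridge) simp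
  fix k
  have "(\<lambda>\<omega>. \<psi> k (X \<omega>) / (m k + lam)) \<in> borel_measurable N"
    by (intro borel_measurable_divide borel_measurable_const measurable_compose[OF X H_measurable[OF \<psi>_in]])
  moreover have "ip (\<psi> k) (ridge_kernel \<mu> \<phi> lam x) = \<psi> k x / (m k + lam)" if "x \<in> \<X>" for x
  proof -
    have "(m k + lam) * ip (\<psi> k) (ridge_kernel \<mu> \<phi> lam x) = \<psi> k x"
      using ridge_\<psi>[OF lam ridge_kernel_mem[OF lam], of k x] ridge_kernel_reproducing[OF lam \<psi>_in that, of k]
        r.comm[OF \<psi>_in ridge_kernel_mem[OF lam], of k x] by simp
    moreover have "0 < m k + lam" using lam m_nonneg[of k] by linarith
    ultimately show ?thesis by (simp add: eq_divide_eq mult.commute)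
  qed
  ultimately show "(\<lambda>\<omega>. ip (\<psi> k) (ridge_kernel \<mu> \<phi> lam (X \<omega>))) \<in> borel_measurable N"
    by (simp add: X\<X> cong: measurable_cong)
qed

section \<open>Stability of ridge regression under empirical deviations\<close>

lemma ridge_norm_eq: "ridge_norm Q ip lam f = sqrt (ridge_ip Q ip lam f f)"
  by (simp add: ridge_norm_def ridge_ip_def)

context
  fixes lam :: real
  assumes lam: "0 < lam"
begin

interpretation r: fun_ip H "ridge_ip Q ip lam" using lam by (intro fun_ip_ridge) simp

text \<open>Against any \<open>g\<close>, the ridge form of \<open>A - f\<close> equals
  \<open>- lam * ip f g\<close>. Taking \<open>g = A - f\<close> and splitting \<open>lam\<close> as
  \<open>sqrt lam * sqrt lam\<close> leaves one factor that \<open>ridge_nm_le\<close> absorbs. This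
  is the bias term of \<open>d\<^sub>N\<close>.\<close>

lemma smoother_close:
  assumes f: "f \<in> H" and A: "A \<in> H" and A_eq: "\<And>g. g \<in> H \<Longrightarrow> ridge_ip Q ip lam A g = L2_inner Q f g"
  shows "r.nm (\<lambda>x. A x - f x) \<le> sqrt lam * h.nm f"
proof -
  let ?S = "\<lambda>x. A x - f x"
  have S: "?S \<in> H" using A f by (rule r.diff_in)
  have Sg: "ridge_ip Q ip lam ?S g = - (lam * ip f g)" if "g \<in> H" for g
    using that A f by (simp add: r.diff_left A_eq ridge_ip_def[of _ _ _ f])
  have "(r.nm ?S)\<^sup>2 = - (lam * ip f ?S)" using Sg[OF S] by (simp add: r.nm_sq S)
  also have "\<dots> \<le> lam * (h.nm f * h.nm ?S)"
  proof -
    have "- ip f ?S \<le> h.nm f * h.nm ?S" using h.cauchy_schwarz[OF f S] by linarith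
    from mult_left_mono[OF this, of lam] show ?thesis using lam by simp
  qed
  also have "\<dots> = (sqrt lam * h.nm f) * (sqrt lam * h.nm ?S)"
  proof -
    have "lam = sqrt lam * sqrt lam" using lam by simp
    then show ?thesis by (metis mult.assoc mult.left_commute)
  qed
  also have "\<dots> \<le> (sqrt lam * h.nm f) * r.nm ?S"
    using ridge_nm_le[OF lam S] lam h.nm_nonneg[OF f] unfolding r.nm_def by (intro mult_left_mono) auto
  finally have "r.nm ?S * r.nm ?S \<le> (sqrt lam * h.nm f) * r.nm ?S" by (simp add: power2_eq_square)
  then show ?thesis by (rule le_of_mult_self_le[rotated]) (use lam h.nm_nonneg[OF f] in simp)
qed

lemma smoother_nm_le:
  assumes f: "f \<in> H" and A: "A \<in> H" and A_eq: "\<And>g. g \<in> H \<Longrightarrow> ridge_ip Q ip lam A g = L2_inner Q f g"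
  shows "r.nm A \<le> r.nm f"
proof -
  have "r.nm A * r.nm A = L2_inner Q f A"
    using r.nm_sq[OF A] A_eq[OF A] by (simp add: power2_eq_square)
  also have "\<dots> \<le> l.nm f * l.nm A" using l.cauchy_schwarz[OF f A] by linarith
  also have "\<dots> \<le> r.nm f * r.nm A"
    using L2_le_ridge[OF lam f] L2_le_ridge[OF lam A] l.nm_nonneg[OF f] l.nm_nonneg[OF A] r.nm_nonneg[OF f]
    unfolding r.nm_def by (intro mult_mono) auto
  finally show ?thesis by (rule le_of_mult_self_le[OF r.nm_nonneg[OF f]])
qed

end

section \<open>Ridge regression on a single block\<close>

context
  fixes lam :: real and I :: "nat set" and xs :: "nat \<Rightarrow> 'a"
  assumes lam: "0 < lam" and I: "finite I" "I \<noteq> {}" and xs: "\<And>i. i \<in> I \<Longrightarrow> xs i \<in> \<X>"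
begin

interpretation r: fun_ip H "ridge_ip Q ip lam" using lam by (intro fun_ip_ridge) simp

abbreviation dev :: "('a \<Rightarrow> real) \<Rightarrow> ('a \<Rightarrow> real) \<Rightarrow> real" where
  "dev f g \<equiv> 1 / real (card I) * (\<Sum>i\<in>I. f (xs i) * g (xs i)) - (\<integral>x. f x * g x \<partial>Q)"

abbreviation \<Xi> :: real where "\<Xi> \<equiv> emp_deviation Q H (ridge_norm Q ip lam) I xs"

lemma ridge_norm_nm: "ridge_norm Q ip lam = r.nm"
  by (simp add: fun_eq_iff ridge_norm_eq r.nm_def)

text \<open>The size of the bound is irrelevant: its existence makes the real supremum in
  \<open>emp_deviation\<close> an upper bound of the set.\<close>

lemma dev_bound:
  assumes f: "f \<in> H" "r.nm f = 1" and g: "g \<in> H" "r.nm g = 1"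
  shows "\<bar>dev f g\<bar> \<le> c\<phi>\<^sup>2 * inverse (bandwidth \<mu> lam) + 1"
proof -
  let ?c = "c\<phi>\<^sup>2 * inverse (bandwidth \<mu> lam)"
  have n: "0 < real (card I)" using I by (simp add: card_gt_0_iff)
  have ev: "\<bar>u x\<bar> \<le> sqrt ?c" if "u \<in> H" "r.nm u = 1" "x \<in> \<X>" for u x
  proof -
    have "(u x)\<^sup>2 \<le> ridge_kernel \<mu> \<phi> lam x x * 1"
      using ridge_eval_sq_le[OF lam that(1,3)] r.nm_sq[OF that(1)] that(2) by simp
    also have "\<dots> \<le> ?c" using ridge_kernel_diag_le[OF lam] by simp
    finally show ?thesis by (intro real_le_rsqrt) simp
  qed
  have c: "0 \<le> ?c"
    unfolding inverse_bandwidth[OF lam]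
    by (intro mult_nonneg_nonneg suminf_nonneg shrink_summable lam) (use shrink_bounds[OF lam] in auto)
  have "\<bar>\<Sum>i\<in>I. f (xs i) * g (xs i)\<bar> \<le> (\<Sum>i\<in>I. ?c)"
  proof (rule order_trans[OF sum_abs sum_mono])
    fix i assume "i \<in> I"
    then have "\<bar>f (xs i)\<bar> * \<bar>g (xs i)\<bar> \<le> sqrt ?c * sqrt ?c"
      using ev[OF f] ev[OF g] xs c by (intro mult_mono) auto
    then show "\<bar>f (xs i) * g (xs i)\<bar> \<le> ?c" using c real_sqrt_mult_self[of ?c] by (simp only: abs_mult abs_of_nonneg)
  qed
  then have 1: "\<bar>1 / real (card I) * (\<Sum>i\<in>I. f (xs i) * g (xs i))\<bar> \<le> ?c"
    using n by (simp add: abs_mult field_simps)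
  have "\<bar>L2_inner Q f g\<bar> \<le> l.nm f * l.nm g" by (rule l.cauchy_schwarz[OF f(1) g(1)])
  also have "\<dots> \<le> 1 * 1"
    using L2_le_ridge[OF lam f(1)] L2_le_ridge[OF lam g(1)] f g l.nm_nonneg r.nm_def
    by (intro mult_mono) (auto simp: r.nm_def)
  finally show ?thesis using 1 unfolding L2_inner_def by linarith
qed

lemma dev_le_normalized:
  assumes "f \<in> H" "r.nm f = 1" "g \<in> H" "r.nm g = 1" shows "\<bar>dev f g\<bar> \<le> \<Xi>"
proof -
  let ?S = "{f \<in> H. r.nm f = 1} \<times> {g \<in> H. r.nm g = 1}"
  have "(case (f, g) of (f, g) \<Rightarrow> \<bar>dev f g\<bar>) \<le> (SUP (f, g) \<in> ?S. \<bar>dev f g\<bar>)"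
    by (rule cSUP_upper) (use assms dev_bound in \<open>auto intro!: bdd_aboveI2\<close>)
  then show ?thesis by (simp add: emp_deviation_def ridge_norm_nm)
qed

lemma nm_eq_0: "f \<in> H \<Longrightarrow> r.nm f = 0 \<Longrightarrow> f = (\<lambda>_. 0)"
proof (rule ip_definite)
  assume f: "f \<in> H" "r.nm f = 0"
  then have "L2_inner Q f f + lam * ip f f = 0" by (simp add: r.nm_def ridge_ip_def)
  moreover have "0 \<le> lam * ip f f" using lam h.nonneg[OF f(1)] by simp
  ultimately have "lam * ip f f = 0" using l.nonneg[OF f(1)] by linarith
  then show "ip f f = 0" using lam by simp
qed

lemma dev_le:
  assumes f: "f \<in> H" and g: "g \<in> H" shows "\<bar>dev f g\<bar> \<le> \<Xi> * (r.nm f * r.nm g)"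
proof (cases "r.nm f = 0 \<or> r.nm g = 0")
  case True
  then have "f = (\<lambda>_. 0) \<or> g = (\<lambda>_. 0)" using nm_eq_0 f g by blast
  then show ?thesis using True by auto
next
  case False
  then have p: "0 < r.nm f" "0 < r.nm g" using r.nm_nonneg f g by (auto simp: less_le)
  let ?f = "\<lambda>x. inverse (r.nm f) * f x" and ?g = "\<lambda>x. inverse (r.nm g) * g x"
  have 1: "\<bar>dev ?f ?g\<bar> \<le> \<Xi>"
    using p f g by (intro dev_le_normalized r.scale_in) (auto simp: r.nm_scale)
  have 2: "dev ?f ?g = inverse (r.nm f * r.nm g) * dev f g"
  proof -
    have *: "?f x * ?g x = inverse (r.nm f * r.nm g) * (f x * g x)" for x by simp
    then show ?thesis
      unfolding * integral_mult_right_zero sum_distrib_left[symmetric] by (simp add: algebra_simps)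
  qed
  have "\<bar>a\<bar> \<le> b \<Longrightarrow> a = inverse c * a' \<Longrightarrow> 0 < c \<Longrightarrow> \<bar>a'\<bar> \<le> b * c" for a a' b c :: real
    by (simp add: abs_mult field_simps)
  from this[OF 1 2 mult_pos_pos[OF p]] show ?thesis .
qed

text \<open>The equation of \<open>w\<close> differs from that of \<open>S\<close> by an empirical
  deviation in \<open>w\<close> itself. Testing with \<open>w - S\<close> gives \<open>\<Xi>\<close>
  times the norm of \<open>w\<close>, and \<open>\<Xi> \<le> 1 / 2\<close> bounds that norm by twice
  the norm of \<open>S\<close>.\<close>

lemma stability:
  assumes w: "w \<in> H" and S: "S \<in> H"
    and eq: "\<And>g. g \<in> H \<Longrightarrow> ridge_ip Q ip lam w g = ridge_ip Q ip lam S g - dev w g"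
    and small: "\<Xi> \<le> 1 / 2"
  shows "r.nm (\<lambda>x. w x - S x) \<le> 2 * \<Xi> * r.nm S"
proof -
  let ?d = "\<lambda>x. w x - S x"
  have d: "?d \<in> H" using w S by (rule r.diff_in)
  have "(r.nm ?d)\<^sup>2 = - dev w ?d"
    using eq[OF d] w S d by (simp add: r.nm_sq r.diff_left)
  also have "\<dots> \<le> \<Xi> * (r.nm w * r.nm ?d)" using dev_le[OF w d] by simp
  finally have *: "r.nm ?d * r.nm ?d \<le> (\<Xi> * r.nm w) * r.nm ?d" by (simp add: power2_eq_square mult_ac)
  have wS: "r.nm w - r.nm S \<le> r.nm ?d" by (rule r.nm_triangle_diff[OF w S])
  \<comment> \<open>If no element of \<open>H\<close> has norm 1, then \<open>\<Xi>\<close> is the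
    supremum of an empty set of reals and its sign is unknown. So \<open>0 \<le> \<Xi>\<close> is
    derived from an element of positive norm, here \<open>w\<close>, and the case of norm 0 is
    settled separately.\<close>
  show ?thesis
  proof (cases "r.nm w = 0")
    case True
    then have "r.nm ?d * r.nm ?d \<le> 0" using * by simp
    then have "r.nm ?d = 0" by (metis mult_eq_0_iff not_real_square_gt_zero order_less_le linorder_not_less)
    moreover have "r.nm S - r.nm w \<le> r.nm ?d"
      using r.nm_triangle_diff[OF S w] r.nm_minus[OF S w] by simp
    ultimately show ?thesis using True r.nm_nonneg[OF S] by simp
  next
    case False
    then have pos: "0 < r.nm w" using r.nm_nonneg[OF w] by simp
    have "0 \<le> \<Xi> * (r.nm w * r.nm w)" using dev_le[OF w w] by linarith
    then have \<Xi>: "0 \<le> \<Xi>" using mult_pos_pos[OF pos pos] by (simp only: zero_le_mult_iff) linarith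
    have le: "r.nm ?d \<le> \<Xi> * r.nm w"
      by (rule le_of_mult_self_le[OF _ *]) (use \<Xi> pos in simp)
    also have "\<dots> \<le> 1 / 2 * r.nm w" using small pos by (intro mult_right_mono) auto
    finally have "r.nm w \<le> 2 * r.nm S" using wS by linarith
    then have "\<Xi> * r.nm w \<le> \<Xi> * (2 * r.nm S)" using \<Xi> by (rule mult_left_mono)
    then show ?thesis using le by simp
  qed
qed

text \<open>The estimator is linear in the errors, so its noise part is determined by the responses
  to unit errors. To first order such a response is the ridge kernel at the sample point, divided by
  the block size.\<close>

lemma krr_unit_close:
  assumes i: "i \<in> I" and small: "\<Xi> \<le> 1 / 2"
  shows "r.nm (\<lambda>x. krr H ip lam I xs (\<lambda>k. if k = i then 1 else 0) x - 1 / real (card I) * ridge_kernel \<mu> \<phi> lam (xs i) x)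
    \<le> 2 * \<Xi> * (1 / real (card I) * r.nm (ridge_kernel \<mu> \<phi> lam (xs i)))"
proof -
  let ?w = "krr H ip lam I xs (\<lambda>k. if k = i then 1 else 0)"
  let ?S = "\<lambda>x. 1 / real (card I) * ridge_kernel \<mu> \<phi> lam (xs i) x"
  note K = ridge_kernel_mem[OF lam, of "xs i"]
  have w: "?w \<in> H" by (rule krr_mem[OF lam I xs])
  have "solves lam I xs (\<lambda>k. if k = i then 1 else 0) ?w" by (rule krr_solves[OF lam I xs])
  then have eq: "1 / real (card I) * (\<Sum>k\<in>I. ?w (xs k) * g (xs k)) + lam * ip ?w g = 1 / real (card I) * g (xs i)"
    if "g \<in> H" for g
    using that i I by (simp add: solves_def if_distrib[of "\<lambda>u. u * _"] sum.delta cong: if_cong)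
  have "r.nm (\<lambda>x. ?w x - ?S x) \<le> 2 * \<Xi> * r.nm ?S"
  proof (rule stability[OF w r.scale_in[OF K] _ small])
    fix g assume g: "g \<in> H"
    have "ridge_ip Q ip lam ?S g = 1 / real (card I) * g (xs i)"
      using r.scale_left[OF K g, of "1 / real (card I)"] ridge_kernel_reproducing[OF lam g xs[OF i]] by simp
    then show "ridge_ip Q ip lam ?w g = ridge_ip Q ip lam ?S g - dev ?w g"
      unfolding ridge_ip_def[of Q ip lam ?w] L2_inner_def using eq[OF g] by linarith
  qed
  also have "r.nm ?S = 1 / real (card I) * r.nm (ridge_kernel \<mu> \<phi> lam (xs i))"
    using r.nm_scale[OF K, of "1 / real (card I)"] by simp
  finally show ?thesis .
qed

text \<open>The errors \<open>w - f\<close> and \<open>A - f\<close> are compared, rather than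
  \<open>w\<close> and \<open>A\<close>. Both have the right-hand side
  \<open>- lam * ip f g\<close>, and the perturbation is the deviation of \<open>w - f\<close>. Thus
  \<open>stability\<close> produces the norm of \<open>A - f\<close>, which is at most
  \<open>sqrt lam * h.nm f\<close>.\<close>

lemma krr_noiseless_close:
  assumes f: "f \<in> H" and A: "A \<in> H" and A_eq: "\<And>g. g \<in> H \<Longrightarrow> ridge_ip Q ip lam A g = L2_inner Q f g"
    and small: "\<Xi> \<le> 1 / 2" and \<Xi>0: "\<Xi> \<le> \<rho>" "0 \<le> \<rho>"
  shows "r.nm (\<lambda>x. krr H ip lam I xs (\<lambda>k. f (xs k)) x - A x) \<le> 2 * \<rho> * (sqrt lam * h.nm f)"
proof -
  let ?w = "krr H ip lam I xs (\<lambda>k. f (xs k))"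
  let ?D = "\<lambda>x. ?w x - f x" and ?S = "\<lambda>x. A x - f x"
  have w: "?w \<in> H" by (rule krr_mem[OF lam I xs])
  have D: "?D \<in> H" and S: "?S \<in> H" using w f A by (auto intro: r.diff_in)
  have sol: "1 / real (card I) * (\<Sum>i\<in>I. ?w (xs i) * g (xs i)) + lam * ip ?w g =
     1 / real (card I) * (\<Sum>i\<in>I. f (xs i) * g (xs i))" if "g \<in> H" for g
    using krr_solves[where xs=xs and ys="\<lambda>k. f (xs k)", OF lam I xs] that by (simp add: solves_def)
  have Sg: "ridge_ip Q ip lam ?S g = - (lam * ip f g)" if "g \<in> H" for g
    using that A f by (simp add: r.diff_left A_eq ridge_ip_def[of _ _ _ f])
  have "r.nm (\<lambda>x. ?D x - ?S x) \<le> 2 * \<Xi> * r.nm ?S"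
  proof (rule stability[OF D S _ small])
    fix g assume g: "g \<in> H"
    have "(\<Sum>i\<in>I. ?D (xs i) * g (xs i)) = (\<Sum>i\<in>I. ?w (xs i) * g (xs i)) - (\<Sum>i\<in>I. f (xs i) * g (xs i))"
      by (simp add: left_diff_distrib sum_subtractf)
    then have "1 / real (card I) * (\<Sum>i\<in>I. ?D (xs i) * g (xs i)) = - (lam * ip ?w g)"
      using sol[OF g] by (simp add: right_diff_distrib)
    moreover have "ip ?D g = ip ?w g - ip f g" using w f g by (rule h.diff_left)
    then have "lam * ip ?D g = lam * ip ?w g - lam * ip f g" by (simp add: right_diff_distrib)
    ultimately show "ridge_ip Q ip lam ?D g = ridge_ip Q ip lam ?S g - dev ?D g"
      unfolding Sg[OF g] ridge_ip_def[of Q ip lam ?D] L2_inner_def by linarith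
  qed
  also have "\<dots> \<le> 2 * \<rho> * r.nm ?S" using \<Xi>0 r.nm_nonneg[OF S] by (intro mult_right_mono) auto
  also have "\<dots> \<le> 2 * \<rho> * (sqrt lam * h.nm f)"
    using smoother_close[OF lam f A A_eq] \<Xi>0 by (intro mult_left_mono) auto
  finally show ?thesis by simp
qed

lemma krr_decompose:
  "krr H ip lam I xs (\<lambda>i. f (xs i) + e i) x =
     krr H ip lam I xs (\<lambda>i. f (xs i)) x + (\<Sum>i\<in>I. e i * krr H ip lam I xs (\<lambda>k. if k = i then 1 else 0) x)"
proof -
  \<comment> \<open>Index \<open>None\<close> stands for the noiseless responses, and
    \<open>Some k\<close> for a unit response at \<open>k\<close>, to be weighted by
    \<open>e k\<close>.\<close>
  let ?y = "\<lambda>j i. case j of None \<Rightarrow> f (xs i) | Some k \<Rightarrow> if i = k then 1 else 0"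
  let ?c = "\<lambda>j. case j of None \<Rightarrow> 1 | Some k \<Rightarrow> e k"
  let ?J = "insert None (Some ` I)"
  have "solves lam I xs (\<lambda>i. \<Sum>j\<in>?J. ?c j * ?y j i) (\<lambda>x. \<Sum>j\<in>?J. ?c j * krr H ip lam I xs (?y j) x)"
    using I by (intro solves_lin[OF lam I xs] krr_solves[OF lam I xs]) auto
  moreover have "(\<Sum>j\<in>?J. ?c j * ?y j i) = f (xs i) + e i" if "i \<in> I" for i
    using I that by (simp add: sum.reindex if_distrib[of "\<lambda>u. _ * u"] sum.delta cong: if_cong)
  ultimately have "solves lam I xs (\<lambda>i. f (xs i) + e i) (\<lambda>x. \<Sum>j\<in>?J. ?c j * krr H ip lam I xs (?y j) x)"
    unfolding solves_def by (simp cong: sum.cong)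
  from krr_unique[OF lam I xs this]
  have "krr H ip lam I xs (\<lambda>i. f (xs i) + e i) x = (\<Sum>j\<in>?J. ?c j * krr H ip lam I xs (?y j) x)"
    by (metis (no_types, lifting))
  also have "\<dots> = krr H ip lam I xs (\<lambda>i. f (xs i)) x + (\<Sum>i\<in>I. e i * krr H ip lam I xs (\<lambda>k. if k = i then 1 else 0) x)"
    using I by (simp add: sum.reindex)
  finally show ?thesis .
qed

end

end

section \<open>Moments of the errors given the design\<close>

locale homoscedastic_design = regression_design M \<X> p X \<epsilon> v
  for M :: "'w measure" and \<X> :: "(real ^ 'd) set" and p X \<epsilon> v +
  fixes \<sigma>2 \<tau> :: real
  assumes hom: "\<And>x. x \<in> \<X> \<Longrightarrow> v x = \<sigma>2"
    and fourth: "\<And>i. i \<ge> 1 \<Longrightarrow> AE \<omega> in M.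
           nn_cond_exp M (vimage_algebra (space M) (X i) (restrict_space borel \<X>))
             (\<lambda>\<omega>. ennreal ((\<epsilon> i \<omega>)^4)) \<omega> < ennreal \<tau>"
    and \<tau>_pos: "0 < \<tau>"
begin

abbreviation B\<X> :: "(real ^ 'd) measure" where "B\<X> \<equiv> restrict_space borel \<X>"
abbreviation S :: "((real ^ 'd) \<times> real) measure" where "S \<equiv> B\<X> \<Otimes>\<^sub>M borel"
abbreviation D :: "nat \<Rightarrow> 'w \<Rightarrow> (real ^ 'd) \<times> real" where "D i \<omega> \<equiv> (X i \<omega>, \<epsilon> i \<omega>)"

lemma X_measurable [measurable]: "i \<ge> 1 \<Longrightarrow> X i \<in> measurable M B\<X>"
  using distributed_measurable[OF X_density, of i]
  by (simp cong: measurable_cong_sets add: sets_restrict_space_cong[of lborel borel])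

lemma \<epsilon>_measurable [measurable]: "i \<ge> 1 \<Longrightarrow> \<epsilon> i \<in> borel_measurable M"
  using \<epsilon>_integrable by blast

lemma X_in: "i \<ge> 1 \<Longrightarrow> \<omega> \<in> space M \<Longrightarrow> X i \<omega> \<in> \<X>"
  using measurable_space[OF X_measurable] by (simp add: space_restrict_space)

lemma sets_covariate: "sets (covariate_law \<X> p) = sets B\<X>"
  by (simp add: covariate_law_def sets_restrict_space_cong[of lborel borel])

lemma covariate_eq_distr: "i \<ge> 1 \<Longrightarrow> distr M B\<X> (X i) = covariate_law \<X> p"
proof -
  assume i: "i \<ge> 1"
  have "distr M B\<X> (X i) = distr M (restrict_space lborel \<X>) (X i)"
    by (rule distr_cong) (simp_all add: sets_restrict_space_cong[of lborel borel])
  then show ?thesis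
    using distributed_distr_eq_density[OF X_density[OF i]] by (simp add: covariate_law_def)
qed

lemma prob_space_covariate: "prob_space (covariate_law \<X> p)"
  unfolding covariate_eq_distr[OF order_refl, symmetric] by (rule prob_space_distr) simp

lemma space_covariate: "space (covariate_law \<X> p) = \<X>"
  by (simp add: covariate_law_def space_restrict_space)

text \<open>Everything in the sample except \<open>\<epsilon> i\<close>: the own covariate and the
  full pairs at all other indices, later ones included. Independence of the pairs makes the
  conditional mean and variance of \<open>\<epsilon> i\<close> the same as given \<open>X i\<close>
  alone.\<close>

definition past :: "nat \<Rightarrow> nat \<Rightarrow> 'w measure" where
  "past N i = vimage_algebra (space M) (\<lambda>\<omega>. (X i \<omega>, \<lambda>k\<in>{1..N} - {i}. D k \<omega>))
     (B\<X> \<Otimes>\<^sub>M PiM ({1..N} - {i}) (\<lambda>_. S))"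

definition design :: "nat \<Rightarrow> 'w measure" where
  "design N = vimage_algebra (space M) (\<lambda>\<omega>. \<lambda>k\<in>{1..N}. X k \<omega>) (PiM {1..N} (\<lambda>_. B\<X>))"

text \<open>The sample side of the independence in \<open>random_division\<close>; events for a
  fixed division have to be located in it.\<close>

definition data :: "nat \<Rightarrow> 'w measure" where
  "data N = vimage_algebra (space M) (\<lambda>\<omega>. \<lambda>k\<in>{1..N}. D k \<omega>) (PiM {1..N} (\<lambda>_. S))"

lemma space_past [simp]: "space (past N i) = space M" by (simp add: past_def)
lemma space_design [simp]: "space (design N) = space M" by (simp add: design_def)
lemma space_data [simp]: "space (data N) = space M" by (simp add: data_def)

lemma data_map [measurable]: "(\<lambda>\<omega>. \<lambda>k\<in>{1..N}. D k \<omega>) \<in> measurable M (PiM {1..N} (\<lambda>_. S))"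
  by (intro measurable_restrict measurable_Pair) auto

lemma design_map [measurable]: "(\<lambda>\<omega>. \<lambda>k\<in>{1..N}. X k \<omega>) \<in> measurable M (PiM {1..N} (\<lambda>_. B\<X>))"
  by (intro measurable_restrict) auto

lemma others_map [measurable]: "(\<lambda>\<omega>. \<lambda>k\<in>{1..N} - {i}. D k \<omega>) \<in> measurable M (PiM ({1..N} - {i}) (\<lambda>_. S))"
  by (intro measurable_restrict measurable_Pair) auto

lemma past_map: "i \<ge> 1 \<Longrightarrow> (\<lambda>\<omega>. (X i \<omega>, \<lambda>k\<in>{1..N} - {i}. D k \<omega>)) \<in>
    measurable M (B\<X> \<Otimes>\<^sub>M PiM ({1..N} - {i}) (\<lambda>_. S))"
  by (intro measurable_Pair X_measurable others_map)

lemma subalgebra_past: "i \<ge> 1 \<Longrightarrow> subalgebra M (past N i)"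
  unfolding subalgebra_def past_def using sets_image_in_sets[OF refl past_map] by (simp del: One_nat_def)

lemma subalgebra_data: "subalgebra M (data N)"
  unfolding subalgebra_def data_def using sets_image_in_sets[OF refl data_map] by (simp del: One_nat_def)

lemma X_design: "k \<in> {1..N} \<Longrightarrow> X k \<in> measurable (design N) B\<X>"
proof -
  assume k: "k \<in> {1..N}"
  have "(\<lambda>\<omega>. \<lambda>k\<in>{1..N}. X k \<omega>) \<in> measurable (design N) (PiM {1..N} (\<lambda>_. B\<X>))"
    unfolding design_def by (rule measurable_vimage_algebra1) (use measurable_space[OF design_map] in auto)
  from measurable_compose[OF this measurable_component_singleton[OF k]] k show ?thesis by simp
qed

lemma D_data: "k \<in> {1..N} \<Longrightarrow> D k \<in> measurable (data N) S"
proof -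
  assume k: "k \<in> {1..N}"
  have "(\<lambda>\<omega>. \<lambda>k\<in>{1..N}. D k \<omega>) \<in> measurable (data N) (PiM {1..N} (\<lambda>_. S))"
    unfolding data_def by (rule measurable_vimage_algebra1) (use measurable_space[OF data_map] in auto)
  from measurable_compose[OF this measurable_component_singleton[OF k]] k show ?thesis by simp
qed

lemma X_data: "k \<in> {1..N} \<Longrightarrow> X k \<in> measurable (data N) B\<X>"
  and \<epsilon>_data: "k \<in> {1..N} \<Longrightarrow> \<epsilon> k \<in> borel_measurable (data N)"
  using measurable_compose[OF D_data measurable_fst] measurable_compose[OF D_data measurable_snd] by simp_all

lemma past_map_past:
  assumes "i \<ge> 1"
  shows "(\<lambda>\<omega>. (X i \<omega>, \<lambda>k\<in>{1..N} - {i}. D k \<omega>)) \<in> measurable (past N i) (B\<X> \<Otimes>\<^sub>M PiM ({1..N} - {i}) (\<lambda>_. S))"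
  unfolding past_def by (rule measurable_vimage_algebra1) (use measurable_space[OF past_map[OF assms]] in auto)

lemma D_past: "i \<ge> 1 \<Longrightarrow> k \<in> {1..N} - {i} \<Longrightarrow> D k \<in> measurable (past N i) S"
  using measurable_compose[OF measurable_compose[OF past_map_past measurable_snd]
      measurable_component_singleton, of i k N] by simp

lemma \<epsilon>_past: "i \<ge> 1 \<Longrightarrow> k \<in> {1..N} - {i} \<Longrightarrow> \<epsilon> k \<in> borel_measurable (past N i)"
  using measurable_compose[OF D_past measurable_snd] by simp

lemma X_past: "i \<ge> 1 \<Longrightarrow> k \<in> {1..N} \<Longrightarrow> X k \<in> measurable (past N i) B\<X>"
proof (cases "k = i")
  case True
  assume "i \<ge> 1"
  then show ?thesis using measurable_compose[OF past_map_past measurable_fst, of i N] True by simp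
next
  case False
  assume "i \<ge> 1" "k \<in> {1..N}"
  then show ?thesis using measurable_compose[OF D_past measurable_fst, of i k N] False by simp
qed

lemma subalgebra_past_design: "i \<ge> 1 \<Longrightarrow> subalgebra (past N i) (design N)"
  unfolding subalgebra_def design_def
  by (intro conjI sets_image_in_sets measurable_restrict X_past) simp_all

lemma subalgebra_data_design: "subalgebra (data N) (design N)"
  unfolding subalgebra_def design_def
  by (intro conjI sets_image_in_sets measurable_restrict X_data) simp_all

lemma design_past: "i \<ge> 1 \<Longrightarrow> f \<in> measurable (design N) L \<Longrightarrow> f \<in> measurable (past N i) L"
  by (rule measurable_from_subalg[OF subalgebra_past_design])

lemma past_M: "i \<ge> 1 \<Longrightarrow> f \<in> measurable (past N i) L \<Longrightarrow> f \<in> measurable M L"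
  by (rule measurable_from_subalg[OF subalgebra_past])

lemma design_data: "f \<in> measurable (design N) L \<Longrightarrow> f \<in> measurable (data N) L"
  by (rule measurable_from_subalg[OF subalgebra_data_design])

lemma data_M: "f \<in> measurable (data N) L \<Longrightarrow> f \<in> measurable M L"
  by (rule measurable_from_subalg[OF subalgebra_data])

lemma design_M: "f \<in> measurable (design N) L \<Longrightarrow> f \<in> measurable M L"
  by (intro data_M design_data)

abbreviation \<A> :: "nat \<Rightarrow> 'w measure" where
  "\<A> i \<equiv> vimage_algebra (space M) (X i) B\<X>"

lemma subalgebra_\<A>: "i \<ge> 1 \<Longrightarrow> subalgebra M (\<A> i)"
  unfolding subalgebra_def by (simp add: sets_image_in_sets[OF refl X_measurable])

lemma X_\<A>: "i \<ge> 1 \<Longrightarrow> X i \<in> measurable (\<A> i) B\<X>"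
  by (rule measurable_vimage_algebra1) (use measurable_space[OF X_measurable] in auto)

lemma sigma_finite_sub: "subalgebra M F \<Longrightarrow> sigma_finite_subalgebra M F"
  by (intro finite_measure_subalgebra_is_sigma_finite)
     (simp add: finite_measure_subalgebra_def finite_measure_subalgebra_axioms_def finite_measure_axioms)

lemma mean_given_X:
  assumes i: "i \<ge> 1" and g: "g \<in> borel_measurable B\<X>" and int: "integrable M (\<lambda>\<omega>. g (X i \<omega>) * \<epsilon> i \<omega>)"
  shows "(\<integral>\<omega>. g (X i \<omega>) * \<epsilon> i \<omega> \<partial>M) = 0"
proof -
  interpret F: sigma_finite_subalgebra M "\<A> i" by (intro sigma_finite_sub subalgebra_\<A> i)
  have "(\<integral>\<omega>. g (X i \<omega>) * \<epsilon> i \<omega> \<partial>M) = (\<integral>\<omega>. g (X i \<omega>) * real_cond_exp M (\<A> i) (\<epsilon> i) \<omega> \<partial>M)"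
    using F.real_cond_exp_intg(2)[OF int measurable_compose[OF X_\<A>[OF i] g] \<epsilon>_measurable[OF i]] by simp
  also have "\<dots> = 0"
    by (rule integral_eq_zero_AE) (use \<epsilon>_mean[OF i] in auto)
  finally show ?thesis .
qed

lemma nn_given_X:
  assumes i: "i \<ge> 1" and g: "g \<in> borel_measurable B\<X>"
  shows "(\<integral>\<^sup>+\<omega>. g (X i \<omega>) * ennreal ((\<epsilon> i \<omega>)\<^sup>2) \<partial>M) = (\<integral>\<^sup>+\<omega>. g (X i \<omega>) * ennreal \<sigma>2 \<partial>M)"
proof -
  interpret F: sigma_finite_subalgebra M "\<A> i" by (intro sigma_finite_sub subalgebra_\<A> i)
  have [measurable]: "\<epsilon> i \<in> borel_measurable M" using i by simp
  have "(\<integral>\<^sup>+\<omega>. g (X i \<omega>) * ennreal ((\<epsilon> i \<omega>)\<^sup>2) \<partial>M)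
      = (\<integral>\<^sup>+\<omega>. g (X i \<omega>) * nn_cond_exp M (\<A> i) (\<lambda>\<omega>. ennreal ((\<epsilon> i \<omega>)\<^sup>2)) \<omega> \<partial>M)"
    by (rule F.nn_cond_exp_intg[OF measurable_compose[OF X_\<A>[OF i] g], symmetric]) simp
  also have "\<dots> = (\<integral>\<^sup>+\<omega>. g (X i \<omega>) * ennreal \<sigma>2 \<partial>M)"
  proof (rule nn_integral_cong_AE)
    show "AE \<omega> in M. g (X i \<omega>) * nn_cond_exp M (\<A> i) (\<lambda>\<omega>. ennreal ((\<epsilon> i \<omega>)\<^sup>2)) \<omega> = g (X i \<omega>) * ennreal \<sigma>2"
      using \<epsilon>_variance[OF i] AE_space by eventually_elim (simp add: hom X_in[OF i])
  qed
  finally show ?thesis .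
qed

lemma nn_fourth: assumes i: "i \<ge> 1" shows "(\<integral>\<^sup>+\<omega>. ennreal ((\<epsilon> i \<omega>)^4) \<partial>M) \<le> ennreal \<tau>"
proof -
  interpret F: sigma_finite_subalgebra M "\<A> i" by (intro sigma_finite_sub subalgebra_\<A> i)
  have [measurable]: "\<epsilon> i \<in> borel_measurable M" using i by simp
  have "(\<integral>\<^sup>+\<omega>. 1 * ennreal ((\<epsilon> i \<omega>)^4) \<partial>M)
      = (\<integral>\<^sup>+\<omega>. 1 * nn_cond_exp M (\<A> i) (\<lambda>\<omega>. ennreal ((\<epsilon> i \<omega>)^4)) \<omega> \<partial>M)"
    by (rule F.nn_cond_exp_intg[symmetric]) auto
  also have "\<dots> \<le> (\<integral>\<^sup>+\<omega>. ennreal \<tau> \<partial>M)"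
  proof (rule nn_integral_mono_AE)
    show "AE \<omega> in M. 1 * nn_cond_exp M (\<A> i) (\<lambda>\<omega>. ennreal ((\<epsilon> i \<omega>)^4)) \<omega> \<le> ennreal \<tau>"
      using fourth[OF i] by eventually_elim simp
  qed
  finally show ?thesis by (simp add: emeasure_space_1)
qed

section \<open>Moments of one error given the rest of the sample\<close>

context
  fixes N i :: nat
  assumes i: "i \<in> {1..N}"
begin

abbreviation Z :: "'w \<Rightarrow> nat \<Rightarrow> (real ^ 'd) \<times> real" where "Z \<equiv> \<lambda>\<omega>. \<lambda>k\<in>{1..N} - {i}. D k \<omega>"
abbreviation PZ :: "(nat \<Rightarrow> (real ^ 'd) \<times> real) measure" where "PZ \<equiv> PiM ({1..N} - {i}) (\<lambda>_. S)"

lemma i1: "i \<ge> 1" using i by simp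

text \<open>A family over the singleton index set, because independence of disjoint groups of
  samples is available for restricted families.\<close>

abbreviation own :: "'w \<Rightarrow> nat \<Rightarrow> (real ^ 'd) \<times> real" where "own \<equiv> \<lambda>\<omega>. \<lambda>k\<in>{i}. D k \<omega>"
abbreviation P1 :: "(nat \<Rightarrow> (real ^ 'd) \<times> real) measure" where "P1 \<equiv> PiM {i} (\<lambda>_. S)"

lemma own_measurable: "own \<in> measurable M P1"
  using i1 by (intro measurable_restrict measurable_Pair) auto

lemma joint_distr: "distr M P1 own \<Otimes>\<^sub>M distr M PZ Z = distr M (P1 \<Otimes>\<^sub>M PZ) (\<lambda>\<omega>. (own \<omega>, Z \<omega>))"
proof -
  have "indep_var P1 own PZ Z"
    using i by (intro indep_var_restrict[OF indep]) auto
  then show ?thesis using indep_var_distribution_eq by blast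
qed

text \<open>By Fubini the other samples can be frozen at a value \<open>z\<close>. The section of
  \<open>A\<close> at \<open>z\<close> is then a function of \<open>X i\<close> alone, to which the
  conditional mean given \<open>X i\<close> applies.\<close>

lemma mean_zero_indicator:
  assumes A: "A \<in> sets (B\<X> \<Otimes>\<^sub>M PZ)"
  shows "(\<integral>\<omega>. indicator A (X i \<omega>, Z \<omega>) * \<epsilon> i \<omega> \<partial>M) = 0"
proof -
  note [measurable] = own_measurable A
  interpret D: prob_space "distr M P1 own" by (rule prob_space_distr) simp
  interpret Z: prob_space "distr M PZ Z" by (rule prob_space_distr) simp
  interpret P: pair_prob_space "distr M P1 own" "distr M PZ Z" ..
  let ?f = "\<lambda>(x, z). indicator A (fst (x i), z) * snd (x i) :: real"
  have f: "?f \<in> borel_measurable (P1 \<Otimes>\<^sub>M PZ)" by measurable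
  have DZ: "(\<lambda>\<omega>. (own \<omega>, Z \<omega>)) \<in> measurable M (P1 \<Otimes>\<^sub>M PZ)" by measurable
  have "(\<lambda>\<omega>. indicator A (X i \<omega>, Z \<omega>) :: real) \<in> borel_measurable M"
    by (rule measurable_compose[OF past_map[OF i1] borel_measurable_indicator[OF A]])
  then have "(\<lambda>\<omega>. indicator A (X i \<omega>, Z \<omega>) * \<epsilon> i \<omega>) \<in> borel_measurable M"
    by (rule borel_measurable_times) (rule \<epsilon>_measurable[OF i1])
  then have "integrable M (\<lambda>\<omega>. indicator A (X i \<omega>, Z \<omega>) * \<epsilon> i \<omega>)"
    by (rule Bochner_Integration.integrable_bound[OF \<epsilon>_integrable[OF i1]]) (auto simp: indicator_def)
  then have int: "integrable (distr M P1 own \<Otimes>\<^sub>M distr M PZ Z) ?f"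
    unfolding joint_distr by (subst integrable_distr_eq[OF DZ f]) simp
  have "(\<integral>\<omega>. indicator A (X i \<omega>, Z \<omega>) * \<epsilon> i \<omega> \<partial>M) = integral\<^sup>L (distr M P1 own \<Otimes>\<^sub>M distr M PZ Z) ?f"
    unfolding joint_distr by (subst integral_distr[OF DZ f]) simp
  also have "\<dots> = (\<integral>z. (\<integral>x. indicator A (fst (x i), z) * snd (x i) \<partial>distr M P1 own) \<partial>distr M PZ Z)"
    by (rule P.integral_snd[OF int, symmetric])
  also have "\<dots> = 0"
  proof (rule integral_eq_zero_AE, rule AE_I2)
    fix z assume z: "z \<in> space (distr M PZ Z)"
    then have z': "z \<in> space PZ" by simp
    have "(\<integral>x. indicator A (fst (x i), z) * snd (x i) \<partial>distr M P1 own) = (\<integral>\<omega>. indicator A (X i \<omega>, z) * \<epsilon> i \<omega> \<partial>M)"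
      using z' by (subst integral_distr[OF own_measurable]) auto
    also have "\<dots> = 0"
    proof (rule mean_given_X[OF i1])
      show g: "(\<lambda>x. indicator A (x, z) :: real) \<in> borel_measurable B\<X>" using z' by measurable
      show "integrable M (\<lambda>\<omega>. indicator A (X i \<omega>, z) * \<epsilon> i \<omega>)"
        by (rule Bochner_Integration.integrable_bound[OF \<epsilon>_integrable[OF i1]])
           (use i1 measurable_compose[OF X_measurable[OF i1] g] in \<open>auto simp: indicator_def intro!: borel_measurable_times\<close>)
    qed
    finally show "(\<integral>x. indicator A (fst (x i), z) * snd (x i) \<partial>distr M P1 own) = 0" .
  qed
  finally show ?thesis .
qed

lemma past_sets: "B \<in> sets (past N i) \<Longrightarrow> \<exists>A\<in>sets (B\<X> \<Otimes>\<^sub>M PZ). \<forall>\<omega>\<in>space M. indicator B \<omega> = (indicator A (X i \<omega>, Z \<omega>) :: 'r :: zero_neq_one)"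
proof -
  assume B: "B \<in> sets (past N i)"
  have "(\<lambda>\<omega>. (X i \<omega>, Z \<omega>)) \<in> space M \<rightarrow> space (B\<X> \<Otimes>\<^sub>M PZ)"
    using measurable_space[OF past_map[OF i1]] by auto
  with B obtain A where "A \<in> sets (B\<X> \<Otimes>\<^sub>M PZ)" "B = (\<lambda>\<omega>. (X i \<omega>, Z \<omega>)) -` A \<inter> space M"
    unfolding past_def by (auto simp: sets_vimage_algebra2)
  then show ?thesis by (intro bexI[of _ A]) (auto simp: indicator_def)
qed

lemma mean_given_past: "AE \<omega> in M. real_cond_exp M (past N i) (\<epsilon> i) \<omega> = 0"
proof -
  interpret F: sigma_finite_subalgebra M "past N i" by (intro sigma_finite_sub subalgebra_past i1)
  show ?thesis
  proof (rule F.real_cond_exp_charact)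
    fix B assume "B \<in> sets (past N i)"
    from past_sets[OF this] obtain A where A: "A \<in> sets (B\<X> \<Otimes>\<^sub>M PZ)"
      and eq: "\<And>\<omega>. \<omega> \<in> space M \<Longrightarrow> indicator B \<omega> = (indicator A (X i \<omega>, Z \<omega>) :: real)" by blast
    have "(\<integral>\<omega>\<in>B. \<epsilon> i \<omega> \<partial>M) = (\<integral>\<omega>. indicator A (X i \<omega>, Z \<omega>) * \<epsilon> i \<omega> \<partial>M)"
      unfolding set_lebesgue_integral_def by (rule Bochner_Integration.integral_cong) (simp_all add: eq)
    then show "(\<integral>\<omega>\<in>B. \<epsilon> i \<omega> \<partial>M) = (\<integral>\<omega>\<in>B. 0 \<partial>M)"
      using mean_zero_indicator[OF A] by (simp add: set_lebesgue_integral_def)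
  qed (use \<epsilon>_integrable i1 in auto)
qed

lemma variance_indicator:
  assumes A: "A \<in> sets (B\<X> \<Otimes>\<^sub>M PZ)"
  shows "(\<integral>\<^sup>+\<omega>. indicator A (X i \<omega>, Z \<omega>) * ennreal ((\<epsilon> i \<omega>)\<^sup>2) \<partial>M)
    = (\<integral>\<^sup>+\<omega>. indicator A (X i \<omega>, Z \<omega>) * ennreal \<sigma>2 \<partial>M)"
proof -
  note [measurable] = own_measurable A
  interpret D: prob_space "distr M P1 own" by (rule prob_space_distr) simp
  interpret Z: prob_space "distr M PZ Z" by (rule prob_space_distr) simp
  interpret P: pair_prob_space "distr M P1 own" "distr M PZ Z" ..
  have DZ: "(\<lambda>\<omega>. (own \<omega>, Z \<omega>)) \<in> measurable M (P1 \<Otimes>\<^sub>M PZ)" by measurable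
  \<comment> \<open>Stated for a general \<open>u\<close> because it is applied twice: with the
    squared error, and with the constant \<open>\<sigma>2\<close> in its place.\<close>
  have fub: "(\<integral>\<^sup>+\<omega>. indicator A (X i \<omega>, Z \<omega>) * u (\<epsilon> i \<omega>) \<partial>M)
    = (\<integral>\<^sup>+z. (\<integral>\<^sup>+\<omega>. indicator A (X i \<omega>, z) * u (\<epsilon> i \<omega>) \<partial>M) \<partial>distr M PZ Z)"
    if u: "u \<in> borel_measurable borel" for u :: "real \<Rightarrow> ennreal"
  proof -
    note [measurable] = u
    let ?f = "\<lambda>(x, z). indicator A (fst (x i), z) * u (snd (x i))"
    have f: "?f \<in> borel_measurable (P1 \<Otimes>\<^sub>M PZ)" by measurable
    have f': "?f \<in> borel_measurable (distr M P1 own \<Otimes>\<^sub>M distr M PZ Z)"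
      using f by (simp cong: measurable_cong_sets)
    have "(\<integral>\<^sup>+\<omega>. indicator A (X i \<omega>, Z \<omega>) * u (\<epsilon> i \<omega>) \<partial>M) = integral\<^sup>N (distr M P1 own \<Otimes>\<^sub>M distr M PZ Z) ?f"
      using f unfolding joint_distr by (subst nn_integral_distr[OF DZ]) simp_all
    also have "\<dots> = (\<integral>\<^sup>+z. (\<integral>\<^sup>+x. ?f (x, z) \<partial>distr M P1 own) \<partial>distr M PZ Z)"
      by (rule P.nn_integral_snd[OF f', symmetric])
    also have "\<dots> = (\<integral>\<^sup>+z. (\<integral>\<^sup>+\<omega>. indicator A (X i \<omega>, z) * u (\<epsilon> i \<omega>) \<partial>M) \<partial>distr M PZ Z)"
    proof (rule nn_integral_cong)
      fix z assume "z \<in> space (distr M PZ Z)"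
      then have "z \<in> space PZ" by simp
      then show "(\<integral>\<^sup>+x. ?f (x, z) \<partial>distr M P1 own) = (\<integral>\<^sup>+\<omega>. indicator A (X i \<omega>, z) * u (\<epsilon> i \<omega>) \<partial>M)"
        by (subst nn_integral_distr[OF own_measurable]) auto
    qed
    finally show ?thesis .
  qed
  have "(\<integral>\<^sup>+z. (\<integral>\<^sup>+\<omega>. indicator A (X i \<omega>, z) * ennreal ((\<epsilon> i \<omega>)\<^sup>2) \<partial>M) \<partial>distr M PZ Z)
    = (\<integral>\<^sup>+z. (\<integral>\<^sup>+\<omega>. indicator A (X i \<omega>, z) * ennreal \<sigma>2 \<partial>M) \<partial>distr M PZ Z)"
  proof (rule nn_integral_cong)
    fix z assume "z \<in> space (distr M PZ Z)"
    then have "z \<in> space PZ" by simp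
    then have "(\<lambda>x. indicator A (x, z) :: ennreal) \<in> borel_measurable B\<X>" by measurable
    from nn_given_X[OF i1 this] show "(\<integral>\<^sup>+\<omega>. indicator A (X i \<omega>, z) * ennreal ((\<epsilon> i \<omega>)\<^sup>2) \<partial>M)
      = (\<integral>\<^sup>+\<omega>. indicator A (X i \<omega>, z) * ennreal \<sigma>2 \<partial>M)" .
  qed
  then show ?thesis using fub[of "\<lambda>e. ennreal (e\<^sup>2)"] fub[of "\<lambda>_. ennreal \<sigma>2"] by simp
qed

lemma variance_given_past: "AE \<omega> in M. ennreal \<sigma>2 = nn_cond_exp M (past N i) (\<lambda>\<omega>. ennreal ((\<epsilon> i \<omega>)\<^sup>2)) \<omega>"
proof -
  interpret F: sigma_finite_subalgebra M "past N i" by (intro sigma_finite_sub subalgebra_past i1)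
  show ?thesis
  proof (rule F.nn_cond_exp_charact)
    fix B assume "B \<in> sets (past N i)"
    from past_sets[OF this] obtain A where A: "A \<in> sets (B\<X> \<Otimes>\<^sub>M PZ)"
      and eq: "\<And>\<omega>. \<omega> \<in> space M \<Longrightarrow> indicator B \<omega> = (indicator A (X i \<omega>, Z \<omega>) :: ennreal)" by blast
    have "(\<integral>\<^sup>+\<omega>\<in>B. ennreal ((\<epsilon> i \<omega>)\<^sup>2) \<partial>M) = (\<integral>\<^sup>+\<omega>. indicator A (X i \<omega>, Z \<omega>) * ennreal ((\<epsilon> i \<omega>)\<^sup>2) \<partial>M)"
      by (rule nn_integral_cong) (simp add: eq mult.commute)
    moreover have "(\<integral>\<^sup>+\<omega>\<in>B. ennreal \<sigma>2 \<partial>M) = (\<integral>\<^sup>+\<omega>. indicator A (X i \<omega>, Z \<omega>) * ennreal \<sigma>2 \<partial>M)"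
      by (rule nn_integral_cong) (simp add: eq mult.commute)
    ultimately show "(\<integral>\<^sup>+\<omega>\<in>B. ennreal ((\<epsilon> i \<omega>)\<^sup>2) \<partial>M) = (\<integral>\<^sup>+\<omega>\<in>B. ennreal \<sigma>2 \<partial>M)"
      using variance_indicator[OF A] by simp
  qed (use \<epsilon>_measurable[OF i1] in auto)
qed

lemma first_moment:
  assumes \<Phi>: "\<Phi> \<in> borel_measurable (past N i)" and int: "integrable M (\<lambda>\<omega>. \<Phi> \<omega> * \<epsilon> i \<omega>)"
  shows "(\<integral>\<omega>. \<Phi> \<omega> * \<epsilon> i \<omega> \<partial>M) = 0"
proof -
  interpret F: sigma_finite_subalgebra M "past N i" by (intro sigma_finite_sub subalgebra_past i1)
  have "(\<integral>\<omega>. \<Phi> \<omega> * \<epsilon> i \<omega> \<partial>M) = (\<integral>\<omega>. \<Phi> \<omega> * real_cond_exp M (past N i) (\<epsilon> i) \<omega> \<partial>M)"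
    using F.real_cond_exp_intg(2)[OF int \<Phi> \<epsilon>_measurable[OF i1]] by simp
  also have "\<dots> = 0"
    by (rule integral_eq_zero_AE) (use mean_given_past in auto)
  finally show ?thesis .
qed

text \<open>Integrability is part of the conclusion: the computation runs in the nonnegative
  integral, where the squared error may be replaced by \<open>\<sigma>2\<close> under any weight
  that does not see \<open>\<epsilon> i\<close>.\<close>

lemma second_moment:
  assumes \<Phi>: "\<Phi> \<in> borel_measurable (past N i)" and nonneg: "\<And>\<omega>. \<omega> \<in> space M \<Longrightarrow> 0 \<le> \<Phi> \<omega>" and int: "integrable M \<Phi>"
    and \<sigma>2: "0 \<le> \<sigma>2"
  shows "integrable M (\<lambda>\<omega>. \<Phi> \<omega> * (\<epsilon> i \<omega>)\<^sup>2)" "(\<integral>\<omega>. \<Phi> \<omega> * (\<epsilon> i \<omega>)\<^sup>2 \<partial>M) = \<sigma>2 * (\<integral>\<omega>. \<Phi> \<omega> \<partial>M)"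
proof -
  interpret F: sigma_finite_subalgebra M "past N i" by (intro sigma_finite_sub subalgebra_past i1)
  note [measurable] = \<epsilon>_measurable[OF i1] \<Phi> past_M[OF i1 \<Phi>]
  have "(\<integral>\<^sup>+\<omega>. ennreal (\<Phi> \<omega> * (\<epsilon> i \<omega>)\<^sup>2) \<partial>M) = (\<integral>\<^sup>+\<omega>. ennreal (\<Phi> \<omega>) * ennreal ((\<epsilon> i \<omega>)\<^sup>2) \<partial>M)"
    by (rule nn_integral_cong) (simp add: nonneg ennreal_mult)
  also have "\<dots> = (\<integral>\<^sup>+\<omega>. ennreal (\<Phi> \<omega>) * nn_cond_exp M (past N i) (\<lambda>\<omega>. ennreal ((\<epsilon> i \<omega>)\<^sup>2)) \<omega> \<partial>M)"
    by (rule F.nn_cond_exp_intg[symmetric]) measurable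
  also have "\<dots> = (\<integral>\<^sup>+\<omega>. ennreal (\<Phi> \<omega>) * ennreal \<sigma>2 \<partial>M)"
    by (rule nn_integral_cong_AE) (use variance_given_past in auto)
  also have "\<dots> = (\<integral>\<^sup>+\<omega>. ennreal (\<Phi> \<omega>) \<partial>M) * ennreal \<sigma>2"
    by (rule nn_integral_multc) measurable
  also have "(\<integral>\<^sup>+\<omega>. ennreal (\<Phi> \<omega>) \<partial>M) = ennreal (\<integral>\<omega>. \<Phi> \<omega> \<partial>M)"
    by (rule nn_integral_eq_integral[OF int]) (use nonneg in auto)
  finally have *: "(\<integral>\<^sup>+\<omega>. ennreal (\<Phi> \<omega> * (\<epsilon> i \<omega>)\<^sup>2) \<partial>M) = ennreal (\<sigma>2 * (\<integral>\<omega>. \<Phi> \<omega> \<partial>M))"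
    using \<sigma>2 by (simp add: ennreal_mult' mult.commute)
  have nn: "AE \<omega> in M. 0 \<le> \<Phi> \<omega> * (\<epsilon> i \<omega>)\<^sup>2" using nonneg by auto
  have pos: "0 \<le> \<sigma>2 * (\<integral>\<omega>. \<Phi> \<omega> \<partial>M)"
    using \<sigma>2 nonneg by (intro mult_nonneg_nonneg integral_nonneg_AE) auto
  show "integrable M (\<lambda>\<omega>. \<Phi> \<omega> * (\<epsilon> i \<omega>)\<^sup>2)"
    by (rule integrableI_nn_integral_finite[OF _ nn *]) measurable
  show "(\<integral>\<omega>. \<Phi> \<omega> * (\<epsilon> i \<omega>)\<^sup>2 \<partial>M) = \<sigma>2 * (\<integral>\<omega>. \<Phi> \<omega> \<partial>M)"
    by (rule integral_eq_nn_integral[THEN trans]) (use nn * pos in auto)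
qed

end

end

section \<open>Moments of linear, quadratic and diagonal forms in the errors\<close>

context homoscedastic_design
begin

lemma \<sigma>2_pos: "0 < \<sigma>2"
proof -
  obtain \<omega> where "\<omega> \<in> space M" using not_empty by auto
  then have "X 1 \<omega> \<in> \<X>" by (intro X_in) auto
  from v_pos[OF this] hom[OF this] show ?thesis by simp
qed

lemma integrable_bounded:
  fixes \<Phi> :: "'w \<Rightarrow> real"
  assumes "\<Phi> \<in> borel_measurable M" "\<And>\<omega>. \<omega> \<in> space M \<Longrightarrow> \<bar>\<Phi> \<omega>\<bar> \<le> C"
  shows "integrable M \<Phi>"
  by (rule integrable_const_bound[where B=C]) (use assms in auto)

lemma \<epsilon>_sq:
  assumes "i \<ge> 1" shows "integrable M (\<lambda>\<omega>. (\<epsilon> i \<omega>)\<^sup>2)"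
proof -
  have "integrable M (\<lambda>\<omega>. 1 * (\<epsilon> i \<omega>)\<^sup>2)"
    by (rule second_moment(1)[where N=i]) (use assms less_imp_le[OF \<sigma>2_pos] in auto)
  then show ?thesis by simp
qed

lemma \<epsilon>_fourth:
  assumes i: "i \<ge> 1"
  shows "integrable M (\<lambda>\<omega>. (\<epsilon> i \<omega>)^4)" "(\<integral>\<omega>. (\<epsilon> i \<omega>)^4 \<partial>M) \<le> \<tau>"
proof -
  note [measurable] = \<epsilon>_measurable[OF i]
  show int: "integrable M (\<lambda>\<omega>. (\<epsilon> i \<omega>)^4)"
  proof (rule integrableI_nonneg)
    show "(\<integral>\<^sup>+\<omega>. ennreal ((\<epsilon> i \<omega>)^4) \<partial>M) < \<infinity>"
      using nn_fourth[OF i] by (rule order_le_less_trans) simp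
  qed auto
  have "ennreal (\<integral>\<omega>. (\<epsilon> i \<omega>)^4 \<partial>M) \<le> ennreal \<tau>"
    using nn_fourth[OF i] nn_integral_eq_integral[OF int] by simp
  then show "(\<integral>\<omega>. (\<epsilon> i \<omega>)^4 \<partial>M) \<le> \<tau>" using \<tau>_pos by (simp add: ennreal_le_iff)
qed

lemma integrable_mult_squares:
  fixes f g :: "'w \<Rightarrow> real"
  assumes "f \<in> borel_measurable M" "g \<in> borel_measurable M"
    and "integrable M (\<lambda>\<omega>. (f \<omega>)\<^sup>2)" "integrable M (\<lambda>\<omega>. (g \<omega>)\<^sup>2)"
  shows "integrable M (\<lambda>\<omega>. f \<omega> * g \<omega>)"
  by (rule Bochner_Integration.integrable_bound[of _ "\<lambda>\<omega>. (f \<omega>)\<^sup>2 + (g \<omega>)\<^sup>2"])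
     (use assms abs_mult_le_squares in auto)

lemma cross_moment:
  assumes i: "i \<in> {1..N}" and k: "k \<in> {1..N}" and neq: "i \<noteq> k"
    and \<Phi>: "\<Phi> \<in> borel_measurable (design N)" and C: "\<And>\<omega>. \<omega> \<in> space M \<Longrightarrow> \<bar>\<Phi> \<omega>\<bar> \<le> C"
  shows "integrable M (\<lambda>\<omega>. \<Phi> \<omega> * \<epsilon> k \<omega> * \<epsilon> i \<omega>)" "(\<integral>\<omega>. \<Phi> \<omega> * \<epsilon> k \<omega> * \<epsilon> i \<omega> \<partial>M) = 0"
proof -
  have i1: "i \<ge> 1" and k1: "k \<ge> 1" using i k by auto
  note [measurable] = \<epsilon>_measurable[OF i1] \<epsilon>_measurable[OF k1] design_M[OF \<Phi>]
  have prod: "integrable M (\<lambda>\<omega>. \<epsilon> k \<omega> * \<epsilon> i \<omega>)"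
    by (intro integrable_mult_squares \<epsilon>_sq i1 k1) measurable
  have "integrable M (\<lambda>\<omega>. C * (\<epsilon> k \<omega> * \<epsilon> i \<omega>))" using prod by simp
  then show int: "integrable M (\<lambda>\<omega>. \<Phi> \<omega> * \<epsilon> k \<omega> * \<epsilon> i \<omega>)"
  proof (rule Bochner_Integration.integrable_bound)
    show "AE \<omega> in M. norm (\<Phi> \<omega> * \<epsilon> k \<omega> * \<epsilon> i \<omega>) \<le> norm (C * (\<epsilon> k \<omega> * \<epsilon> i \<omega>))"
    proof (rule AE_I2)
      fix \<omega> assume "\<omega> \<in> space M"
      then have "\<bar>\<Phi> \<omega>\<bar> \<le> \<bar>C\<bar>" using C[of \<omega>] by linarith
      then show "norm (\<Phi> \<omega> * \<epsilon> k \<omega> * \<epsilon> i \<omega>) \<le> norm (C * (\<epsilon> k \<omega> * \<epsilon> i \<omega>))"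
        by (simp add: abs_mult mult.assoc mult_right_mono)
    qed
  qed measurable
  have "(\<lambda>\<omega>. \<Phi> \<omega> * \<epsilon> k \<omega>) \<in> borel_measurable (past N i)"
    using k neq by (intro borel_measurable_times design_past[OF i1 \<Phi>] \<epsilon>_past i1) auto
  from first_moment[OF i this int] show "(\<integral>\<omega>. \<Phi> \<omega> * \<epsilon> k \<omega> * \<epsilon> i \<omega> \<partial>M) = 0" .
qed

lemma integral_double_sum:
  fixes f :: "'i \<Rightarrow> 'j \<Rightarrow> 'w \<Rightarrow> real"
  assumes "\<And>i k. i \<in> I \<Longrightarrow> k \<in> J \<Longrightarrow> integrable M (f i k)"
  shows "(\<integral>\<omega>. (\<Sum>i\<in>I. \<Sum>k\<in>J. f i k \<omega>) \<partial>M) = (\<Sum>i\<in>I. \<Sum>k\<in>J. \<integral>\<omega>. f i k \<omega> \<partial>M)"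
proof (rule trans[OF Bochner_Integration.integral_sum sum.cong[OF refl]])
  fix i assume i: "i \<in> I"
  show "integrable M (\<lambda>\<omega>. \<Sum>k\<in>J. f i k \<omega>)"
    by (intro Bochner_Integration.integrable_sum assms i)
  show "(\<integral>\<omega>. (\<Sum>k\<in>J. f i k \<omega>) \<partial>M) = (\<Sum>k\<in>J. \<integral>\<omega>. f i k \<omega> \<partial>M)"
    by (intro Bochner_Integration.integral_sum assms i)
qed

text \<open>For \<open>i \<noteq> k\<close> the factor \<open>\<Phi> i k * \<epsilon> k\<close> is
  measurable with respect to \<open>past N i\<close>, so the term has mean 0. Only the diagonal
  remains, and there the squared error averages to \<open>\<sigma>2\<close>.\<close>

lemma quad_moment:
  assumes I: "I \<subseteq> {1..N}"
    and \<Phi>: "\<And>i k. i \<in> I \<Longrightarrow> k \<in> I \<Longrightarrow> \<Phi> i k \<in> borel_measurable (design N)"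
    and C: "\<And>i k \<omega>. i \<in> I \<Longrightarrow> k \<in> I \<Longrightarrow> \<omega> \<in> space M \<Longrightarrow> \<bar>\<Phi> i k \<omega>\<bar> \<le> C"
    and nonneg: "\<And>i \<omega>. i \<in> I \<Longrightarrow> \<omega> \<in> space M \<Longrightarrow> 0 \<le> \<Phi> i i \<omega>"
  shows "integrable M (\<lambda>\<omega>. \<Sum>i\<in>I. \<Sum>k\<in>I. \<Phi> i k \<omega> * \<epsilon> k \<omega> * \<epsilon> i \<omega>)"
    and "(\<integral>\<omega>. (\<Sum>i\<in>I. \<Sum>k\<in>I. \<Phi> i k \<omega> * \<epsilon> k \<omega> * \<epsilon> i \<omega>) \<partial>M) = \<sigma>2 * (\<Sum>i\<in>I. \<integral>\<omega>. \<Phi> i i \<omega> \<partial>M)"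
proof -
  have fin: "finite I" using I finite_subset by blast
  have tm: "integrable M (\<lambda>\<omega>. \<Phi> i k \<omega> * \<epsilon> k \<omega> * \<epsilon> i \<omega>) \<and>
    (\<integral>\<omega>. \<Phi> i k \<omega> * \<epsilon> k \<omega> * \<epsilon> i \<omega> \<partial>M) = (if k = i then \<sigma>2 * (\<integral>\<omega>. \<Phi> i i \<omega> \<partial>M) else 0)"
    if ik: "i \<in> I" "k \<in> I" for i k
  proof (cases "k = i")
    case True
    have i: "i \<in> {1..N}" using I ik by auto
    then have i1: "i \<ge> 1" by simp
    have "integrable M (\<Phi> i i)"
      by (rule integrable_bounded[OF design_M[OF \<Phi>[OF ik(1) ik(1)]] C[OF ik(1) ik(1)]])
    from second_moment[OF i design_past[OF i1 \<Phi>[OF ik(1) ik(1)]] nonneg[OF ik(1)] this] \<sigma>2_pos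
    show ?thesis using True by (simp add: power2_eq_square mult.assoc)
  next
    case False
    then have neq: "i \<noteq> k" by simp
    have "i \<in> {1..N}" "k \<in> {1..N}" using I ik by auto
    from cross_moment[OF this neq \<Phi>[OF ik] C[OF ik]] show ?thesis using False by simp
  qed
  show "integrable M (\<lambda>\<omega>. \<Sum>i\<in>I. \<Sum>k\<in>I. \<Phi> i k \<omega> * \<epsilon> k \<omega> * \<epsilon> i \<omega>)"
    by (intro Bochner_Integration.integrable_sum tm[THEN conjunct1])
  have "(\<integral>\<omega>. (\<Sum>i\<in>I. \<Sum>k\<in>I. \<Phi> i k \<omega> * \<epsilon> k \<omega> * \<epsilon> i \<omega>) \<partial>M)
    = (\<Sum>i\<in>I. \<Sum>k\<in>I. \<integral>\<omega>. \<Phi> i k \<omega> * \<epsilon> k \<omega> * \<epsilon> i \<omega> \<partial>M)"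
    by (intro integral_double_sum tm[THEN conjunct1])
  also have "\<dots> = (\<Sum>i\<in>I. \<Sum>k\<in>I. if k = i then \<sigma>2 * (\<integral>\<omega>. \<Phi> i i \<omega> \<partial>M) else 0)"
    by (intro sum.cong refl tm[THEN conjunct2])
  also have "\<dots> = \<sigma>2 * (\<Sum>i\<in>I. \<integral>\<omega>. \<Phi> i i \<omega> \<partial>M)"
    using fin by (simp add: sum.delta sum_distrib_left)
  finally show "(\<integral>\<omega>. (\<Sum>i\<in>I. \<Sum>k\<in>I. \<Phi> i k \<omega> * \<epsilon> k \<omega> * \<epsilon> i \<omega>) \<partial>M) = \<sigma>2 * (\<Sum>i\<in>I. \<integral>\<omega>. \<Phi> i i \<omega> \<partial>M)" .
qed

lemma linear_moment:
  assumes A: "A \<in> borel_measurable (covariate_law \<X> p)" and C: "\<And>x. x \<in> \<X> \<Longrightarrow> \<bar>A x\<bar> \<le> C"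
  shows "integrable M (\<lambda>\<omega>. (\<Sum>i=1..N. \<epsilon> i \<omega> * A (X i \<omega>))\<^sup>2)"
    and "(\<integral>\<omega>. (\<Sum>i=1..N. \<epsilon> i \<omega> * A (X i \<omega>))\<^sup>2 \<partial>M) = \<sigma>2 * (real N * L2_inner (covariate_law \<X> p) A A)"
proof -
  have A': "A \<in> borel_measurable B\<X>" using A by (simp add: sets_covariate cong: measurable_cong_sets)
  let ?\<Phi> = "\<lambda>i k \<omega>. A (X i \<omega>) * A (X k \<omega>)"
  have 1: "?\<Phi> i k \<in> borel_measurable (design N)" if "i \<in> {1..N}" "k \<in> {1..N}" for i k
    using that by (intro borel_measurable_times measurable_compose[OF X_design A'])
  have 2: "\<bar>?\<Phi> i k \<omega>\<bar> \<le> C * C" if "i \<in> {1..N}" "k \<in> {1..N}" "\<omega> \<in> space M" for i k \<omega>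
  proof -
    have "\<bar>A (X i \<omega>)\<bar> \<le> C" "\<bar>A (X k \<omega>)\<bar> \<le> C" using that by (auto intro!: C X_in)
    then show ?thesis unfolding abs_mult by (intro mult_mono) auto
  qed
  have 3: "0 \<le> ?\<Phi> i i \<omega>" for i \<omega> by simp
  have eq: "(\<Sum>i=1..N. \<epsilon> i \<omega> * A (X i \<omega>))\<^sup>2 = (\<Sum>i=1..N. \<Sum>k=1..N. ?\<Phi> i k \<omega> * \<epsilon> k \<omega> * \<epsilon> i \<omega>)" for \<omega>
    unfolding power2_eq_square sum_product by (intro sum.cong refl) (simp add: mult_ac)
  show "integrable M (\<lambda>\<omega>. (\<Sum>i=1..N. \<epsilon> i \<omega> * A (X i \<omega>))\<^sup>2)"
    unfolding eq by (rule quad_moment[where \<Phi>="?\<Phi>", OF order_refl 1 2 3])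
  have "(\<integral>\<omega>. ?\<Phi> i i \<omega> \<partial>M) = L2_inner (covariate_law \<X> p) A A" if "i \<in> {1..N}" for i
  proof -
    have i: "i \<ge> 1" using that by simp
    show ?thesis unfolding L2_inner_def covariate_eq_distr[OF i, symmetric]
      by (rule integral_distr[symmetric]) (use A' i in auto)
  qed
  then have "(\<Sum>i=1..N. \<integral>\<omega>. ?\<Phi> i i \<omega> \<partial>M) = real N * L2_inner (covariate_law \<X> p) A A" by simp
  then show "(\<integral>\<omega>. (\<Sum>i=1..N. \<epsilon> i \<omega> * A (X i \<omega>))\<^sup>2 \<partial>M) = \<sigma>2 * (real N * L2_inner (covariate_law \<X> p) A A)"
    unfolding eq using quad_moment(2)[where \<Phi>="?\<Phi>", OF order_refl 1 2 3] by simp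
qed

text \<open>With the ridge kernel and \<open>n = N\<close> this is \<open>W(N)\<close>. The upper
  limit is kept variable, and the larger index is summed outside, because the second moment is found
  by induction on \<open>n\<close>.\<close>

definition pair_sum :: "(real ^ 'd \<Rightarrow> real ^ 'd \<Rightarrow> real) \<Rightarrow> nat \<Rightarrow> 'w \<Rightarrow> real" where
  "pair_sum Kf n \<omega> = (\<Sum>k=1..n. \<Sum>i=1..<k. 2 * \<epsilon> i \<omega> * \<epsilon> k \<omega> * Kf (X i \<omega>) (X k \<omega>))"

context
  fixes N :: nat and Kf :: "real ^ 'd \<Rightarrow> real ^ 'd \<Rightarrow> real" and \<kappa> :: real
  assumes Kmeas: "\<And>i k. i \<in> {1..N} \<Longrightarrow> k \<in> {1..N} \<Longrightarrow> (\<lambda>\<omega>. Kf (X i \<omega>) (X k \<omega>)) \<in> borel_measurable (design N)"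
    and Kbound: "\<And>x y. x \<in> \<X> \<Longrightarrow> y \<in> \<X> \<Longrightarrow> \<bar>Kf x y\<bar> \<le> \<kappa>"
begin

lemma \<kappa>_nonneg: "0 \<le> \<kappa>"
proof -
  obtain \<omega> where "\<omega> \<in> space M" using not_empty by auto
  then have "X 1 \<omega> \<in> \<X>" by (intro X_in) auto
  from Kbound[OF this this] show ?thesis by linarith
qed

lemma Kbound': "i \<in> {1..N} \<Longrightarrow> k \<in> {1..N} \<Longrightarrow> \<omega> \<in> space M \<Longrightarrow> \<bar>Kf (X i \<omega>) (X k \<omega>)\<bar> \<le> \<kappa>"
  by (intro Kbound X_in) auto

text \<open>The increments of \<open>pair_sum Kf\<close> are martingale differences, so second moments add up.\<close>

lemma pair_sum_moment:
  assumes K2: "\<And>i k. i \<in> {1..N} \<Longrightarrow> k \<in> {1..N} \<Longrightarrow> i \<noteq> k \<Longrightarrow> (\<integral>\<omega>. (Kf (X i \<omega>) (X k \<omega>))\<^sup>2 \<partial>M) \<le> \<kappa>"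
  shows "n \<le> N \<Longrightarrow> integrable M (\<lambda>\<omega>. (pair_sum Kf n \<omega>)\<^sup>2) \<and> (\<integral>\<omega>. (pair_sum Kf n \<omega>)\<^sup>2 \<partial>M) \<le> 4 * \<sigma>2\<^sup>2 * (real n * real N) * \<kappa>"
proof (induction n)
  case 0 then show ?case by (simp add: pair_sum_def)
next
  case (Suc n)
  then have IH: "integrable M (\<lambda>\<omega>. (pair_sum Kf n \<omega>)\<^sup>2)" "(\<integral>\<omega>. (pair_sum Kf n \<omega>)\<^sup>2 \<partial>M) \<le> 4 * \<sigma>2\<^sup>2 * (real n * real N) * \<kappa>" by auto
  let ?m = "Suc n"
  have m: "?m \<in> {1..N}" using Suc.prems by auto
  have m1: "?m \<ge> 1" by simp
  \<comment> \<open>The new summand is \<open>2 * \<epsilon> m * Z\<close> with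
    \<open>m = Suc n\<close>, where neither \<open>Z\<close> nor the previous sum involves
    \<open>\<epsilon> m\<close>. Hence the cross term in the square has mean 0.\<close>
  define Z where "Z \<omega> = (\<Sum>i=1..n. \<epsilon> i \<omega> * Kf (X i \<omega>) (X ?m \<omega>))" for \<omega>
  have step: "pair_sum Kf ?m \<omega> = pair_sum Kf n \<omega> + 2 * (\<epsilon> ?m \<omega> * Z \<omega>)" for \<omega>
    by (simp add: pair_sum_def Z_def atLeastLessThanSuc_atLeastAtMost sum_distrib_left mult_ac)
  have K_past: "(\<lambda>\<omega>. Kf (X i \<omega>) (X k \<omega>)) \<in> borel_measurable (past N ?m)" if "i \<in> {1..N}" "k \<in> {1..N}" for i k
    using that by (intro design_past m1 Kmeas)
  have Z_past: "Z \<in> borel_measurable (past N ?m)"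
    unfolding Z_def using Suc.prems
    by (intro borel_measurable_sum borel_measurable_times \<epsilon>_past K_past) auto
  have V_past: "pair_sum Kf n \<in> borel_measurable (past N ?m)"
    unfolding pair_sum_def using Suc.prems
    by (intro borel_measurable_sum borel_measurable_times borel_measurable_const \<epsilon>_past K_past) auto
  note [measurable] = \<epsilon>_measurable[OF m1] past_M[OF m1 Z_past] past_M[OF m1 V_past]
  let ?\<Phi> = "\<lambda>i k \<omega>. Kf (X i \<omega>) (X ?m \<omega>) * Kf (X k \<omega>) (X ?m \<omega>)"
  have I: "{1..n} \<subseteq> {1..N}" using Suc.prems by auto
  have 1: "?\<Phi> i k \<in> borel_measurable (design N)" if "i \<in> {1..n}" "k \<in> {1..n}" for i k
    using that I m by (intro borel_measurable_times Kmeas) auto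
  have 2: "\<bar>?\<Phi> i k \<omega>\<bar> \<le> \<kappa> * \<kappa>" if "i \<in> {1..n}" "k \<in> {1..n}" "\<omega> \<in> space M" for i k \<omega>
    unfolding abs_mult using that I m \<kappa>_nonneg by (intro mult_mono Kbound') auto
  have Zsq: "(Z \<omega>)\<^sup>2 = (\<Sum>i=1..n. \<Sum>k=1..n. ?\<Phi> i k \<omega> * \<epsilon> k \<omega> * \<epsilon> i \<omega>)" for \<omega>
    unfolding Z_def power2_eq_square sum_product by (intro sum.cong refl) (simp add: mult_ac)
  have Zint: "integrable M (\<lambda>\<omega>. (Z \<omega>)\<^sup>2)" unfolding Zsq by (rule quad_moment[where \<Phi>="?\<Phi>", OF I 1 2 zero_le_square])
  have "(\<integral>\<omega>. (Z \<omega>)\<^sup>2 \<partial>M) = \<sigma>2 * (\<Sum>i=1..n. \<integral>\<omega>. ?\<Phi> i i \<omega> \<partial>M)"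
    unfolding Zsq by (rule quad_moment(2)[where \<Phi>="?\<Phi>", OF I 1 2 zero_le_square])
  also have "\<dots> \<le> \<sigma>2 * (\<Sum>i=1..n. \<kappa>)"
    using \<sigma>2_pos m I by (intro mult_left_mono sum_mono) (auto simp flip: power2_eq_square intro!: K2)
  also have "\<dots> \<le> \<sigma>2 * (real N * \<kappa>)"
    using \<sigma>2_pos \<kappa>_nonneg Suc.prems by (intro mult_left_mono) (auto intro: mult_right_mono)
  finally have EZ: "(\<integral>\<omega>. (Z \<omega>)\<^sup>2 \<partial>M) \<le> \<sigma>2 * (real N * \<kappa>)" .
  have Z2: "(\<lambda>\<omega>. (Z \<omega>)\<^sup>2) \<in> borel_measurable (past N ?m)" using Z_past by (intro borel_measurable_power)
  note sm = second_moment[OF m Z2 zero_le_power2 Zint less_imp_le[OF \<sigma>2_pos]]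
  have int2: "integrable M (\<lambda>\<omega>. (\<epsilon> ?m \<omega> * Z \<omega>)\<^sup>2)"
    using sm(1) by (simp add: power_mult_distrib mult.commute)
  have "integrable M (\<lambda>\<omega>. pair_sum Kf n \<omega> * (\<epsilon> ?m \<omega> * Z \<omega>))"
    by (intro integrable_mult_squares IH int2) measurable
  then have intc: "integrable M (\<lambda>\<omega>. (pair_sum Kf n \<omega> * Z \<omega>) * \<epsilon> ?m \<omega>)" by (simp add: mult_ac)
  have c0: "(\<integral>\<omega>. (pair_sum Kf n \<omega> * Z \<omega>) * \<epsilon> ?m \<omega> \<partial>M) = 0"
    by (rule first_moment[OF m _ intc]) (intro borel_measurable_times V_past Z_past)
  have sq: "(pair_sum Kf ?m \<omega>)\<^sup>2 = (pair_sum Kf n \<omega>)\<^sup>2 + (4 * ((pair_sum Kf n \<omega> * Z \<omega>) * \<epsilon> ?m \<omega>) + 4 * ((Z \<omega>)\<^sup>2 * (\<epsilon> ?m \<omega>)\<^sup>2))" for \<omega>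
    unfolding step by (simp add: power2_eq_square algebra_simps)
  have "integrable M (\<lambda>\<omega>. (pair_sum Kf ?m \<omega>)\<^sup>2)" unfolding sq using IH intc sm(1) by simp
  moreover have "(\<integral>\<omega>. (pair_sum Kf ?m \<omega>)\<^sup>2 \<partial>M) = (\<integral>\<omega>. (pair_sum Kf n \<omega>)\<^sup>2 \<partial>M) + 4 * (\<sigma>2 * (\<integral>\<omega>. (Z \<omega>)\<^sup>2 \<partial>M))"
    unfolding sq using IH intc sm c0 by simp
  moreover have "\<sigma>2 * (\<integral>\<omega>. (Z \<omega>)\<^sup>2 \<partial>M) \<le> \<sigma>2 * (\<sigma>2 * (real N * \<kappa>))"
    using EZ \<sigma>2_pos by (intro mult_left_mono) auto
  ultimately show ?case using IH by (simp add: power2_eq_square algebra_simps)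
qed

text \<open>The summands are independent functions of the pairs, and they are centred by
  \<open>trace\<close>, so their variances add up. Each variance is at most the second moment of
  \<open>(\<epsilon> i)\<^sup>2 K (X i) (X i)\<close>, where the fourth moment of condition (ii)
  enters.\<close>

lemma diagonal_moment:
  assumes trace: "\<And>i. i \<in> {1..N} \<Longrightarrow> (\<integral>\<omega>. Kf (X i \<omega>) (X i \<omega>) \<partial>M) = t"
    and nonneg: "\<And>x. x \<in> \<X> \<Longrightarrow> 0 \<le> Kf x x"
    and Kd: "(\<lambda>x. Kf x x) \<in> borel_measurable B\<X>"
  shows "integrable M (\<lambda>\<omega>. (\<Sum>i=1..N. (\<epsilon> i \<omega>)\<^sup>2 * Kf (X i \<omega>) (X i \<omega>) - \<sigma>2 * t)\<^sup>2)"
    and "(\<integral>\<omega>. (\<Sum>i=1..N. (\<epsilon> i \<omega>)\<^sup>2 * Kf (X i \<omega>) (X i \<omega>) - \<sigma>2 * t)\<^sup>2 \<partial>M) \<le> real N * (\<kappa>\<^sup>2 * \<tau>)"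
proof -
  define c where "c i \<omega> = (\<epsilon> i \<omega>)\<^sup>2 * Kf (X i \<omega>) (X i \<omega>)" for i \<omega>
  define a where "a i \<omega> = c i \<omega> - \<sigma>2 * t" for i \<omega>
  have c_int: "integrable M (c i)" and c_mean: "(\<integral>\<omega>. c i \<omega> \<partial>M) = \<sigma>2 * t"
    and c2_int: "integrable M (\<lambda>\<omega>. (c i \<omega>)\<^sup>2)" and c2_le: "(\<integral>\<omega>. (c i \<omega>)\<^sup>2 \<partial>M) \<le> \<kappa>\<^sup>2 * \<tau>"
    if i: "i \<in> {1..N}" for i
  proof -
    have i1: "i \<ge> 1" using i by simp
    have KM: "(\<lambda>\<omega>. Kf (X i \<omega>) (X i \<omega>)) \<in> borel_measurable M" using Kmeas[OF i i] by (rule design_M)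
    note [measurable] = \<epsilon>_measurable[OF i1] KM
    have Ki: "integrable M (\<lambda>\<omega>. Kf (X i \<omega>) (X i \<omega>))"
      using Kbound'[OF i i] by (intro integrable_bounded[OF KM])
    have nn: "0 \<le> Kf (X i \<omega>) (X i \<omega>)" if "\<omega> \<in> space M" for \<omega> using nonneg X_in[OF i1 that] by blast
    note sm = second_moment[OF i design_past[OF i1 Kmeas[OF i i]] nn Ki less_imp_le[OF \<sigma>2_pos]]
    show "integrable M (c i)" "(\<integral>\<omega>. c i \<omega> \<partial>M) = \<sigma>2 * t"
      using sm trace[OF i] by (simp_all add: c_def[abs_def] mult.commute)
    have le: "(c i \<omega>)\<^sup>2 \<le> \<kappa>\<^sup>2 * (\<epsilon> i \<omega>)^4" if "\<omega> \<in> space M" for \<omega>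
    proof -
      have "(Kf (X i \<omega>) (X i \<omega>))\<^sup>2 \<le> \<kappa>\<^sup>2"
        using Kbound'[OF i i that] nn[OF that] by (intro power_mono) auto
      then have "(\<epsilon> i \<omega>)^4 * (Kf (X i \<omega>) (X i \<omega>))\<^sup>2 \<le> (\<epsilon> i \<omega>)^4 * \<kappa>\<^sup>2"
        by (intro mult_left_mono) auto
      moreover have "(c i \<omega>)\<^sup>2 = (\<epsilon> i \<omega>)^4 * (Kf (X i \<omega>) (X i \<omega>))\<^sup>2"
        by (simp add: c_def power_mult_distrib flip: power_mult)
      ultimately show ?thesis by (simp add: mult.commute)
    qed
    have e4: "integrable M (\<lambda>\<omega>. \<kappa>\<^sup>2 * (\<epsilon> i \<omega>)^4)" using \<epsilon>_fourth[OF i1] by simp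
    show c2: "integrable M (\<lambda>\<omega>. (c i \<omega>)\<^sup>2)"
    proof (rule Bochner_Integration.integrable_bound[OF e4])
      show "(\<lambda>\<omega>. (c i \<omega>)\<^sup>2) \<in> borel_measurable M" unfolding c_def by measurable
    qed (use le in \<open>auto intro!: AE_I2 order_trans[OF _ abs_ge_self]\<close>)
    have "(\<integral>\<omega>. (c i \<omega>)\<^sup>2 \<partial>M) \<le> (\<integral>\<omega>. \<kappa>\<^sup>2 * (\<epsilon> i \<omega>)^4 \<partial>M)"
      by (rule integral_mono[OF c2 e4 le])
    also have "\<dots> = \<kappa>\<^sup>2 * (\<integral>\<omega>. (\<epsilon> i \<omega>)^4 \<partial>M)" by simp
    also have "\<dots> \<le> \<kappa>\<^sup>2 * \<tau>" using \<epsilon>_fourth(2)[OF i1] by (intro mult_left_mono) auto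
    finally show "(\<integral>\<omega>. (c i \<omega>)\<^sup>2 \<partial>M) \<le> \<kappa>\<^sup>2 * \<tau>" .
  qed
  have a_int: "integrable M (a i)" and a_mean: "(\<integral>\<omega>. a i \<omega> \<partial>M) = 0"
    and a2_int: "integrable M (\<lambda>\<omega>. a i \<omega> * a i \<omega>)" and a2_le: "(\<integral>\<omega>. a i \<omega> * a i \<omega> \<partial>M) \<le> \<kappa>\<^sup>2 * \<tau>"
    if i: "i \<in> {1..N}" for i
  proof -
    show "integrable M (a i)" unfolding a_def using c_int[OF i] by simp
    show "(\<integral>\<omega>. a i \<omega> \<partial>M) = 0" unfolding a_def using c_int[OF i] c_mean[OF i] by (simp add: prob_space)
    have sq: "a i \<omega> * a i \<omega> = (c i \<omega>)\<^sup>2 - 2 * (\<sigma>2 * t) * c i \<omega> + (\<sigma>2 * t)\<^sup>2" for \<omega>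
      by (simp add: a_def power2_eq_square algebra_simps)
    show "integrable M (\<lambda>\<omega>. a i \<omega> * a i \<omega>)" unfolding sq using c_int[OF i] c2_int[OF i] by simp
    have "(\<integral>\<omega>. a i \<omega> * a i \<omega> \<partial>M) = (\<integral>\<omega>. (c i \<omega>)\<^sup>2 \<partial>M) - (\<sigma>2 * t)\<^sup>2"
      unfolding sq using c_int[OF i] c2_int[OF i] c_mean[OF i] by (simp add: prob_space power2_eq_square)
    also have "\<dots> \<le> (\<integral>\<omega>. (c i \<omega>)\<^sup>2 \<partial>M)" by simp
    also have "\<dots> \<le> \<kappa>\<^sup>2 * \<tau>" by (rule c2_le[OF i])
    finally show "(\<integral>\<omega>. a i \<omega> * a i \<omega> \<partial>M) \<le> \<kappa>\<^sup>2 * \<tau>" .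
  qed
  have cross: "integrable M (\<lambda>\<omega>. a i \<omega> * a k \<omega>) \<and> (\<integral>\<omega>. a i \<omega> * a k \<omega> \<partial>M) = 0"
    if ik: "i \<in> {1..N}" "k \<in> {1..N}" "i \<noteq> k" for i k
  proof -
    have "(\<lambda>z. (snd z)\<^sup>2 * Kf (fst z) (fst z) - \<sigma>2 * t) \<in> borel_measurable S"
      using measurable_compose[OF measurable_fst Kd, of borel] by measurable
    then have "indep_vars (\<lambda>_. borel) (\<lambda>i \<omega>. a i \<omega>) {1..}"
      using indep_vars_compose2[OF indep, of "\<lambda>_ z. (snd z)\<^sup>2 * Kf (fst z) (fst z) - \<sigma>2 * t" "\<lambda>_. borel"]
      by (simp add: a_def c_def)
    then have ind: "indep_vars (\<lambda>_. borel) a {i, k}" by (rule indep_vars_subset) (use ik in auto)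
    have ai: "integrable M (a j)" if "j \<in> {i, k}" for j using that ik a_int by auto
    have "(\<integral>\<omega>. (\<Prod>j\<in>{i, k}. a j \<omega>) \<partial>M) = (\<Prod>j\<in>{i, k}. \<integral>\<omega>. a j \<omega> \<partial>M)"
      by (rule indep_vars_lebesgue_integral[OF _ ind ai]) auto
    moreover have "integrable M (\<lambda>\<omega>. (\<Prod>j\<in>{i, k}. a j \<omega>))"
      by (rule indep_vars_integrable[OF _ ind ai]) auto
    ultimately show ?thesis using ik a_mean by simp
  qed
  have eq: "(\<Sum>i=1..N. (\<epsilon> i \<omega>)\<^sup>2 * Kf (X i \<omega>) (X i \<omega>) - \<sigma>2 * t)\<^sup>2 = (\<Sum>i=1..N. \<Sum>k=1..N. a i \<omega> * a k \<omega>)" for \<omega>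
    by (simp add: power2_eq_square sum_product a_def c_def)
  have int: "integrable M (\<lambda>\<omega>. a i \<omega> * a k \<omega>)" if "i \<in> {1..N}" "k \<in> {1..N}" for i k
    using a2_int[of i] cross[of i k] that by (cases "i = k") auto
  show "integrable M (\<lambda>\<omega>. (\<Sum>i=1..N. (\<epsilon> i \<omega>)\<^sup>2 * Kf (X i \<omega>) (X i \<omega>) - \<sigma>2 * t)\<^sup>2)"
    unfolding eq by (intro Bochner_Integration.integrable_sum int)
  have "(\<integral>\<omega>. (\<Sum>i=1..N. \<Sum>k=1..N. a i \<omega> * a k \<omega>) \<partial>M) = (\<Sum>i=1..N. \<Sum>k=1..N. \<integral>\<omega>. a i \<omega> * a k \<omega> \<partial>M)"
    by (intro integral_double_sum int)
  also have "\<dots> = (\<Sum>i=1..N. \<integral>\<omega>. a i \<omega> * a i \<omega> \<partial>M)"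
  proof (rule sum.cong)
    fix i assume i: "i \<in> {1..N}"
    have "(\<Sum>k=1..N. \<integral>\<omega>. a i \<omega> * a k \<omega> \<partial>M) = (\<Sum>k=1..N. if k = i then \<integral>\<omega>. a i \<omega> * a i \<omega> \<partial>M else 0)"
      using cross[OF i] by (intro sum.cong) auto
    then show "(\<Sum>k=1..N. \<integral>\<omega>. a i \<omega> * a k \<omega> \<partial>M) = (\<integral>\<omega>. a i \<omega> * a i \<omega> \<partial>M)" using i by (simp add: sum.delta)
  qed simp
  also have "\<dots> \<le> (\<Sum>i=1..N. \<kappa>\<^sup>2 * \<tau>)" by (rule sum_mono[OF a2_le])
  also have "\<dots> = real N * (\<kappa>\<^sup>2 * \<tau>)" by simp
  finally show "(\<integral>\<omega>. (\<Sum>i=1..N. (\<epsilon> i \<omega>)\<^sup>2 * Kf (X i \<omega>) (X i \<omega>) - \<sigma>2 * t)\<^sup>2 \<partial>M) \<le> real N * (\<kappa>\<^sup>2 * \<tau>)"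
    unfolding eq .
qed

end

text \<open>Independence of two covariates lets the bound for the integral in one variable pass to
  the joint mean. Applied to \<open>K\<^sup>2\<close> it keeps the order
  \<open>1 / h\<close>.\<close>

lemma pair_moment:
  assumes ik: "i \<ge> 1" "k \<ge> 1" "i \<noteq> k"
    and F: "(\<lambda>(x, y). F x y) \<in> borel_measurable (covariate_law \<X> p \<Otimes>\<^sub>M covariate_law \<X> p)"
    and C: "\<And>x y. x \<in> \<X> \<Longrightarrow> y \<in> \<X> \<Longrightarrow> \<bar>F x y :: real\<bar> \<le> C"
    and B: "\<And>x. x \<in> \<X> \<Longrightarrow> (\<integral>y. F x y \<partial>covariate_law \<X> p) \<le> B"
  shows "(\<integral>\<omega>. F (X i \<omega>) (X k \<omega>) \<partial>M) \<le> B"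
proof -
  let ?Q = "covariate_law \<X> p"
  interpret Q: prob_space ?Q by (rule prob_space_covariate)
  interpret QQ: pair_prob_space ?Q ?Q ..
  have "indep_vars (\<lambda>_. B\<X>) (\<lambda>i \<omega>. fst (D i \<omega>)) {1..}"
    by (rule indep_vars_compose2[OF indep]) simp
  then have "indep_vars (\<lambda>_. B\<X>) X {1..}" by simp
  from indep_var_restrict[OF this, of "{i}" "{k}"] ik
  have "indep_var (PiM {i} (\<lambda>_. B\<X>)) (\<lambda>\<omega>. \<lambda>j\<in>{i}. X j \<omega>) (PiM {k} (\<lambda>_. B\<X>)) (\<lambda>\<omega>. \<lambda>j\<in>{k}. X j \<omega>)"
    by simp
  from indep_var_compose[OF this measurable_component_singleton measurable_component_singleton, of i k]
  have "indep_var B\<X> (X i) B\<X> (X k)" by (simp add: comp_def)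
  then have "distr M B\<X> (X i) \<Otimes>\<^sub>M distr M B\<X> (X k) = distr M (B\<X> \<Otimes>\<^sub>M B\<X>) (\<lambda>\<omega>. (X i \<omega>, X k \<omega>))"
    using indep_var_distribution_eq by blast
  then have QQ: "?Q \<Otimes>\<^sub>M ?Q = distr M (B\<X> \<Otimes>\<^sub>M B\<X>) (\<lambda>\<omega>. (X i \<omega>, X k \<omega>))"
    unfolding covariate_eq_distr[OF ik(1)] covariate_eq_distr[OF ik(2)] .
  have F': "(\<lambda>(x, y). F x y) \<in> borel_measurable (B\<X> \<Otimes>\<^sub>M B\<X>)"
    using F by (simp add: sets_covariate cong: measurable_cong_sets sets_pair_measure_cong)
  have int: "integrable (?Q \<Otimes>\<^sub>M ?Q) (\<lambda>(x, y). F x y)"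
    by (rule QQ.integrable_const_bound[where B=C, OF AE_I2 F])
       (auto simp: space_pair_measure space_covariate intro!: C)
  have "(\<integral>\<omega>. F (X i \<omega>) (X k \<omega>) \<partial>M) = (\<integral>z. (case z of (x, y) \<Rightarrow> F x y) \<partial>(?Q \<Otimes>\<^sub>M ?Q))"
    unfolding QQ by (subst integral_distr[OF _ F']) (use ik in auto)
  also have "\<dots> = (\<integral>x. (\<integral>y. F x y \<partial>?Q) \<partial>?Q)" by (rule QQ.integral_fst'[OF int, symmetric, simplified])
  also have "\<dots> \<le> (\<integral>x. B \<partial>?Q)"
    using QQ.integrable_fst'[OF int] B by (intro integral_mono) (auto simp: space_covariate)
  finally show ?thesis by (simp add: Q.prob_space)
qed

end

section \<open>Divide and conquer\<close>

lemma divisions_block: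
  assumes g: "g \<in> divisions N s n" and j: "j \<in> {1..s}" and n: "0 < n"
  shows "finite (block N g j)" "block N g j \<noteq> {}" "card (block N g j) = n" "block N g j \<subseteq> {1..N}"
proof -
  show "card (block N g j) = n" using g j by (simp add: divisions_def)
  then show "block N g j \<noteq> {}" using n by auto
qed (auto simp: block_def)

lemma divisions_label: "g \<in> divisions N s n \<Longrightarrow> i \<in> {1..N} \<Longrightarrow> g i \<in> {1..s}"
  unfolding divisions_def by blast

lemma block_label: "i \<in> {1..N} \<Longrightarrow> i \<in> block N g (g i)"
  by (simp add: block_def)

lemma finite_divisions: "finite (divisions N s n)"
  by (rule finite_subset[of _ "{1..N} \<rightarrow>\<^sub>E {1..s}"]) (auto simp: divisions_def intro: finite_PiE)

lemma sum_over_blocks: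
  fixes F :: "nat \<Rightarrow> nat \<Rightarrow> real"
  assumes g: "g \<in> divisions N s n"
  shows "(\<Sum>j=1..s. \<Sum>i\<in>block N g j. F j i) = (\<Sum>i=1..N. F (g i) i)"
proof -
  have "(\<Sum>j=1..s. \<Sum>i\<in>block N g j. F j i) = (\<Sum>j=1..s. \<Sum>i\<in>{i \<in> {1..N}. g i = j}. F (g i) i)"
    by (intro sum.cong refl) (auto simp: block_def)
  also have "\<dots> = (\<Sum>i=1..N. F (g i) i)"
    by (rule sum.group) (use divisions_label[OF g] in auto)
  finally show ?thesis .
qed

locale dc_design = homoscedastic_design M \<X> p X \<epsilon> v \<sigma>2 \<tau> +
  rk: bounded_eigen_rkhs \<X> H ip R "covariate_law \<X> p" \<mu> \<phi> c\<phi>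
  for M :: "'w measure" and \<X> :: "(real ^ 'd) set" and p X \<epsilon> v \<sigma>2 \<tau> H ip R \<mu> \<phi> c\<phi> +
  fixes N s n :: nat and lam h :: real and G :: "'w \<Rightarrow> nat \<Rightarrow> nat"
  assumes lam: "0 < lam" and N: "0 < N" and sizes: "N = n * s"
    and division: "random_division M \<X> X \<epsilon> N s n G"
    and h_eq: "h = bandwidth \<mu> lam" and h_pos: "0 < h" and c\<phi>_ge: "1 \<le> c\<phi>"
begin

abbreviation Q where "Q \<equiv> covariate_law \<X> p"
abbreviation E where "E \<equiv> ridge_ip Q ip lam"
abbreviation K where "K \<equiv> ridge_kernel \<mu> \<phi> lam"
abbreviation \<kappa> where "\<kappa> \<equiv> c\<phi>\<^sup>2 * inverse h"

sublocale r: fun_ip H E using lam by (intro rk.fun_ip_ridge) simp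

lemma n_pos: "0 < n" and s_pos: "0 < s" using N sizes by (auto intro: Nat.gr0I)

lemma \<kappa>_pos: "0 < \<kappa>" using c\<phi>_ge h_pos by simp

lemma K_mem: "K x \<in> H" by (rule rk.ridge_kernel_mem[OF lam])

lemma K_bound: "x \<in> \<X> \<Longrightarrow> y \<in> \<X> \<Longrightarrow> \<bar>K x y\<bar> \<le> \<kappa>"
  using rk.ridge_kernel_abs_le[OF lam] by (simp add: h_eq)

lemma measurable_Q: "measurable N' Q = measurable N' B\<X>"
  by (rule measurable_cong_sets) (simp_all add: sets_covariate)

lemma K_measurable:
  assumes "X i \<in> measurable N' Q" "X k \<in> measurable N' Q"
  shows "(\<lambda>\<omega>. K (X i \<omega>) (X k \<omega>)) \<in> borel_measurable N'"
  by (intro rk.Hmeas_eval rk.Hmeas_ridge_kernel lam assms)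

lemma K_design: "i \<in> {1..N} \<Longrightarrow> k \<in> {1..N} \<Longrightarrow> (\<lambda>\<omega>. K (X i \<omega>) (X k \<omega>)) \<in> borel_measurable (design N)"
  by (intro K_measurable) (simp_all add: measurable_Q X_design)

lemma K_sq_mean:
  assumes ik: "i \<in> {1..N}" "k \<in> {1..N}" "i \<noteq> k"
  shows "(\<integral>\<omega>. (K (X i \<omega>) (X k \<omega>))\<^sup>2 \<partial>M) \<le> \<kappa>"
proof (rule pair_moment)
  have "(\<lambda>z. K (fst z) (snd z)) \<in> borel_measurable (Q \<Otimes>\<^sub>M Q)"
    by (intro rk.Hmeas_eval rk.Hmeas_ridge_kernel lam measurable_fst measurable_snd)
  then show "(\<lambda>(x, y). (K x y)\<^sup>2) \<in> borel_measurable (Q \<Otimes>\<^sub>M Q)"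
    by (simp add: case_prod_beta')
  show "\<bar>(K x y)\<^sup>2\<bar> \<le> \<kappa>\<^sup>2" if "x \<in> \<X>" "y \<in> \<X>" for x y
    using power_mono[OF K_bound[OF that], of 2] by simp
  show "(\<integral>y. (K x y)\<^sup>2 \<partial>Q) \<le> \<kappa>" if "x \<in> \<X>" for x
    using rk.ridge_kernel_sq_integral[OF lam that] rk.ridge_kernel_diag_le[OF lam, of x] by (simp add: h_eq)
qed (use ik in auto)

lemma K_trace:
  assumes i: "i \<in> {1..N}" shows "(\<integral>\<omega>. K (X i \<omega>) (X i \<omega>) \<partial>M) = inverse h"
proof -
  have i1: "i \<ge> 1" using i by simp
  have "(\<lambda>x. K x x) \<in> borel_measurable Q" using rk.ridge_kernel_trace(1)[OF lam] by auto
  then have m: "(\<lambda>x. K x x) \<in> borel_measurable B\<X>" by (simp add: sets_covariate cong: measurable_cong_sets)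
  have "(\<integral>\<omega>. K (X i \<omega>) (X i \<omega>) \<partial>M) = (\<integral>x. K x x \<partial>Q)"
    unfolding covariate_eq_distr[OF i1, symmetric]
    by (rule integral_distr[symmetric]) (use m i1 in auto)
  then show ?thesis using rk.ridge_kernel_trace(2)[OF lam] by (simp add: h_eq)
qed

abbreviation xs :: "'w \<Rightarrow> nat \<Rightarrow> real ^ 'd" where "xs \<omega> \<equiv> (\<lambda>i. X i \<omega>)"

text \<open>The effect on the average estimator of a unit value of \<open>\<epsilon> i\<close>,
  minus the part \<open>K (X i) / N\<close> that is collected in \<open>lead\<close>.\<close>

definition resp :: "(nat \<Rightarrow> nat) \<Rightarrow> nat \<Rightarrow> 'w \<Rightarrow> real ^ 'd \<Rightarrow> real" where
  "resp g i \<omega> = (\<lambda>x. 1 / real s * (krr H ip lam (block N g (g i)) (xs \<omega>) (\<lambda>k. if k = i then 1 else 0) x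
      - 1 / real n * K (X i \<omega>) x))"

definition noise :: "(nat \<Rightarrow> nat) \<Rightarrow> 'w \<Rightarrow> real ^ 'd \<Rightarrow> real" where
  "noise g \<omega> = (\<lambda>x. \<Sum>i=1..N. \<epsilon> i \<omega> * resp g i \<omega> x)"

definition bias :: "(real ^ 'd \<Rightarrow> real) \<Rightarrow> (real ^ 'd \<Rightarrow> real) \<Rightarrow> (nat \<Rightarrow> nat) \<Rightarrow> 'w \<Rightarrow> real ^ 'd \<Rightarrow> real" where
  "bias f A g \<omega> = (\<lambda>x. \<Sum>j=1..s. 1 / real s * (krr H ip lam (block N g j) (xs \<omega>) (\<lambda>i. f (X i \<omega>)) x - A x))"

definition lead :: "'w \<Rightarrow> real ^ 'd \<Rightarrow> real" where
  "lead \<omega> = (\<lambda>x. \<Sum>i=1..N. (\<epsilon> i \<omega> / real N) * K (X i \<omega>) x)"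

text \<open>Up to the factor \<open>\<sigma>2\<close>, the second moment of the norm of
  \<open>noise\<close> given the covariates. Being measurable in the design, it can be used for
  truncation where the empirical deviations cannot.\<close>

definition energy :: "(nat \<Rightarrow> nat) \<Rightarrow> 'w \<Rightarrow> real" where
  "energy g \<omega> = (\<Sum>i=1..N. E (resp g i \<omega>) (resp g i \<omega>))"

abbreviation Ximax :: "(nat \<Rightarrow> nat) \<Rightarrow> 'w \<Rightarrow> real" where
  "Ximax g \<omega> \<equiv> (MAX j\<in>{1..s}. emp_deviation Q H (ridge_norm Q ip lam) (block N g j) (xs \<omega>))"

context
  fixes g assumes g: "g \<in> divisions N s n"
begin

lemma block_X: "j \<in> {1..s} \<Longrightarrow> \<omega> \<in> space M \<Longrightarrow> i \<in> block N g j \<Longrightarrow> X i \<omega> \<in> \<X>"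
  by (intro X_in) (auto simp: block_def)

lemma krr_block_mem: "j \<in> {1..s} \<Longrightarrow> \<omega> \<in> space M \<Longrightarrow> krr H ip lam (block N g j) (xs \<omega>) ys \<in> H"
  by (intro rk.krr_mem lam divisions_block(1,2)[OF g _ n_pos] block_X)

lemma resp_Hmeas:
  assumes "\<And>k. k \<in> {1..N} \<Longrightarrow> X k \<in> measurable N' B\<X>" and i: "i \<in> {1..N}"
  shows "rk.Hmeas N' (resp g i)"
  unfolding resp_def
  using assms divisions_block[OF g divisions_label[OF g i] n_pos] i
  by (intro rk.Hmeas_scale rk.Hmeas_diff rk.Hmeas_krr rk.Hmeas_ridge_kernel borel_measurable_const lam)
     (auto simp: measurable_Q)

lemma noise_Hmeas:
  assumes "\<And>k. k \<in> {1..N} \<Longrightarrow> X k \<in> measurable N' B\<X>" "\<And>k. k \<in> {1..N} \<Longrightarrow> \<epsilon> k \<in> borel_measurable N'"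
  shows "rk.Hmeas N' (noise g)"
  unfolding noise_def by (rule rk.Hmeas_lin) (auto intro: resp_Hmeas assms)

lemma resp_mem: "\<omega> \<in> space M \<Longrightarrow> i \<in> {1..N} \<Longrightarrow> resp g i \<omega> \<in> H"
  by (rule rk.Hmeas_mem[OF resp_Hmeas]) auto

lemma noise_mem: "\<omega> \<in> space M \<Longrightarrow> noise g \<omega> \<in> H"
  by (rule rk.Hmeas_mem[OF noise_Hmeas]) auto

lemma energy_design: "energy g \<in> borel_measurable (design N)"
  unfolding energy_def
  by (intro borel_measurable_sum rk.Hmeas_ridge resp_Hmeas X_design)

lemma noise_sq_data: "(\<lambda>\<omega>. E (noise g \<omega>) (noise g \<omega>)) \<in> borel_measurable (data N)"
  by (intro rk.Hmeas_ridge noise_Hmeas X_data \<epsilon>_data)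

text \<open>Chebyshev's inequality restricted to small energy. The indicator of \<open>B\<close>
  depends on the covariates only, so it can join the weights of \<open>quad_moment\<close> and makes
  them bounded. Only the diagonal survives, and it adds up to the energy: errors of different
  samples, and so of different blocks, do not reinforce each other. This is the gain over the
  triangle inequality across blocks.\<close>

lemma noise_tail:
  assumes t: "0 \<le> t" and u: "0 < u"
  defines "Ev \<equiv> {\<omega> \<in> space M. energy g \<omega> \<le> t \<and> u \<le> E (noise g \<omega>) (noise g \<omega>)}"
  shows "Ev \<in> sets (data N)" "prob Ev \<le> \<sigma>2 * t / u"
proof -
  let ?n2 = "\<lambda>\<omega>. E (noise g \<omega>) (noise g \<omega>)"
  have "Ev = {\<omega> \<in> space (data N). energy g \<omega> \<le> t \<and> u \<le> ?n2 \<omega>}" by (simp add: Ev_def)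
  also have "\<dots> \<in> sets (data N)"
    using design_data[OF energy_design] noise_sq_data by (intro sets.sets_Collect_conj borel_measurable_le) auto
  finally show "Ev \<in> sets (data N)" .
  define B where "B = {\<omega> \<in> space M. energy g \<omega> \<le> t}"
  have "B = {\<omega> \<in> space (design N). energy g \<omega> \<le> t}" by (simp add: B_def)
  also have "\<dots> \<in> sets (design N)" using energy_design by (intro borel_measurable_le) auto
  finally have B: "B \<in> sets (design N)" .
  let ?\<Phi> = "\<lambda>i k \<omega>. indicator B \<omega> * E (resp g i \<omega>) (resp g k \<omega>) :: real"
  have 1: "?\<Phi> i k \<in> borel_measurable (design N)" if "i \<in> {1..N}" "k \<in> {1..N}" for i k
    using that B by (intro borel_measurable_times borel_measurable_indicator rk.Hmeas_ridge resp_Hmeas X_design)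
  have le: "E (resp g i \<omega>) (resp g i \<omega>) \<le> energy g \<omega>" if "i \<in> {1..N}" "\<omega> \<in> space M" for i \<omega>
    unfolding energy_def using that
    by (intro member_le_sum[of i "{1..N}" "\<lambda>i. E (resp g i \<omega>) (resp g i \<omega>)"] r.nonneg resp_mem) auto
  have 2: "\<bar>?\<Phi> i k \<omega>\<bar> \<le> t" if ik: "i \<in> {1..N}" "k \<in> {1..N}" and \<omega>: "\<omega> \<in> space M" for i k \<omega>
  proof (cases "\<omega> \<in> B")
    case True
    let ?a = "resp g i \<omega>" and ?b = "resp g k \<omega>"
    have a: "?a \<in> H" and b: "?b \<in> H" using ik \<omega> by (auto intro: resp_mem)
    have "(E ?a ?b)\<^sup>2 \<le> E ?a ?a * E ?b ?b" by (rule r.cauchy_schwarz_sq[OF a b])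
    also have "\<dots> \<le> t * t"
      using le[OF ik(1) \<omega>] le[OF ik(2) \<omega>] True r.nonneg[OF a] r.nonneg[OF b] t
      by (intro mult_mono) (auto simp: B_def)
    finally have "\<bar>E ?a ?b\<bar> \<le> t" using t by (simp add: abs_le_square_iff[symmetric] power2_eq_square[symmetric])
    then show ?thesis using True by simp
  qed (use t in simp)
  have 3: "0 \<le> ?\<Phi> i i \<omega>" if "i \<in> {1..N}" "\<omega> \<in> space M" for i \<omega>
    using that by (intro mult_nonneg_nonneg r.nonneg resp_mem) auto
  have eq: "indicator B \<omega> * ?n2 \<omega> = (\<Sum>i=1..N. \<Sum>k=1..N. ?\<Phi> i k \<omega> * \<epsilon> k \<omega> * \<epsilon> i \<omega>)" if "\<omega> \<in> space M" for \<omega>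
    unfolding noise_def using that
    by (subst r.B_lin_sq) (auto intro: resp_mem simp: sum_distrib_left mult_ac)
  note qm = quad_moment[where \<Phi>="?\<Phi>" and I="{1..N}" and N=N and C=t, OF order_refl 1 2 3]
  have int: "integrable M (\<lambda>\<omega>. indicator B \<omega> * ?n2 \<omega>)"
    using qm(1) by (simp add: eq cong: Bochner_Integration.integrable_cong)
  have inti: "integrable M (?\<Phi> i i)" if "i \<in> {1..N}" for i
    by (rule integrable_bounded[OF design_M[OF 1[OF that that]] 2[OF that that]])
  have total: "(\<integral>\<omega>. indicator B \<omega> * ?n2 \<omega> \<partial>M) = \<sigma>2 * (\<Sum>i=1..N. \<integral>\<omega>. ?\<Phi> i i \<omega> \<partial>M)"
    using qm(2) by (simp add: eq cong: Bochner_Integration.integral_cong)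
  have "(\<Sum>i=1..N. \<integral>\<omega>. ?\<Phi> i i \<omega> \<partial>M) = (\<integral>\<omega>. (\<Sum>i=1..N. ?\<Phi> i i \<omega>) \<partial>M)"
    by (intro Bochner_Integration.integral_sum[symmetric] inti)
  also have "\<dots> \<le> (\<integral>\<omega>. t \<partial>M)"
  proof (rule integral_mono)
    show "integrable M (\<lambda>\<omega>. \<Sum>i=1..N. ?\<Phi> i i \<omega>)" by (intro Bochner_Integration.integrable_sum inti)
    fix \<omega> assume "\<omega> \<in> space M"
    show "(\<Sum>i=1..N. ?\<Phi> i i \<omega>) \<le> t"
      using t by (cases "\<omega> \<in> B") (auto simp: B_def energy_def)
  qed simp
  finally have "(\<Sum>i=1..N. \<integral>\<omega>. ?\<Phi> i i \<omega> \<partial>M) \<le> t" by (simp add: prob_space)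
  then have mean: "(\<integral>\<omega>. indicator B \<omega> * ?n2 \<omega> \<partial>M) \<le> \<sigma>2 * t"
    unfolding total using \<sigma>2_pos by (intro mult_left_mono) auto
  have Ev_eq: "Ev = {\<omega> \<in> space M. u \<le> indicator B \<omega> * ?n2 \<omega>}"
    using u by (auto simp: Ev_def B_def indicator_def)
  have "0 \<le> indicator B \<omega> * ?n2 \<omega>" if "\<omega> \<in> space M" for \<omega>
    using r.nonneg[OF noise_mem[OF that]] by simp
  then have "AE \<omega> in M. 0 \<le> indicator B \<omega> * ?n2 \<omega>" by (rule AE_I2)
  then have "prob Ev \<le> (\<integral>\<omega>. indicator B \<omega> * ?n2 \<omega> \<partial>M) / u"
    unfolding Ev_eq by (intro integral_Markov_inequality_measure[OF int, where A="{}"] u sets.empty_sets)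
  also have "\<dots> \<le> \<sigma>2 * t / u" using mean u by (intro divide_right_mono) auto
  finally show "prob Ev \<le> \<sigma>2 * t / u" .
qed

lemma dev_le_Ximax: "j \<in> {1..s} \<Longrightarrow> emp_deviation Q H (ridge_norm Q ip lam) (block N g j) (xs \<omega>) \<le> Ximax g \<omega>"
  by (intro Max_ge) auto

text \<open>By \<open>krr_unit_close\<close> each response has norm at most
  \<open>2 * \<rho> / N\<close> times the norm of \<open>K (X i)\<close>; squares are summed over
  \<open>N\<close> samples. The estimate holds at every outcome, so it asks for no measurability of
  \<open>Ximax\<close>.\<close>

lemma energy_le:
  assumes \<omega>: "\<omega> \<in> space M" and X\<rho>: "Ximax g \<omega> \<le> \<rho>" and \<rho>: "0 \<le> \<rho>" "\<rho> \<le> 1 / 2"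
  shows "energy g \<omega> \<le> 4 * \<rho>\<^sup>2 * \<kappa> / real N"
proof -
  have "E (resp g i \<omega>) (resp g i \<omega>) \<le> 4 * \<rho>\<^sup>2 * \<kappa> / (real N)\<^sup>2" if i: "i \<in> {1..N}" for i
  proof -
    note lab = divisions_label[OF g i]
    note blk = divisions_block[OF g lab n_pos]
    let ?I = "block N g (g i)"
    let ?Xi = "emp_deviation Q H (ridge_norm Q ip lam) ?I (xs \<omega>)"
    let ?w = "krr H ip lam ?I (xs \<omega>) (\<lambda>k. if k = i then 1 else 0)"
    have Xi: "?Xi \<le> \<rho>" using dev_le_Ximax[OF lab, of \<omega>] X\<rho> by linarith
    have x: "X i \<omega> \<in> \<X>" using i \<omega> by (intro X_in) auto
    have d: "(\<lambda>x. ?w x - 1 / real n * K (X i \<omega>) x) \<in> H"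
      by (intro r.diff_in r.scale_in K_mem krr_block_mem lab \<omega>)
    have "r.nm (\<lambda>x. ?w x - 1 / real n * K (X i \<omega>) x) \<le> 2 * ?Xi * (1 / real n * r.nm (K (X i \<omega>)))"
      using rk.krr_unit_close[where xs="xs \<omega>", OF lam blk(1,2) block_X[OF lab \<omega>] block_label[OF i]] Xi \<rho> blk(3) by simp
    also have "\<dots> \<le> 2 * \<rho> * (1 / real n * r.nm (K (X i \<omega>)))"
      using Xi r.nm_nonneg[OF K_mem] by (intro mult_right_mono mult_left_mono mult_nonneg_nonneg) auto
    finally have le: "r.nm (\<lambda>x. ?w x - 1 / real n * K (X i \<omega>) x) \<le> 2 * \<rho> * (1 / real n * r.nm (K (X i \<omega>)))" .
    have "r.nm (resp g i \<omega>) = 1 / real s * r.nm (\<lambda>x. ?w x - 1 / real n * K (X i \<omega>) x)"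
      unfolding resp_def by (subst r.nm_scale[OF d]) simp
    also have "\<dots> \<le> 1 / real s * (2 * \<rho> * (1 / real n * r.nm (K (X i \<omega>))))"
      using le by (intro mult_left_mono) auto
    also have "\<dots> = 2 * \<rho> / real N * r.nm (K (X i \<omega>))" by (simp add: sizes)
    finally have "(r.nm (resp g i \<omega>))\<^sup>2 \<le> (2 * \<rho> / real N * r.nm (K (X i \<omega>)))\<^sup>2"
      by (intro power_mono r.nm_nonneg resp_mem \<omega> i)
    also have "\<dots> = 4 * \<rho>\<^sup>2 / (real N)\<^sup>2 * K (X i \<omega>) (X i \<omega>)"
      using rk.nm_ridge_kernel_sq[OF lam x] by (simp add: power_mult_distrib power_divide)
    also have "\<dots> \<le> 4 * \<rho>\<^sup>2 / (real N)\<^sup>2 * \<kappa>"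
      using K_bound[OF x x] by (intro mult_left_mono) auto
    finally show ?thesis using r.nm_sq[OF resp_mem[OF \<omega> i]] by simp
  qed
  then have "energy g \<omega> \<le> (\<Sum>i=1..N. 4 * \<rho>\<^sup>2 * \<kappa> / (real N)\<^sup>2)" unfolding energy_def by (rule sum_mono)
  also have "\<dots> = 4 * \<rho>\<^sup>2 * \<kappa> / real N" using N by (simp add: power2_eq_square)
  finally show ?thesis .
qed

context
  fixes f A assumes f: "f \<in> H" and A: "A \<in> H" and A_eq: "\<And>g. g \<in> H \<Longrightarrow> E A g = L2_inner Q f g"
begin

lemma bias_mem: "\<omega> \<in> space M \<Longrightarrow> bias f A g \<omega> \<in> H"
  unfolding bias_def by (intro r.lin_in r.diff_in krr_block_mem A) auto

text \<open>The noiseless errors of the blocks are not centred, so they are combined by the triangle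
  inequality and averaging preserves the bound of one block.\<close>

lemma bias_le:
  assumes \<omega>: "\<omega> \<in> space M" and X\<rho>: "Ximax g \<omega> \<le> \<rho>" and \<rho>: "0 \<le> \<rho>" "\<rho> \<le> 1 / 2"
  shows "r.nm (bias f A g \<omega>) \<le> 2 * \<rho> * (sqrt lam * rk.h.nm f)"
proof -
  let ?d = "\<lambda>j x. krr H ip lam (block N g j) (xs \<omega>) (\<lambda>i. f (X i \<omega>)) x - A x"
  have d: "?d j \<in> H" if "j \<in> {1..s}" for j by (intro r.diff_in krr_block_mem A that \<omega>)
  have "r.nm (bias f A g \<omega>) \<le> (\<Sum>j=1..s. r.nm (\<lambda>x. 1 / real s * ?d j x))"
    unfolding bias_def by (rule r.nm_sum) (rule finite_atLeastAtMost, intro r.scale_in d)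
  also have "\<dots> \<le> (\<Sum>j=1..s. 1 / real s * (2 * \<rho> * (sqrt lam * rk.h.nm f)))"
  proof (rule sum_mono)
    fix j assume j: "j \<in> {1..s}"
    have Xi: "emp_deviation Q H (ridge_norm Q ip lam) (block N g j) (xs \<omega>) \<le> \<rho>"
      using dev_le_Ximax[OF j, of \<omega>] X\<rho> by linarith
    have "r.nm (?d j) \<le> 2 * \<rho> * (sqrt lam * rk.h.nm f)"
      using Xi \<rho> by (intro rk.krr_noiseless_close[OF lam divisions_block(1,2)[OF g j n_pos] block_X[OF j \<omega>] f A A_eq]) auto
    then have "1 / real s * r.nm (?d j) \<le> 1 / real s * (2 * \<rho> * (sqrt lam * rk.h.nm f))"
      by (intro mult_left_mono) auto
    then show "r.nm (\<lambda>x. 1 / real s * ?d j x) \<le> 1 / real s * (2 * \<rho> * (sqrt lam * rk.h.nm f))"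
      using r.nm_scale[OF d[OF j], of "1 / real s"] by simp
  qed
  also have "\<dots> = 2 * \<rho> * (sqrt lam * rk.h.nm f)" using s_pos by simp
  finally show ?thesis .
qed

lemma dc_decompose:
  assumes \<omega>: "\<omega> \<in> space M"
  shows "dc_krr H ip lam N s g (xs \<omega>) (\<lambda>i. f (X i \<omega>) + \<epsilon> i \<omega>) =
    (\<lambda>x. lead \<omega> x + (A x + (noise g \<omega> x + bias f A g \<omega> x)))"
proof
  fix x
  let ?k = "\<lambda>j ys. krr H ip lam (block N g j) (xs \<omega>) ys x"
  let ?e = "\<lambda>i k. if k = i then 1 else 0 :: real"
  have "dc_krr H ip lam N s g (xs \<omega>) (\<lambda>i. f (X i \<omega>) + \<epsilon> i \<omega>) x
    = 1 / real s * (\<Sum>j=1..s. ?k j (\<lambda>i. f (X i \<omega>)) + (\<Sum>i\<in>block N g j. \<epsilon> i \<omega> * ?k j (?e i)))"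
    unfolding dc_krr_def
    by (intro arg_cong[where f="\<lambda>u. 1 / real s * u"] sum.cong refl
        rk.krr_decompose lam divisions_block(1,2)[OF g _ n_pos] block_X \<omega>)
  also have "\<dots> = 1 / real s * (\<Sum>j=1..s. ?k j (\<lambda>i. f (X i \<omega>))) + (\<Sum>i=1..N. \<epsilon> i \<omega> * (1 / real s * ?k (g i) (?e i)))"
    unfolding sum.distrib sum_over_blocks[OF g] by (simp add: ring_distribs sum_distrib_left mult_ac)
  also have "(\<Sum>i=1..N. \<epsilon> i \<omega> * (1 / real s * ?k (g i) (?e i))) = lead \<omega> x + noise g \<omega> x"
  proof -
    have "\<epsilon> i \<omega> * (1 / real s * ?k (g i) (?e i)) = (\<epsilon> i \<omega> / real N) * K (X i \<omega>) x + \<epsilon> i \<omega> * resp g i \<omega> x" for i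
      unfolding resp_def by (simp add: sizes algebra_simps)
    then show ?thesis by (simp add: lead_def noise_def sum.distrib)
  qed
  also have "1 / real s * (\<Sum>j=1..s. ?k j (\<lambda>i. f (X i \<omega>))) = A x + bias f A g \<omega> x"
    unfolding bias_def sum_distrib_left[symmetric] sum_subtractf using s_pos by (simp add: right_diff_distrib)
  finally show "dc_krr H ip lam N s g (xs \<omega>) (\<lambda>i. f (X i \<omega>) + \<epsilon> i \<omega>) x = lead \<omega> x + (A x + (noise g \<omega> x + bias f A g \<omega> x))"
    by simp
qed

end

lemma dc_Hmeas:
  assumes f: "f \<in> H"
  shows "rk.Hmeas M (\<lambda>\<omega>. dc_krr H ip lam N s g (xs \<omega>) (\<lambda>i. f (X i \<omega>) + \<epsilon> i \<omega>))"
proof -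
  have i: "i \<ge> 1" if "i \<in> block N g j" for i j using that by (simp add: block_def)
  have X: "X i \<in> measurable M Q" if "i \<in> block N g j" for i j using i[OF that] by (simp add: measurable_Q)
  have Y: "(\<lambda>\<omega>. f (X i \<omega>) + \<epsilon> i \<omega>) \<in> borel_measurable M" if "i \<in> block N g j" for i j
    by (intro borel_measurable_add measurable_compose[OF X[OF that] rk.H_measurable[OF f]] \<epsilon>_measurable i[OF that])
  have "rk.Hmeas M (\<lambda>\<omega> x. \<Sum>j=1..s. 1 / real s * krr H ip lam (block N g j) (xs \<omega>) (\<lambda>i. f (X i \<omega>) + \<epsilon> i \<omega>) x)"
    by (intro rk.Hmeas_lin rk.Hmeas_krr lam divisions_block(1,2)[OF g _ n_pos] X Y borel_measurable_const) auto
  then show ?thesis unfolding dc_krr_def by (simp add: sum_distrib_left)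
qed

end

section \<open>Passing from a fixed division to the random one\<close>

lemma G_measurable: "G \<in> measurable M (count_space (divisions N s n))"
  using division by (simp add: random_division_def)

lemma G_in: "\<omega> \<in> space M \<Longrightarrow> G \<omega> \<in> divisions N s n"
  using measurable_space[OF G_measurable] by simp

text \<open>The division takes finitely many values, so it may be frozen, and
  \<open>dc_Hmeas\<close> applies to each value.\<close>

lemma statistic_measurable:
  assumes f: "f \<in> H"
  defines "fb \<equiv> \<lambda>\<omega>. dc_krr H ip lam N s (G \<omega>) (xs \<omega>) (\<lambda>i. f (X i \<omega>) + \<epsilon> i \<omega>)"
  shows "(\<lambda>\<omega>. E (fb \<omega>) (fb \<omega>)) \<in> borel_measurable M"
  unfolding fb_def
proof (rule measurable_compose_countable'[where I="divisions N s n" and g=G and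
      f="\<lambda>g \<omega>. E (dc_krr H ip lam N s g (xs \<omega>) (\<lambda>i. f (X i \<omega>) + \<epsilon> i \<omega>)) (dc_krr H ip lam N s g (xs \<omega>) (\<lambda>i. f (X i \<omega>) + \<epsilon> i \<omega>))"])
  fix g assume "g \<in> divisions N s n"
  then show "(\<lambda>\<omega>. E (dc_krr H ip lam N s g (xs \<omega>) (\<lambda>i. f (X i \<omega>) + \<epsilon> i \<omega>)) (dc_krr H ip lam N s g (xs \<omega>) (\<lambda>i. f (X i \<omega>) + \<epsilon> i \<omega>))) \<in> borel_measurable M"
    by (intro rk.Hmeas_ridge dc_Hmeas f)
qed (auto intro: G_measurable countable_finite finite_divisions)

text \<open>On \<open>G = g\<close> the event is that of \<open>noise_tail\<close>, which lies in
  \<open>data N\<close> and is therefore independent of \<open>G = g\<close>. The bound is the same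
  for every \<open>g\<close>, so it survives the average over the divisions.\<close>

lemma noise_tail_random:
  assumes t: "0 \<le> t" and u: "0 < u"
  defines "Ev \<equiv> {\<omega> \<in> space M. energy (G \<omega>) \<omega> \<le> t \<and> u \<le> E (noise (G \<omega>) \<omega>) (noise (G \<omega>) \<omega>)}"
  shows "Ev \<in> events" "prob Ev \<le> \<sigma>2 * t / u"
proof -
  let ?D = "divisions N s n"
  let ?Ev = "\<lambda>g. {\<omega> \<in> space M. energy g \<omega> \<le> t \<and> u \<le> E (noise g \<omega>) (noise g \<omega>)}"
  let ?Gv = "\<lambda>g. G -` {g} \<inter> space M"
  note nt = noise_tail[OF _ t u]
  have Gv: "?Gv g \<in> sets (vimage_algebra (space M) G (count_space ?D))" if "g \<in> ?D" for g
    by (rule in_vimage_algebra) (use that in auto)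
  have Gm: "?Gv g \<in> events" if "g \<in> ?D" for g
    by (rule measurable_sets[OF G_measurable]) (use that in auto)
  have Em: "?Ev g \<in> events" if "g \<in> ?D" for g
    using nt(1)[OF that] subalgebra_data by (auto simp: subalgebra_def)
  have eq: "Ev = (\<Union>g\<in>?D. ?Gv g \<inter> ?Ev g)"
    unfolding Ev_def using G_in by auto
  show "Ev \<in> events" unfolding eq using Gm Em by (intro sets.finite_UN finite_divisions) auto
  have ind: "prob (?Gv g \<inter> ?Ev g) = prob (?Gv g) * prob (?Ev g)" if "g \<in> ?D" for g
    by (rule indep_setD[OF _ Gv[OF that] nt(1)[OF that, unfolded data_def]])
       (use division in \<open>simp add: random_division_def\<close>)
  have "prob Ev \<le> (\<Sum>g\<in>?D. prob (?Gv g \<inter> ?Ev g))"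
    unfolding eq using Gm Em by (intro finite_measure_subadditive_finite finite_divisions) auto
  also have "\<dots> \<le> (\<Sum>g\<in>?D. prob (?Gv g) * (\<sigma>2 * t / u))"
  proof (rule sum_mono)
    fix g assume "g \<in> ?D"
    then show "prob (?Gv g \<inter> ?Ev g) \<le> prob (?Gv g) * (\<sigma>2 * t / u)"
      unfolding ind[OF \<open>g \<in> ?D\<close>] by (intro mult_left_mono nt(2)) auto
  qed
  also have "\<dots> = (\<Sum>g\<in>?D. prob (?Gv g)) * (\<sigma>2 * t / u)" by (rule sum_distrib_right[symmetric])
  also have "(\<Sum>g\<in>?D. prob (?Gv g)) = prob (\<Union>g\<in>?D. ?Gv g)"
    using Gm by (intro finite_measure_finite_Union[symmetric] finite_divisions) (auto simp: disjoint_family_on_def)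
  also have "\<dots> * (\<sigma>2 * t / u) \<le> 1 * (\<sigma>2 * t / u)"
    using t u \<sigma>2_pos by (intro mult_right_mono) auto
  finally show "prob Ev \<le> \<sigma>2 * t / u" by simp
qed

section \<open>The leading noise term\<close>

lemma lead_mem: "lead \<omega> \<in> H"
  unfolding lead_def by (intro r.lin_in K_mem) auto

lemma lead_inner:
  assumes \<omega>: "\<omega> \<in> space M" and A: "A \<in> H"
  shows "E (lead \<omega>) A = (\<Sum>i=1..N. \<epsilon> i \<omega> * A (X i \<omega>)) / real N"
proof -
  have "E (lead \<omega>) A = (\<Sum>i=1..N. (\<epsilon> i \<omega> / real N) * E (K (X i \<omega>)) A)"
    unfolding lead_def by (intro r.lin_left K_mem A) auto
  also have "\<dots> = (\<Sum>i=1..N. \<epsilon> i \<omega> * A (X i \<omega>)) / real N"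
    unfolding sum_divide_distrib
    using \<omega> A by (intro sum.cong refl) (simp add: rk.ridge_kernel_reproducing[OF lam] X_in)
  finally show ?thesis .
qed

text \<open>By the reproducing property the squared norm is a double sum of kernel values. The
  diagonal has mean \<open>\<sigma>2 / (N * h)\<close> after division by \<open>N\<^sup>2\<close>;
  symmetry of the kernel turns the rest into \<open>pair_sum\<close>.\<close>

lemma lead_sq:
  assumes \<omega>: "\<omega> \<in> space M"
  shows "E (lead \<omega>) (lead \<omega>) = ((\<Sum>i=1..N. (\<epsilon> i \<omega>)\<^sup>2 * K (X i \<omega>) (X i \<omega>)) + pair_sum K N \<omega>) / (real N)\<^sup>2"
proof -
  let ?a = "\<lambda>i k. \<epsilon> i \<omega> * \<epsilon> k \<omega> * K (X i \<omega>) (X k \<omega>)"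
  have sym: "?a i k = ?a k i" for i k by (simp add: rk.ridge_kernel_sym[OF lam, of "X i \<omega>"] mult_ac)
  have double: "(\<Sum>i=1..n. \<Sum>k=1..n. ?a i k) = (\<Sum>i=1..n. ?a i i) + (\<Sum>k=1..n. \<Sum>i=1..<k. 2 * ?a i k)" for n
  proof (induction n)
    case (Suc n)
    have "(\<Sum>i=1..Suc n. \<Sum>k=1..Suc n. ?a i k)
      = (\<Sum>i=1..n. \<Sum>k=1..n. ?a i k) + (\<Sum>i=1..n. ?a i (Suc n)) + (\<Sum>k=1..n. ?a (Suc n) k) + ?a (Suc n) (Suc n)"
      by (simp add: sum.distrib)
    also have "(\<Sum>k=1..n. ?a (Suc n) k) = (\<Sum>k=1..n. ?a k (Suc n))" by (intro sum.cong refl sym)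
    finally show ?case using Suc.IH
      by (simp add: atLeastLessThanSuc_atLeastAtMost sum_distrib_left[symmetric])
  qed simp
  have "E (lead \<omega>) (lead \<omega>) = (\<Sum>i=1..N. (\<epsilon> i \<omega> / real N) * E (K (X i \<omega>)) (lead \<omega>))"
    by (subst (1) lead_def, rule r.lin_left) (auto intro: K_mem lead_mem)
  also have "\<dots> = (\<Sum>i=1..N. (\<epsilon> i \<omega> / real N) * (\<Sum>k=1..N. (\<epsilon> k \<omega> / real N) * K (X k \<omega>) (X i \<omega>)))"
  proof (rule sum.cong)
    fix i assume "i \<in> {1..N}"
    then have "X i \<omega> \<in> \<X>" using \<omega> by (intro X_in) auto
    then show "(\<epsilon> i \<omega> / real N) * E (K (X i \<omega>)) (lead \<omega>) = (\<epsilon> i \<omega> / real N) * (\<Sum>k=1..N. (\<epsilon> k \<omega> / real N) * K (X k \<omega>) (X i \<omega>))"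
      using rk.ridge_kernel_reproducing[OF lam lead_mem, of "X i \<omega>"] by (simp add: lead_def)
  qed simp
  also have "\<dots> = (\<Sum>i=1..N. \<Sum>k=1..N. ?a k i) / (real N)\<^sup>2"
    by (simp add: sum_distrib_left sum_divide_distrib power2_eq_square mult_ac)
  also have "(\<Sum>i=1..N. \<Sum>k=1..N. ?a k i) = (\<Sum>i=1..N. \<Sum>k=1..N. ?a i k)" by (intro sum.cong refl sym)
  also have "\<dots> = (\<Sum>i=1..N. ?a i i) + (\<Sum>k=1..N. \<Sum>i=1..<k. 2 * ?a i k)" by (rule double)
  also have "(\<Sum>k=1..N. \<Sum>i=1..<k. 2 * ?a i k) = pair_sum K N \<omega>"
    unfolding pair_sum_def by (intro sum.cong refl) (simp add: mult.assoc)
  finally show ?thesis by (simp add: power2_eq_square mult.assoc)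
qed

lemma tail_bound:
  fixes Z :: "'w \<Rightarrow> real"
  assumes "integrable M (\<lambda>\<omega>. (Z \<omega>)\<^sup>2)" "(\<integral>\<omega>. (Z \<omega>)\<^sup>2 \<partial>M) \<le> \<beta>" "0 < u"
  shows "{\<omega> \<in> space M. u \<le> (Z \<omega>)\<^sup>2} \<in> events" "prob {\<omega> \<in> space M. u \<le> (Z \<omega>)\<^sup>2} \<le> \<beta> / u"
proof -
  have [measurable]: "(\<lambda>\<omega>. (Z \<omega>)\<^sup>2) \<in> borel_measurable M" using assms(1) by blast
  show "{\<omega> \<in> space M. u \<le> (Z \<omega>)\<^sup>2} \<in> events" by measurable
  have "prob {\<omega> \<in> space M. u \<le> (Z \<omega>)\<^sup>2} \<le> (\<integral>\<omega>. (Z \<omega>)\<^sup>2 \<partial>M) / u"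
    by (rule integral_Markov_inequality_measure[OF assms(1), where A="{}"]) (use assms in auto)
  also have "\<dots> \<le> \<beta> / u" using assms by (intro divide_right_mono) auto
  finally show "prob {\<omega> \<in> space M. u \<le> (Z \<omega>)\<^sup>2} \<le> \<beta> / u" .
qed

end

section \<open>Power of the test\<close>

text \<open>The deterministic core. \<open>F\<close> is the norm of \<open>f\<close> and
  \<open>L\<close> its bias bound; \<open>nU\<close>, \<open>nD\<close>, \<open>nP\<close> are the
  norms of \<open>U\<close>, \<open>D\<close> and \<open>A + D\<close>; \<open>c0\<close> is the
  centring and \<open>T\<close> the statistic. With \<open>e = F / C\<close> every part of the
  separation rate is at most \<open>e\<close>, so \<open>nP\<^sup>2\<close> grows like
  \<open>C\<^sup>2 e\<^sup>2\<close> while all other terms are at most linear in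
  \<open>C\<close>.\<close>

lemma detection_bound:
  fixes F L b y w x C C3 C4 C5 C6 C7 Z UU UA UD nU nD nP c0 T :: real
  assumes nonneg: "0 \<le> L" "0 \<le> b" "0 \<le> y" "0 \<le> w" "0 \<le> x"
      "0 \<le> C3" "0 \<le> C4" "0 \<le> C5" "0 \<le> C6" "0 \<le> C7" "0 \<le> Z"
    and C: "1 + 2 * (1 + C7) + 2 * C3 + 2 * (C6 * C7) + C4 + C5 + Z \<le> C"
    and sep: "C * (L + sqrt y + w + sqrt (b * x) + b) \<le> F"
    and D: "0 \<le> nD" "nD \<le> C7 * b" and U: "0 \<le> nU" "nU \<le> C6 * x"
    and UU: "c0 - (C4 + C5) * y \<le> UU" and UA: "\<bar>UA\<bar> \<le> C3 * F * w" and UD: "\<bar>UD\<bar> \<le> nU * nD"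
    and P: "F - L - nD \<le> nP" and T: "T = UU + 2 * (UA + UD) + nP\<^sup>2"
  shows "Z * y \<le> T - c0"
proof -
  \<comment> \<open>Obtained rather than substituted, so that the arithmetic treats the product as
    an atom.\<close>
  obtain q where q: "q = C6 * C7" by simp
  have C67: "0 \<le> q" using nonneg by (simp add: q)
  note C = C[folded q]
  have C1: "1 \<le> C" using C nonneg C67 by simp
  define e where "e = F / C"
  have F: "F = C * e" using C1 by (simp add: e_def)
  have sum: "L + sqrt y + w + sqrt (b * x) + b \<le> e"
    using sep C1 unfolding F by (simp add: mult_le_cancel_left)
  have pos: "0 \<le> sqrt y" "0 \<le> sqrt (b * x)" using nonneg by simp_all
  have L: "L \<le> e" and w: "w \<le> e" and b: "b \<le> e" and sy: "sqrt y \<le> e" and sbx: "sqrt (b * x) \<le> e"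
    using sum pos nonneg by linarith+
  have e: "0 \<le> e" using b nonneg by linarith
  have y: "y \<le> e\<^sup>2" using power_mono[OF sy pos(1), of 2] nonneg by simp
  have bx: "b * x \<le> e\<^sup>2" using power_mono[OF sbx pos(2), of 2] nonneg by simp
  have "\<bar>UA\<bar> \<le> C3 * F * w" by (rule UA)
  also have "\<dots> \<le> C3 * F * e" using w nonneg e C1 by (intro mult_left_mono) (auto simp: F)
  also have "\<dots> = C3 * C * e\<^sup>2" by (simp add: F power2_eq_square)
  finally have UA': "\<bar>UA\<bar> \<le> C3 * C * e\<^sup>2" .
  have "\<bar>UD\<bar> \<le> nU * nD" by (rule UD)
  also have "\<dots> \<le> (C6 * x) * (C7 * b)" using D U nonneg by (intro mult_mono) auto
  also have "\<dots> = q * (b * x)" by (simp add: q mult_ac)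
  also have "\<dots> \<le> q * e\<^sup>2" using bx C67 by (intro mult_left_mono)
  finally have UD': "\<bar>UD\<bar> \<le> q * e\<^sup>2" .
  have "nD \<le> C7 * e" using D b nonneg by (meson mult_left_mono order_trans)
  then have nP: "(C - 1 - C7) * e \<le> nP" using P L unfolding F by (simp add: algebra_simps)
  have "0 \<le> C - 1 - C7" using C nonneg C67 by simp
  then have "((C - 1 - C7) * e)\<^sup>2 \<le> nP\<^sup>2" using nP e by (intro power_mono mult_nonneg_nonneg)
  moreover have "((C - 1 - C7) * e)\<^sup>2 = (C - 1 - C7)\<^sup>2 * e\<^sup>2" by (simp add: power_mult_distrib)
  \<comment> \<open>Of \<open>F = C e\<close>, the bias costs at most \<open>e\<close> and
    \<open>nD\<close> at most \<open>C7 e\<close>. The square is written with a factor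
    \<open>C\<close> in front, to be set against the term \<open>2 * C3 * C\<close> of
    \<open>UA\<close>; the last summand is dropped.\<close>
  moreover have "(C - 1 - C7)\<^sup>2 = C * (C - 2 * (1 + C7)) + (1 + C7)\<^sup>2"
    by (simp add: power2_eq_square algebra_simps)
  ultimately have "(C * (C - 2 * (1 + C7))) * e\<^sup>2 + (1 + C7)\<^sup>2 * e\<^sup>2 \<le> nP\<^sup>2" by (simp add: distrib_right)
  then have nP2: "(C * (C - 2 * (1 + C7))) * e\<^sup>2 \<le> nP\<^sup>2" using zero_le_power2[of "(1 + C7) * e"]
    unfolding power_mult_distrib by linarith
  have "(C4 + C5) * y \<le> (C4 + C5) * e\<^sup>2" "Z * y \<le> Z * e\<^sup>2"
    using y nonneg by (auto intro: mult_left_mono)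
  then have lower: "T - c0 - Z * y \<ge> (C * (C - 2 * (1 + C7))) * e\<^sup>2 - (C4 + C5) * e\<^sup>2 - 2 * (C3 * C * e\<^sup>2) - 2 * (q * e\<^sup>2) - Z * e\<^sup>2"
  proof -
    have comb: "p - s2 - 2 * u - 2 * d - ze \<le> uu + 2 * (ua + ud) + np - c0 - zy"
      if "c0 - s1 \<le> uu" "s1 \<le> s2" "zy \<le> ze" "\<bar>ua\<bar> \<le> u" "\<bar>ud\<bar> \<le> d" "p \<le> np"
      for p s1 s2 u d ze zy uu ua ud np :: real
    proof -
      have "c0 - s2 \<le> uu" "- u \<le> ua" "- d \<le> ud" using that by linarith+
      then show ?thesis using that(3,6) by argo
    qed
    show ?thesis unfolding T by (rule comb) fact+
  qed
  \<comment> \<open>Everything that does not carry a factor \<open>C\<close>, plus 1. The hypothesis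
    on \<open>C\<close> says that the cofactor of \<open>C\<close> is at least \<open>B\<close>, and
    \<open>C \<ge> 1\<close> does the rest.\<close>
  define B where "B = 1 + 2 * q + C4 + C5 + Z"
  have "B \<le> C - 2 * (1 + C7) - 2 * C3" using C by (simp add: B_def)
  moreover have "0 \<le> B" using nonneg C67 by (simp add: B_def)
  ultimately have "1 * B \<le> C * (C - 2 * (1 + C7) - 2 * C3)" using C1 by (intro mult_mono) auto
  then have "0 \<le> (C * (C - 2 * (1 + C7) - 2 * C3) - (2 * q + C4 + C5 + Z)) * e\<^sup>2"
    by (intro mult_nonneg_nonneg) (auto simp: B_def)
  also have "\<dots> = (C * (C - 2 * (1 + C7))) * e\<^sup>2 - (C4 + C5) * e\<^sup>2 - 2 * (C3 * C * e\<^sup>2) - 2 * (q * e\<^sup>2) - Z * e\<^sup>2"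
    by (simp add: algebra_simps)
  finally show ?thesis using lower by linarith
qed

text \<open>The separation constant: \<open>C1\<close> bounds the empirical deviation in units of its rate, and
  each of the five exceptional events has probability at most \<open>\<delta> / 5\<close>.\<close>

definition sep_const :: "real \<Rightarrow> real \<Rightarrow> real \<Rightarrow> real \<Rightarrow> real \<Rightarrow> real \<Rightarrow> real" where
  "sep_const \<sigma>2 \<tau> c C1 z \<delta> =
    (let C3 = sqrt (5 * \<sigma>2 / \<delta>); C4 = sqrt (5 * \<tau> / \<delta>) * c\<^sup>2; C5 = sqrt (20 / \<delta>) * \<sigma>2 * c;
         C6 = sqrt (\<sigma>2 + C4 + C5); C7 = sqrt (20 * \<sigma>2 / \<delta>) * c * C1 + 2 * C1
     in 1 + 2 * (1 + C7) + 2 * C3 + 2 * (C6 * C7) + C4 + C5 + \<bar>z\<bar> * (2 * \<sigma>2 * c))"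

text \<open>Each of the events \<open>E1\<close> to \<open>E5\<close> has probability at most
  \<open>\<delta> / 5\<close>, and off their union \<open>detection_bound\<close> applies. The
  admissible \<open>C\<close> depends neither on \<open>f\<close> nor on \<open>N\<close>,
  \<open>h\<close> or \<open>lam\<close>.\<close>

lemma (in dc_design) power:
  fixes f :: "real ^ 'd \<Rightarrow> real" and C C1 \<rho>r \<delta> z :: real
  assumes \<delta>: "0 < \<delta>" and h1: "h \<le> 1" and Nh: "1 \<le> real N * h" and f: "f \<in> H"
    and C1: "0 < C1" and rr: "0 < \<rho>r" "C1 * \<rho>r \<le> 1 / 2"
    and dev_event: "{\<omega> \<in> space M. C1 * \<rho>r < Ximax (G \<omega>) \<omega>} \<in> events"
    and dev: "prob {\<omega> \<in> space M. C1 * \<rho>r < Ximax (G \<omega>) \<omega>} \<le> \<delta> / 5"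
    and C: "sep_const \<sigma>2 \<tau> c\<phi> C1 z \<delta> \<le> C"
  defines "x \<equiv> sqrt (1 / (real N * h))" and "y \<equiv> 1 / (real N * sqrt h)" and "w \<equiv> 1 / sqrt (real N)"
  defines "b \<equiv> (sqrt lam * rk.h.nm f + x) * \<rho>r"
  assumes sep: "C * (sqrt lam * rk.h.nm f + sqrt y + w + sqrt (b * x) + b) \<le> r.nm f"
  defines "fb \<equiv> \<lambda>\<omega>. dc_krr H ip lam N s (G \<omega>) (xs \<omega>) (\<lambda>i. f (X i \<omega>) + \<epsilon> i \<omega>)"
  shows "1 - \<delta> \<le> prob {\<omega> \<in> space M.
      z * sqrt (variance (pair_sum K N)) / (real N)\<^sup>2 \<le> \<bar>E (fb \<omega>) (fb \<omega>) - \<sigma>2 / (real N * h)\<bar>}"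
proof -
  define F where "F = r.nm f"
  define L where "L = sqrt lam * rk.h.nm f"
  define \<rho> where "\<rho> = C1 * \<rho>r"
  \<comment> \<open>\<open>C2\<close> to \<open>C5\<close> are chosen so that the second moment
    bounds, divided by the thresholds, give at most \<open>\<delta> / 5\<close>. In
    \<open>C2\<close> and \<open>C5\<close> the 20 is 5 times 4; the 4 comes from
    \<open>energy_le\<close> and from \<open>pair_sum_moment\<close> respectively.\<close>
  define C2 where "C2 = sqrt (20 * \<sigma>2 / \<delta>) * c\<phi> * C1"
  define C3 where "C3 = sqrt (5 * \<sigma>2 / \<delta>)"
  define C4 where "C4 = sqrt (5 * \<tau> / \<delta>) * c\<phi>\<^sup>2"
  define C5 where "C5 = sqrt (20 / \<delta>) * \<sigma>2 * c\<phi>"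
  define C6 where "C6 = sqrt (\<sigma>2 + C4 + C5)"
  define C7 where "C7 = C2 + 2 * C1"
  define Z where "Z = \<bar>z\<bar> * (2 * \<sigma>2 * c\<phi>)"
  have cp: "0 < c\<phi>" using c\<phi>_ge by linarith
  have Np: "0 < real N" using N by simp
  have \<rho>: "0 < \<rho>" "\<rho> \<le> 1 / 2" using C1 rr by (simp_all add: \<rho>_def)
  have pos: "0 < C2" "0 < C3" "0 < C4" "0 < C5" using \<delta> \<sigma>2_pos \<tau>_pos cp C1
    by (simp_all add: C2_def C3_def C4_def C5_def)
  have pos': "0 \<le> C6" "0 < C7" "0 \<le> Z" using pos C1 \<sigma>2_pos cp by (simp_all add: C6_def C7_def Z_def)
  have xyw: "0 < x" "0 < y" "0 < w" using Np h_pos by (simp_all add: x_def y_def w_def)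
  have L0: "0 \<le> L" using rk.h.nm_nonneg[OF f] lam by (simp add: L_def)
  have b0: "0 \<le> b" using L0 xyw rr by (simp add: b_def L_def)
  have C': "1 + 2 * (1 + C7) + 2 * C3 + 2 * (C6 * C7) + C4 + C5 + Z \<le> C"
    using C by (simp add: sep_const_def Let_def C2_def C3_def C4_def C5_def C6_def C7_def Z_def)
  have Cpos: "0 < C"
  proof -
    have "0 < 1 + 2 * (1 + C7) + 2 * C3 + 2 * (C6 * C7) + C4 + C5 + Z"
      using pos pos' by (intro add_pos_nonneg) auto
    then show ?thesis using C' by (rule less_le_trans)
  qed
  have sep': "C * (L + sqrt y + w + sqrt (b * x) + b) \<le> F" using sep by (simp add: L_def F_def)
  have Fpos: "0 < F"
  proof -
    have "0 < L + sqrt y + w + sqrt (b * x) + b"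
      using L0 xyw b0 by (intro add_nonneg_pos add_pos_nonneg add_nonneg_nonneg) auto
    then show ?thesis using sep' Cpos by (meson less_le_trans mult_pos_pos)
  qed
  obtain A where A: "A \<in> H" and A_eq: "\<And>g. g \<in> H \<Longrightarrow> E A g = L2_inner Q f g"
    using rk.smoother[OF lam f] by blast
  have AF: "r.nm A \<le> F" unfolding F_def by (rule rk.smoother_nm_le[OF lam f A A_eq])
  have AfL: "r.nm (\<lambda>x. A x - f x) \<le> L" unfolding L_def by (rule rk.smoother_close[OF lam f A A_eq])
  have A_nm: "F - L \<le> r.nm A"
    using r.nm_triangle_diff[OF f A] r.nm_minus[OF f A] AfL by (simp add: F_def)
  have AA: "L2_inner Q A A \<le> F\<^sup>2"
  proof -
    have "L2_inner Q A A = (rk.l.nm A)\<^sup>2" using rk.l.nm_sq[OF A] by simp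
    also have "\<dots> \<le> F\<^sup>2"
      using rk.L2_le_ridge[OF lam A] AF rk.l.nm_nonneg[OF A] by (intro power_mono) auto
    finally show ?thesis .
  qed
  define t where "t = 4 * \<rho>\<^sup>2 * \<kappa> / real N"
  define u2 where "u2 = (C2 * \<rho>r * x)\<^sup>2"
  define u3 where "u3 = (C3 * F * sqrt (real N))\<^sup>2"
  define u4 where "u4 = (C4 * (real N)\<^sup>2 * y)\<^sup>2"
  define u5 where "u5 = (C5 * (real N)\<^sup>2 * y)\<^sup>2"
  define E1 where "E1 = {\<omega> \<in> space M. \<rho> < Ximax (G \<omega>) \<omega>}"
  define E2 where "E2 = {\<omega> \<in> space M. energy (G \<omega>) \<omega> \<le> t \<and> u2 \<le> E (noise (G \<omega>) \<omega>) (noise (G \<omega>) \<omega>)}"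
  define S3 where "S3 \<omega> = (\<Sum>i=1..N. \<epsilon> i \<omega> * A (X i \<omega>))" for \<omega>
  define S4 where "S4 \<omega> = (\<Sum>i=1..N. (\<epsilon> i \<omega>)\<^sup>2 * K (X i \<omega>) (X i \<omega>) - \<sigma>2 * inverse h)" for \<omega>
  define E3 where "E3 = {\<omega> \<in> space M. u3 \<le> (S3 \<omega>)\<^sup>2}"
  define E4 where "E4 = {\<omega> \<in> space M. u4 \<le> (S4 \<omega>)\<^sup>2}"
  define E5 where "E5 = {\<omega> \<in> space M. u5 \<le> (pair_sum K N \<omega>)\<^sup>2}"
  have u: "0 < u2" "0 < u3" "0 < u4" "0 < u5"
    using pos xyw rr Fpos Np by (simp_all add: u2_def u3_def u4_def u5_def)
  have t0: "0 \<le> t" using \<kappa>_pos by (simp add: t_def)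
  have sqrt2: "(sqrt (5 * \<sigma>2 / \<delta>))\<^sup>2 = 5 * \<sigma>2 / \<delta>" "(sqrt (20 * \<sigma>2 / \<delta>))\<^sup>2 = 20 * \<sigma>2 / \<delta>"
    "(sqrt (5 * \<tau> / \<delta>))\<^sup>2 = 5 * \<tau> / \<delta>" "(sqrt (20 / \<delta>))\<^sup>2 = 20 / \<delta>" "(sqrt h)\<^sup>2 = h"
    "x\<^sup>2 = 1 / (real N * h)"
    using \<delta> \<sigma>2_pos \<tau>_pos h_pos by (simp_all add: x_def)
  have y2: "y\<^sup>2 = 1 / ((real N)\<^sup>2 * h)" using sqrt2 by (simp add: y_def power_mult_distrib power_divide)
  have E1: "E1 \<in> events" "prob E1 \<le> \<delta> / 5" using dev_event dev by (simp_all add: E1_def \<rho>_def)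
  have frac: "q \<le> \<delta> / 5" if "q \<le> a / u" "a = \<delta> / 5 * u" "0 < u" for q a u :: real
    using that by simp
  have E2: "E2 \<in> events" "prob E2 \<le> \<delta> / 5"
  proof -
    note nt = noise_tail_random[OF t0 u(1), folded E2_def]
    show "E2 \<in> events" by (rule nt(1))
    have "u2 = 20 * \<sigma>2 / \<delta> * c\<phi>\<^sup>2 * C1\<^sup>2 * \<rho>r\<^sup>2 * (1 / (real N * h))"
      unfolding u2_def C2_def power_mult_distrib sqrt2 by simp
    moreover have "\<sigma>2 * t = 4 * \<sigma>2 * C1\<^sup>2 * \<rho>r\<^sup>2 * c\<phi>\<^sup>2 * (1 / (real N * h))"
      unfolding t_def \<rho>_def power_mult_distrib using h_pos Np by (simp add: field_simps)
    ultimately have "\<sigma>2 * t = \<delta> / 5 * u2" using \<delta> by simp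
    from frac[OF nt(2) this u(1)] show "prob E2 \<le> \<delta> / 5" .
  qed
  have E3: "E3 \<in> events" "prob E3 \<le> \<delta> / 5"
  proof -
    obtain B where B: "\<bar>A x\<bar> \<le> B" if "x \<in> \<X>" for x using rk.eval_le[OF A] by blast
    note lm = linear_moment[OF rk.H_measurable[OF A] B, of N, folded S3_def]
    have "(\<integral>\<omega>. (S3 \<omega>)\<^sup>2 \<partial>M) \<le> \<sigma>2 * (real N * F\<^sup>2)"
      using lm(2) AA \<sigma>2_pos by (simp add: mult_left_mono)
    note tb = tail_bound[OF lm(1) this u(2), folded E3_def]
    show "E3 \<in> events" by (rule tb(1))
    have le: "prob E3 \<le> \<sigma>2 * (real N * F\<^sup>2) / u3" by (rule tb(2))
    have "u3 = 5 * \<sigma>2 / \<delta> * F\<^sup>2 * real N"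
      unfolding u3_def C3_def power_mult_distrib sqrt2 by simp
    then have "\<sigma>2 * (real N * F\<^sup>2) = \<delta> / 5 * u3" using \<delta> by simp
    from frac[OF le this u(2)] show "prob E3 \<le> \<delta> / 5" .
  qed
  have E4: "E4 \<in> events" "prob E4 \<le> \<delta> / 5"
  proof -
    have "(\<lambda>x. K x x) \<in> borel_measurable Q" using rk.ridge_kernel_trace(1)[OF lam] by auto
    then have m: "(\<lambda>x. K x x) \<in> borel_measurable B\<X>" by (simp add: sets_covariate cong: measurable_cong_sets)
    note dm = diagonal_moment[where Kf=K and N=N and \<kappa>=\<kappa> and t="inverse h", OF K_design K_bound K_trace rk.ridge_kernel_diag_nonneg[OF lam] m, folded S4_def]
    note tb = tail_bound[OF dm u(3), folded E4_def]
    show "E4 \<in> events" by (rule tb(1))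
    have le: "prob E4 \<le> real N * (\<kappa>\<^sup>2 * \<tau>) / u4" by (rule tb(2))
    have "u4 = 5 * \<tau> / \<delta> * (c\<phi>\<^sup>2)\<^sup>2 * ((real N)\<^sup>2)\<^sup>2 * (1 / ((real N)\<^sup>2 * h))"
      unfolding u4_def C4_def power_mult_distrib sqrt2 y2 by simp
    then have "\<delta> / 5 * u4 = \<tau> * (c\<phi>\<^sup>2)\<^sup>2 * (real N)\<^sup>2 / h"
      using \<delta> Np h_pos by (simp add: power2_eq_square field_simps)
    also have "\<dots> = real N * (\<kappa>\<^sup>2 * \<tau>) * (real N * h)"
      using h_pos by (simp add: power_mult_distrib power2_eq_square field_simps)
    finally have "real N * (\<kappa>\<^sup>2 * \<tau>) * (real N * h) = \<delta> / 5 * u4" by simp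
    \<comment> \<open>The second moment of the diagonal sum is of order
      \<open>N / h\<^sup>2\<close>, and the squared threshold of order \<open>N\<^sup>2 / h\<close>.
      Their ratio is \<open>1 / (N * h)\<close>, which \<open>Nh\<close> bounds by 1.\<close>
    moreover have "real N * (\<kappa>\<^sup>2 * \<tau>) * 1 \<le> real N * (\<kappa>\<^sup>2 * \<tau>) * (real N * h)"
      using Nh \<tau>_pos by (intro mult_left_mono) auto
    ultimately have "real N * (\<kappa>\<^sup>2 * \<tau>) \<le> \<delta> / 5 * u4" by simp
    then have "real N * (\<kappa>\<^sup>2 * \<tau>) / u4 \<le> \<delta> / 5" using u by (simp add: pos_divide_le_eq)
    then show "prob E4 \<le> \<delta> / 5" using le by linarith
  qed
  have V2: "integrable M (\<lambda>\<omega>. (pair_sum K N \<omega>)\<^sup>2)" "(\<integral>\<omega>. (pair_sum K N \<omega>)\<^sup>2 \<partial>M) \<le> 4 * \<sigma>2\<^sup>2 * (real N * real N) * \<kappa>"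
    using pair_sum_moment[where Kf=K and N=N and \<kappa>=\<kappa>, OF K_design K_bound K_sq_mean order_refl] by blast+
  \<comment> \<open>Here \<open>\<kappa> = c\<phi>\<^sup>2 / h\<close> and
    \<open>N\<^sup>4 y\<^sup>2 = N\<^sup>2 / h\<close>. So the standard deviation of
    \<open>W\<close>, divided by \<open>N\<^sup>2\<close>, is at most a multiple of
    \<open>y\<close>, one of the scales of the separation rate.\<close>
  have V2val: "4 * \<sigma>2\<^sup>2 * (real N * real N) * \<kappa> = (2 * \<sigma>2 * c\<phi> * (real N)\<^sup>2 * y)\<^sup>2"
    unfolding power_mult_distrib y2 using h_pos Np by (simp add: power2_eq_square field_simps)
  have E5: "E5 \<in> events" "prob E5 \<le> \<delta> / 5"
  proof -
    note tb = tail_bound[OF V2 u(4), folded E5_def]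
    show "E5 \<in> events" by (rule tb(1))
    have le: "prob E5 \<le> 4 * \<sigma>2\<^sup>2 * (real N * real N) * \<kappa> / u5" by (rule tb(2))
    have "u5 = 20 / \<delta> * \<sigma>2\<^sup>2 * c\<phi>\<^sup>2 * ((real N)\<^sup>2)\<^sup>2 * y\<^sup>2"
      unfolding u5_def C5_def power_mult_distrib sqrt2 by simp
    moreover have "(2 * \<sigma>2 * c\<phi> * (real N)\<^sup>2 * y)\<^sup>2 = 4 * \<sigma>2\<^sup>2 * c\<phi>\<^sup>2 * ((real N)\<^sup>2)\<^sup>2 * y\<^sup>2"
      unfolding power_mult_distrib by simp
    ultimately have "(2 * \<sigma>2 * c\<phi> * (real N)\<^sup>2 * y)\<^sup>2 = \<delta> / 5 * u5" using \<delta> by simp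
    then have "4 * \<sigma>2\<^sup>2 * (real N * real N) * \<kappa> = \<delta> / 5 * u5" unfolding V2val .
    from frac[OF le this u(4)] show "prob E5 \<le> \<delta> / 5" .
  qed
  have V_meas: "pair_sum K N \<in> borel_measurable M"
  proof -
    have "(\<lambda>\<omega>. K (X i \<omega>) (X k \<omega>)) \<in> borel_measurable M" if "i \<in> {1..N}" "k \<in> {1..N}" for i k
      using K_design[OF that] by (rule design_M)
    then show ?thesis unfolding pair_sum_def
      by (intro borel_measurable_sum borel_measurable_times borel_measurable_const \<epsilon>_measurable) auto
  qed
  have sd: "sqrt (variance (pair_sum K N)) \<le> 2 * \<sigma>2 * c\<phi> * (real N)\<^sup>2 * y"
  proof -
    have "integrable M (pair_sum K N)" by (rule square_integrable_imp_integrable[OF V_meas V2(1)])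
    then have "variance (pair_sum K N) \<le> (\<integral>\<omega>. (pair_sum K N \<omega>)\<^sup>2 \<partial>M)"
      using V2(1) by (simp add: variance_eq)
    also have "\<dots> \<le> (2 * \<sigma>2 * c\<phi> * (real N)\<^sup>2 * y)\<^sup>2" using V2(2) unfolding V2val .
    finally show ?thesis
      using \<sigma>2_pos cp xyw by (intro real_le_lsqrt) auto
  qed
  \<comment> \<open>The critical value is bounded through the absolute value of \<open>z\<close>, so
    the quantile never has to be evaluated.\<close>
  have zsd: "z * sqrt (variance (pair_sum K N)) / (real N)\<^sup>2 \<le> Z * y"
  proof -
    have "0 \<le> sqrt (variance (pair_sum K N))" by simp
    then have "z * sqrt (variance (pair_sum K N)) \<le> \<bar>z\<bar> * sqrt (variance (pair_sum K N))"
      by (intro mult_right_mono) auto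
    also have "\<dots> \<le> \<bar>z\<bar> * (2 * \<sigma>2 * c\<phi> * (real N)\<^sup>2 * y)" using sd by (intro mult_left_mono) auto
    also have "\<dots> = Z * y * (real N)\<^sup>2" by (simp add: Z_def mult_ac)
    finally show ?thesis using Np by (simp add: pos_divide_le_eq)
  qed
  let ?T = "\<lambda>\<omega>. E (fb \<omega>) (fb \<omega>)"
  let ?good = "{\<omega> \<in> space M. z * sqrt (variance (pair_sum K N)) / (real N)\<^sup>2 \<le> \<bar>?T \<omega> - \<sigma>2 / (real N * h)\<bar>}"
  have T_meas: "?T \<in> borel_measurable M" unfolding fb_def by (rule statistic_measurable[OF f])
  have good: "?good \<in> events" using T_meas by measurable
  have sub: "space M - (E1 \<union> E2 \<union> E3 \<union> E4 \<union> E5) \<subseteq> ?good"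
  proof
    fix \<omega> assume "\<omega> \<in> space M - (E1 \<union> E2 \<union> E3 \<union> E4 \<union> E5)"
    then have \<omega>: "\<omega> \<in> space M" and n1: "Ximax (G \<omega>) \<omega> \<le> \<rho>"
      and n2: "energy (G \<omega>) \<omega> \<le> t \<Longrightarrow> E (noise (G \<omega>) \<omega>) (noise (G \<omega>) \<omega>) < u2"
      and n3: "(S3 \<omega>)\<^sup>2 < u3" and n4: "(S4 \<omega>)\<^sup>2 < u4" and n5: "(pair_sum K N \<omega>)\<^sup>2 < u5"
      by (auto simp: E1_def E2_def E3_def E4_def E5_def not_le not_less)
    note g = G_in[OF \<omega>]
    define No where "No = noise (G \<omega>) \<omega>"
    define Bi where "Bi = bias f A (G \<omega>) \<omega>"
    define U where "U = lead \<omega>"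
    define D where "D = (\<lambda>x. No x + Bi x)"
    define P where "P = (\<lambda>x. A x + D x)"
    have No: "No \<in> H" unfolding No_def by (rule noise_mem[OF g \<omega>])
    have Bi: "Bi \<in> H" unfolding Bi_def by (rule bias_mem[OF g f A A_eq \<omega>])
    have U: "U \<in> H" unfolding U_def by (rule lead_mem)
    have D: "D \<in> H" unfolding D_def by (rule r.add_in[OF No Bi])
    have P: "P \<in> H" unfolding P_def by (rule r.add_in[OF A D])
    have en: "energy (G \<omega>) \<omega> \<le> t"
      unfolding t_def using \<rho> by (intro energy_le[OF g \<omega> n1]) auto
    have abs_le: "\<bar>q\<bar> \<le> k" if "q\<^sup>2 < k\<^sup>2" "0 \<le> k" for q k :: real
      using that abs_le_square_iff[of q k] by simp
    have "(r.nm No)\<^sup>2 < (C2 * \<rho>r * x)\<^sup>2"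
      unfolding r.nm_sq[OF No] using n2[OF en] by (simp add: u2_def No_def)
    from abs_le[OF this] have noise: "r.nm No \<le> C2 * (x * \<rho>r)"
      using pos rr xyw by (simp add: mult_ac)
    have "r.nm Bi \<le> 2 * \<rho> * L"
      unfolding Bi_def L_def using \<rho> by (intro bias_le[OF g f A A_eq \<omega> n1]) auto
    then have bias: "r.nm Bi \<le> 2 * C1 * (L * \<rho>r)" by (simp add: \<rho>_def mult_ac)
    have "r.nm D \<le> r.nm No + r.nm Bi" unfolding D_def by (rule r.nm_triangle[OF No Bi])
    also have "\<dots> \<le> C7 * b"
    proof -
      have "C7 * b = C2 * (x * \<rho>r) + 2 * C1 * (L * \<rho>r) + C2 * (L * \<rho>r) + 2 * C1 * (x * \<rho>r)"
        by (simp add: C7_def b_def L_def algebra_simps)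
      moreover have "0 \<le> C2 * (L * \<rho>r)" "0 \<le> 2 * C1 * (x * \<rho>r)" using pos C1 L0 rr xyw by auto
      ultimately show ?thesis using noise bias by linarith
    qed
    finally have D_le: "r.nm D \<le> C7 * b" .
    have fb_eq: "fb \<omega> = (\<lambda>x. U x + P x)"
      unfolding fb_def U_def P_def D_def No_def Bi_def by (rule dc_decompose[OF g f A A_eq \<omega>])
    \<comment> \<open>\<open>A\<close> and \<open>D\<close> are kept together in \<open>P\<close>
      for the square and separated in the pairing with \<open>U\<close>. This avoids the product of
      \<open>A\<close> and \<open>D\<close>, and lets the centred pairing of \<open>U\<close> with
      \<open>A\<close> be bounded by Chebyshev instead of by norms.\<close>
    have T: "?T \<omega> = E U U + 2 * (E U A + E U D) + (r.nm P)\<^sup>2"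
      unfolding fb_eq r.B_add_sq[OF U P] r.nm_sq[OF P] using U A D by (simp add: P_def r.add_right)
    have P_ge: "F - L - r.nm D \<le> r.nm P"
    proof -
      have "r.nm A \<le> r.nm P + r.nm D"
        using r.nm_triangle_diff[OF A D] r.nm_triangle[OF P r.scale_in[OF D, of "-1"]] r.nm_scale[OF D, of "-1"]
        by (simp add: P_def)
      then show ?thesis using A_nm by linarith
    qed
    have abs3: "\<bar>S3 \<omega>\<bar> \<le> C3 * F * sqrt (real N)"
      using n3 pos Fpos unfolding u3_def by (intro abs_le) auto
    have abs4: "\<bar>S4 \<omega>\<bar> \<le> C4 * (real N)\<^sup>2 * y"
      using n4 pos xyw unfolding u4_def by (intro abs_le) auto
    have abs5: "\<bar>pair_sum K N \<omega>\<bar> \<le> C5 * (real N)\<^sup>2 * y"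
      using n5 pos xyw unfolding u5_def by (intro abs_le) auto
    have UA: "\<bar>E U A\<bar> \<le> C3 * F * w"
    proof -
      have "\<bar>E U A\<bar> = \<bar>S3 \<omega>\<bar> / real N" unfolding U_def lead_inner[OF \<omega> A] S3_def by simp
      also have "\<dots> \<le> C3 * F * sqrt (real N) / real N" using abs3 by (intro divide_right_mono) auto
      also have "\<dots> = C3 * F * w" using real_div_sqrt[of "real N"] Np by (simp add: w_def field_simps)
      finally show ?thesis .
    qed
    have UUeq: "E U U = \<sigma>2 / (real N * h) + S4 \<omega> / (real N)\<^sup>2 + pair_sum K N \<omega> / (real N)\<^sup>2"
    proof -
      have sum: "(\<Sum>i=1..N. (\<epsilon> i \<omega>)\<^sup>2 * K (X i \<omega>) (X i \<omega>)) = S4 \<omega> + real N * (\<sigma>2 * inverse h)"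
        by (simp add: S4_def sum_subtractf)
      have c: "real N * (\<sigma>2 * inverse h) / (real N)\<^sup>2 = \<sigma>2 / (real N * h)"
        using Np h_pos by (simp add: field_simps power2_eq_square)
      show ?thesis unfolding U_def lead_sq[OF \<omega>] sum add_divide_distrib c by simp
    qed
    have S4y: "\<bar>S4 \<omega> / (real N)\<^sup>2\<bar> \<le> C4 * y" and Vy: "\<bar>pair_sum K N \<omega> / (real N)\<^sup>2\<bar> \<le> C5 * y"
      using abs4 abs5 Np by (simp_all add: pos_divide_le_eq mult_ac)
    have UU_ge: "\<sigma>2 / (real N * h) - (C4 + C5) * y \<le> E U U"
      unfolding UUeq distrib_right using S4y Vy by linarith
    \<comment> \<open>For \<open>h \<le> 1\<close> the fluctuation scale \<open>y\<close> of the
      squared norm of \<open>U\<close> is below its mean scale \<open>x\<^sup>2\<close>, so the norm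
      of \<open>U\<close> is of order \<open>x\<close>.\<close>
    have yx: "y \<le> x\<^sup>2"
    proof -
      have "h \<le> sqrt h" using h1 h_pos by (intro real_le_rsqrt) (simp add: power2_eq_square mult_left_le)
      then have "real N * h \<le> real N * sqrt h" by (intro mult_left_mono) auto
      then show ?thesis unfolding sqrt2 y_def using Np h_pos by (intro divide_left_mono) auto
    qed
    have U_le: "r.nm U \<le> C6 * x"
    proof -
      have "(r.nm U)\<^sup>2 \<le> \<sigma>2 * x\<^sup>2 + (C4 + C5) * y"
      proof -
        have "(r.nm U)\<^sup>2 = \<sigma>2 * x\<^sup>2 + S4 \<omega> / (real N)\<^sup>2 + pair_sum K N \<omega> / (real N)\<^sup>2"
          unfolding r.nm_sq[OF U] UUeq sqrt2 by simp
        then show ?thesis unfolding distrib_right using S4y Vy by linarith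
      qed
      also have "\<dots> \<le> \<sigma>2 * x\<^sup>2 + (C4 + C5) * x\<^sup>2" using yx pos by (intro add_left_mono mult_left_mono) auto
      also have "\<dots> = (\<sigma>2 + C4 + C5) * x\<^sup>2" by (simp add: distrib_right)
      also have "\<dots> = (C6 * x)\<^sup>2" using pos \<sigma>2_pos by (simp add: C6_def power_mult_distrib)
      finally show ?thesis by (rule power2_le_imp_le) (use pos' xyw in simp)
    qed
    have "Z * y \<le> ?T \<omega> - \<sigma>2 / (real N * h)"
      by (rule detection_bound[OF L0 b0 less_imp_le[OF xyw(2)] less_imp_le[OF xyw(3)] less_imp_le[OF xyw(1)]
            less_imp_le[OF pos(2)] less_imp_le[OF pos(3)] less_imp_le[OF pos(4)] pos'(1) less_imp_le[OF pos'(2)] pos'(3)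
            C' sep' r.nm_nonneg[OF D] D_le r.nm_nonneg[OF U] U_le UU_ge UA r.cauchy_schwarz[OF U D] P_ge T])
    then show "\<omega> \<in> ?good" using \<omega> zsd by simp
  qed
  have bad: "prob (E1 \<union> E2 \<union> E3 \<union> E4 \<union> E5) \<le> \<delta>"
  proof -
    have "prob (E1 \<union> E2 \<union> E3 \<union> E4 \<union> E5) \<le> prob E1 + prob E2 + prob E3 + prob E4 + prob E5"
      using measure_Un_le[of E1 M E2] measure_Un_le[of "E1 \<union> E2" M E3]
        measure_Un_le[of "E1 \<union> E2 \<union> E3" M E4] measure_Un_le[of "E1 \<union> E2 \<union> E3 \<union> E4" M E5]
        E1 E2 E3 E4 E5 by simp
    then show ?thesis using E1(2) E2(2) E3(2) E4(2) E5(2) by simp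
  qed
  have "1 - \<delta> \<le> prob (space M - (E1 \<union> E2 \<union> E3 \<union> E4 \<union> E5))"
    using bad E1 E2 E3 E4 E5 by (subst prob_compl) auto
  also have "\<dots> \<le> prob ?good" by (rule finite_measure_mono[OF sub good])
  finally show ?thesis .
qed

section \<open>From the asymptotic conditions to one sample size\<close>

lemma uniform_eigenfunction_bound:
  fixes \<phi> :: "nat \<Rightarrow> 'a \<Rightarrow> real"
  assumes "(SUP j\<in>{1..}. sup_norm \<X> (\<phi> j)) < \<infinity>"
  obtains c where "1 \<le> c" "\<And>j x. j \<ge> 1 \<Longrightarrow> x \<in> \<X> \<Longrightarrow> \<bar>\<phi> j x\<bar> \<le> c"
proof -
  define S where "S = (SUP j\<in>{1..}. sup_norm \<X> (\<phi> j))"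
  have S: "S < \<infinity>" using assms by (simp add: S_def)
  have "\<bar>\<phi> j x\<bar> \<le> max 1 (enn2real S)" if "j \<ge> 1" "x \<in> \<X>" for j x
  proof -
    have "ennreal \<bar>\<phi> j x\<bar> \<le> sup_norm \<X> (\<phi> j)" unfolding sup_norm_def by (rule SUP_upper[OF that(2)])
    also have "\<dots> \<le> S" unfolding S_def using that(1) by (intro SUP_upper) auto
    also have "\<dots> = ennreal (enn2real S)" using S by (simp add: ennreal_enn2real)
    finally show ?thesis by (simp add: ennreal_le_iff)
  qed
  then show ?thesis using that[of "max 1 (enn2real S)"] by simp
qed

text \<open>The term \<open>k = 1\<close> of the supremum bounds the tail after the first
  eigenvalue, provided \<open>\<mu> 1\<close> is positive. If \<open>\<mu> 1 = 0\<close>, all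
  eigenvalues vanish by monotonicity.\<close>

lemma (in eigen_rkhs) eigenvalues_summable:
  assumes "(SUP k\<in>{1..}. (\<Sum>l. ennreal (\<mu> (k + 1 + l))) / ennreal (real k * \<mu> k)) < \<infinity>"
  shows "summable (\<lambda>k. \<mu> (Suc k))"
proof -
  have nn: "0 \<le> \<mu> (Suc k)" for k by (simp add: \<mu>_nonneg)
  show ?thesis
  proof (cases "\<mu> 1 = 0")
    case True
    have "\<mu> (Suc k) = 0" for k
    proof (induction k)
      case (Suc k)
      then show ?case using \<mu>_decreasing[of "Suc k"] nn[of "Suc k"] by simp
    qed (use True in simp)
    then show ?thesis by simp
  next
    case False
    then have pos: "0 < \<mu> 1" using \<mu>_nonneg[of 1] by simp
    have "(\<Sum>l. ennreal (\<mu> (1 + 1 + l))) / ennreal (real 1 * \<mu> 1) < \<infinity>"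
      by (rule le_less_trans[OF _ assms], rule SUP_upper[where f="\<lambda>k. (\<Sum>l. ennreal (\<mu> (k + 1 + l))) / ennreal (real k * \<mu> k)"]) simp
    then have "(\<Sum>l. ennreal (\<mu> (Suc (Suc l)))) \<noteq> \<top>"
      using pos by (auto simp: ennreal_top_divide)
    then have "summable (\<lambda>l. \<mu> (Suc (Suc l)))"
      using nn by (intro summable_suminf_not_top) auto
    then show ?thesis by (rule summable_Suc_iff[THEN iffD1])
  qed
qed

theorem theorem3p6:
  fixes M :: "'w measure"
    and \<X> :: "(real ^ 'd) set"
    and p v :: "real ^ 'd \<Rightarrow> real"
    and X :: "nat \<Rightarrow> 'w \<Rightarrow> real ^ 'd"
    and \<epsilon> :: "nat \<Rightarrow> 'w \<Rightarrow> real"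
    and H :: "(real ^ 'd \<Rightarrow> real) set"
    and ip :: "(real ^ 'd \<Rightarrow> real) \<Rightarrow> (real ^ 'd \<Rightarrow> real) \<Rightarrow> real"
    and R :: "real ^ 'd \<Rightarrow> real ^ 'd \<Rightarrow> real"
    and \<mu> :: "nat \<Rightarrow> real"
    and \<phi> :: "nat \<Rightarrow> real ^ 'd \<Rightarrow> real"
    and s n :: "nat \<Rightarrow> nat"
    and lam h :: "nat \<Rightarrow> real"
    and G :: "nat \<Rightarrow> 'w \<Rightarrow> nat \<Rightarrow> nat"
    and Q :: "(real ^ 'd) measure"
    and nrm :: "nat \<Rightarrow> (real ^ 'd \<Rightarrow> real) \<Rightarrow> real"
    and nrmH :: "(real ^ 'd \<Rightarrow> real) \<Rightarrow> real"
    and \<xi> :: "nat \<Rightarrow> nat \<Rightarrow> 'w \<Rightarrow> real"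
    and Y :: "(real ^ 'd \<Rightarrow> real) \<Rightarrow> nat \<Rightarrow> 'w \<Rightarrow> real"
    and fbar :: "nat \<Rightarrow> (real ^ 'd \<Rightarrow> real) \<Rightarrow> 'w \<Rightarrow> real ^ 'd \<Rightarrow> real"
    and T \<psi> :: "nat \<Rightarrow> (real ^ 'd \<Rightarrow> real) \<Rightarrow> 'w \<Rightarrow> real"
    and W :: "nat \<Rightarrow> 'w \<Rightarrow> real"
    and sdW :: "nat \<Rightarrow> real"
    and Pr :: "(real ^ 'd \<Rightarrow> real) \<Rightarrow> nat \<Rightarrow> real"
    and bN dN :: "nat \<Rightarrow> (real ^ 'd \<Rightarrow> real) \<Rightarrow> real"
    and \<alpha> a b \<sigma>2 :: real
  assumes design: "regression_design M \<X> p X \<epsilon> v"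
    and Q_def: "Q = covariate_law \<X> p"
    and rkhs: "eigen_rkhs \<X> H ip R Q \<mu> \<phi>"
    and lam_pos: "\<And>N. N \<ge> 1 \<Longrightarrow> 0 < lam N"
    and h_def: "\<And>N. h N = bandwidth \<mu> (lam N)"
    and nrm_def: "\<And>N f. nrm N f = ridge_norm Q ip (lam N) f"
    and nrmH_def: "\<And>f. nrmH f = sqrt (ip f f)"
    and sizes: "\<And>N. N \<ge> 1 \<Longrightarrow> N = n N * s N"
    and division: "\<And>N. N \<ge> 1 \<Longrightarrow> random_division M \<X> X \<epsilon> N (s N) (n N) (G N)"
    and \<xi>_def: "\<And>N j \<omega>. \<xi> N j \<omega> =
           emp_deviation Q H (nrm N) (block N (G N \<omega>) j) (\<lambda>i. X i \<omega>)"
    and Y_def: "\<And>f i \<omega>. Y f i \<omega> = f (X i \<omega>) + \<epsilon> i \<omega>"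
    and fbar_def: "\<And>N f \<omega>. fbar N f \<omega> =
           dc_krr H ip (lam N) N (s N) (G N \<omega>) (\<lambda>i. X i \<omega>) (\<lambda>i. Y f i \<omega>)"
    and T_def: "\<And>N f \<omega>. T N f \<omega> = (nrm N (fbar N f \<omega>))\<^sup>2"
    and \<alpha>: "0 < \<alpha>" "\<alpha> < 1"
    and W_def: "\<And>N \<omega>. W N \<omega> = (\<Sum>k=1..N. \<Sum>i=1..<k.
           2 * \<epsilon> i \<omega> * \<epsilon> k \<omega> * ridge_kernel \<mu> \<phi> (lam N) (X i \<omega>) (X k \<omega>))"
    and sdW_def: "\<And>N. sdW N = sqrt (prob_space.variance M (W N))"
    and \<psi>_def: "\<And>N f \<omega>. \<psi> N f \<omega> =
           (if \<bar>T N f \<omega> - \<sigma>2 / (real N * h N)\<bar>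
                 \<ge> std_normal_quantile (1 - \<alpha> / 2) * sdW N / (real N)\<^sup>2
            then 1 else 0)"
    and Pr_def: "\<And>f N. Pr f N = measure M {\<omega> \<in> space M. \<psi> N f \<omega> = 1}"
    and homoscedastic: "\<And>x. x \<in> \<X> \<Longrightarrow> v x = \<sigma>2"
    and cond_i: "\<exists>c>0. \<forall>x\<in>\<X>. 0 \<le> p x \<and> p x \<le> c \<and> 0 \<le> v x \<and> v x \<le> c"
    and cond_ii: "\<exists>\<tau>>0. \<forall>i\<ge>1. AE \<omega> in M.
           nn_cond_exp M (vimage_algebra (space M) (X i) (restrict_space borel \<X>))
             (\<lambda>\<omega>. ennreal ((\<epsilon> i \<omega>)^4)) \<omega> < ennreal \<tau>"
    and cond_iii: "(SUP j\<in>{1..}. sup_norm \<X> (\<phi> j)) < \<infinity>"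
             "(SUP k\<in>{1..}. (\<Sum>l. ennreal (\<mu> (k + 1 + l))) / ennreal (real k * \<mu> k)) < \<infinity>"
    and ab: "0 \<le> a" "0 \<le> b"
    and cond_iv: "bigOP M (\<lambda>N \<omega>. MAX j\<in>{1..s N}. \<xi> N j \<omega>)
               (\<lambda>N. sqrt (ln (real N) powr b / (real (n N) * h N powr a)))"
    and cond_v: "h \<longlonglongrightarrow> 0"
           "filterlim (\<lambda>N. real N * (h N)\<^sup>2) at_top sequentially"
           "(\<lambda>N. ln (real N) powr b) \<in> o(\<lambda>N. real (n N) * h N powr (a + 1))"
    and bN_def: "\<And>N f. bN N f =
           (sqrt (lam N) * nrmH f + (real N * h N) powr (- 1 / 2))
             * sqrt (ln (real N) powr b / (real (n N) * h N powr a))"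
    and dN_def: "\<And>N f. dN N f =
           sqrt (lam N) * nrmH f + (real N * h N powr (1 / 2)) powr (- 1 / 2)
             + real N powr (- 1 / 2)
             + bN N f powr (1 / 2) * (real N * h N) powr (- 1 / 4) + bN N f"
  shows "\<forall>\<delta>>0. \<exists>C>0. \<exists>N0\<ge>1. \<forall>N\<ge>N0.
           (INF f\<in>{f \<in> H. nrm N f \<ge> C * dN N f}. ereal (Pr f N)) \<ge> ereal (1 - \<delta>)"
proof (intro allI impI)
  fix \<delta> :: real assume \<delta>: "0 < \<delta>"
  interpret ei: eigen_rkhs \<X> H ip R Q \<mu> \<phi> by (rule rkhs)
  obtain c where c: "1 \<le> c" "\<And>j x. j \<ge> 1 \<Longrightarrow> x \<in> \<X> \<Longrightarrow> \<bar>\<phi> j x\<bar> \<le> c"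
    using uniform_eigenfunction_bound[OF cond_iii(1)] by blast
  have summ: "summable (\<lambda>k. \<mu> (Suc k))" by (rule ei.eigenvalues_summable[OF cond_iii(2)])
  obtain \<tau> where \<tau>: "0 < \<tau>" "\<And>i. i \<ge> 1 \<Longrightarrow> AE \<omega> in M.
           nn_cond_exp M (vimage_algebra (space M) (X i) (restrict_space borel \<X>))
             (\<lambda>\<omega>. ennreal ((\<epsilon> i \<omega>)^4)) \<omega> < ennreal \<tau>"
    using cond_ii by blast
  interpret hd: homoscedastic_design M \<X> p X \<epsilon> v \<sigma>2 \<tau>
    by (intro homoscedastic_design.intro design homoscedastic_design_axioms.intro homoscedastic \<tau>)
  have bounded: "bounded_eigen_rkhs \<X> H ip R (covariate_law \<X> p) \<mu> \<phi> c"
    using rkhs hd.prob_space_covariate hd.space_covariate c(2) summ unfolding Q_def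
    by (intro bounded_eigen_rkhs.intro bounded_eigen_rkhs_axioms.intro) auto
  define z where "z = std_normal_quantile (1 - \<alpha> / 2)"
  define r where "r N = sqrt (ln (real N) powr b / (real (n N) * h N powr a))" for N
  let ?Xi = "\<lambda>N \<omega>. MAX j\<in>{1..s N}. \<xi> N j \<omega>"
  have "0 < \<delta> / 5" using \<delta> by simp
  with cond_iv obtain C1 where C1: "0 < C1"
    and dev: "\<forall>\<^sub>F N in sequentially. measure M {\<omega> \<in> space M. \<bar>?Xi N \<omega>\<bar> > C1 * r N} \<le> \<delta> / 5"
    and meas: "\<forall>\<^sub>F N in sequentially. ?Xi N \<in> borel_measurable M"
    unfolding bigOP_def r_def by blast
  define C where "C = max 1 (sep_const \<sigma>2 \<tau> c C1 z \<delta>)"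
  have h_nonneg: "0 \<le> h N" if "N \<ge> 1" for N
  proof -
    have "0 \<le> shrink (lam N) (\<mu> (Suc k))" for k
      using shrink_bounds[OF lam_pos[OF that]] ei.\<mu>_nonneg by simp
    moreover have "summable (\<lambda>k. shrink (lam N) (\<mu> (Suc k)))"
      by (rule bounded_eigen_rkhs.shrink_summable[OF bounded lam_pos[OF that]])
    ultimately show ?thesis unfolding h_def bandwidth_def by (simp add: suminf_nonneg)
  qed
  \<comment> \<open>Below \<open>h0\<close> two things hold: \<open>h \<le> 1\<close>, and
    \<open>sqrt h \<le> 1 / (2 * C1)\<close>. As \<open>r N\<close> will be at most
    \<open>sqrt (h N)\<close>, the latter makes the empirical deviations at most 1/2 outside
    \<open>E1\<close>.\<close>
  define h0 where "h0 = min 1 ((1 / (2 * C1))\<^sup>2)"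
  have h0: "0 < h0" using C1 by (simp add: h0_def)
  have ev1: "\<forall>\<^sub>F N in sequentially. h N < h0" using order_tendstoD(2)[OF cond_v(1) h0] .
  have ev2: "\<forall>\<^sub>F N in sequentially. 1 \<le> real N * (h N)\<^sup>2"
    using cond_v(2) by (simp add: filterlim_at_top)
  have ev3: "\<forall>\<^sub>F N in sequentially. norm (ln (real N) powr b) \<le> 1 * norm (real (n N) * h N powr (a + 1))"
    by (rule landau_o.smallD[OF cond_v(3)]) simp
  \<comment> \<open>Makes \<open>ln N\<close> positive, and hence the rate \<open>r N\<close>
    too.\<close>
  have ev4: "\<forall>\<^sub>F N :: nat in sequentially. N \<ge> 3" by (rule eventually_ge_at_top)
  have "\<forall>\<^sub>F N in sequentially. N \<ge> 1 \<and> (\<forall>f\<in>{f \<in> H. nrm N f \<ge> C * dN N f}. 1 - \<delta> \<le> Pr f N)"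
    using ev1 ev2 ev3 ev4 dev meas
  proof eventually_elim
    case (elim N)
    have N: "N \<ge> 1" "0 < N" using elim by auto
    \<comment> \<open>If all eigenvalues vanished, \<open>bandwidth\<close> would be
      \<open>inverse 0\<close>, which HOL sets to 0. The lower bound on \<open>N * h\<^sup>2\<close>
      excludes this value.\<close>
    have hpos: "0 < h N"
    proof -
      have "h N \<noteq> 0" using elim(2) by auto
      then show ?thesis using h_nonneg[OF N(1)] by simp
    qed
    have h1: "h N \<le> 1" using elim(1) by (simp add: h0_def)
    have Nh: "1 \<le> real N * h N"
    proof -
      have "(h N)\<^sup>2 \<le> h N" using h1 hpos by (simp add: power2_eq_square mult_left_le)
      then have "real N * (h N)\<^sup>2 \<le> real N * h N" by (intro mult_left_mono) auto
      then show ?thesis using elim(2) by linarith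
    qed
    interpret dc: dc_design M \<X> p X \<epsilon> v \<sigma>2 \<tau> H ip R \<mu> \<phi> c N "s N" "n N" "lam N" "h N" "G N"
      using lam_pos[OF N(1)] N sizes[OF N(1)] division[OF N(1)] h_def hpos c(1)
      by (intro dc_design.intro dc_design_axioms.intro hd.homoscedastic_design_axioms bounded)
    have npos: "0 < real (n N)" using dc.n_pos by simp
    have lnpos: "0 < ln (real N) powr b" using elim(4) by simp
    have rpos: "0 < r N" using lnpos npos hpos by (simp add: r_def)
    have rsmall: "C1 * r N \<le> 1 / 2"
    proof -
      \<comment> \<open>The exponent \<open>a + 1\<close> leaves one factor \<open>h\<close> after
        division by \<open>n * h powr a\<close>, so the square of \<open>r N\<close> is at most
        \<open>h N\<close>.\<close>
      have "ln (real N) powr b \<le> real (n N) * h N powr (a + 1)" using elim(3) npos by simp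
      also have "\<dots> = (real (n N) * h N powr a) * h N" using hpos by (simp add: powr_add)
      finally have "ln (real N) powr b / (real (n N) * h N powr a) \<le> h N"
        using npos hpos by (simp add: pos_divide_le_eq mult.commute)
      also have "\<dots> \<le> (1 / (2 * C1))\<^sup>2" using elim(1) by (simp add: h0_def)
      finally have "r N \<le> 1 / (2 * C1)" unfolding r_def using C1 by (intro real_le_lsqrt) auto
      then show ?thesis using C1 by (simp add: field_simps)
    qed
    have Xi_eq: "dc.Ximax (G N \<omega>) \<omega> = ?Xi N \<omega>" for \<omega>
    proof -
      have "ridge_norm Q ip (lam N) = nrm N" by (simp add: fun_eq_iff nrm_def)
      then show ?thesis by (simp add: \<xi>_def Q_def)
    qed
    have dev_event: "{\<omega> \<in> space M. C1 * r N < dc.Ximax (G N \<omega>) \<omega>} \<in> sets M"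
      unfolding Xi_eq using elim(6) by measurable
    have "measure M {\<omega> \<in> space M. C1 * r N < dc.Ximax (G N \<omega>) \<omega>} \<le> measure M {\<omega> \<in> space M. \<bar>?Xi N \<omega>\<bar> > C1 * r N}"
      unfolding Xi_eq
    proof (rule hd.finite_measure_mono)
      show "{\<omega> \<in> space M. C1 * r N < ?Xi N \<omega>} \<subseteq> {\<omega> \<in> space M. C1 * r N < \<bar>?Xi N \<omega>\<bar>}"
        by (intro Collect_mono impI conjI) (blast, blast intro: less_le_trans[OF _ abs_ge_self])
      show "{\<omega> \<in> space M. C1 * r N < \<bar>?Xi N \<omega>\<bar>} \<in> sets M"
        using elim(6) by measurable
    qed
    then have dev_prob: "measure M {\<omega> \<in> space M. C1 * r N < dc.Ximax (G N \<omega>) \<omega>} \<le> \<delta> / 5"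
      using elim(5) by linarith
    have "1 - \<delta> \<le> Pr f N" if f: "f \<in> H" and sep: "C * dN N f \<le> nrm N f" for f
    proof -
      let ?x = "sqrt (1 / (real N * h N))" and ?y = "1 / (real N * sqrt (h N))" and ?w = "1 / sqrt (real N)"
      let ?b = "(sqrt (lam N) * nrmH f + ?x) * r N"
      have half: "u powr (- 1 / 2) = sqrt (1 / u)" if "0 < u" for u :: real
      proof -
        have "u powr (- 1 / 2) = inverse (u powr (1 / 2))"
          using powr_minus[of u "1 / 2"] by simp
        also have "\<dots> = sqrt (1 / u)"
          using that by (simp add: powr_half_sqrt real_sqrt_divide inverse_eq_divide)
        finally show ?thesis .
      qed
      have nrmH_nonneg: "0 \<le> nrmH f" unfolding nrmH_def using ei.ip_nonneg[OF f] by simp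
      have b_eq: "bN N f = ?b"
      proof -
        have "0 < real N * h N" using N hpos by simp
        from half[OF this] show ?thesis unfolding bN_def r_def by simp
      qed
      have b_nonneg: "0 \<le> ?b" using nrmH_nonneg rpos lam_pos[OF N(1)] hpos by simp
      have quarter: "(real N * h N) powr (- 1 / 4) = sqrt ?x"
      proof -
        have "0 < real N * h N" using N hpos by simp
        then have "?x = (real N * h N) powr (- 1 / 2)" by (rule half[symmetric])
        then have "sqrt ?x = ((real N * h N) powr (- 1 / 2)) powr (1 / 2)"
          using powr_half_sqrt[of "(real N * h N) powr (- 1 / 2)"] by simp
        also have "\<dots> = (real N * h N) powr (- 1 / 4)" unfolding powr_powr by simp
        finally show ?thesis by (rule sym)
      qed
      have d_eq: "dN N f = sqrt (lam N) * nrmH f + sqrt ?y + ?w + sqrt (?b * ?x) + ?b"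
      proof -
        have "h N powr (1 / 2) = sqrt (h N)" using hpos by (simp add: powr_half_sqrt)
        moreover have "(real N * sqrt (h N)) powr (- 1 / 2) = sqrt ?y"
          by (rule half) (use N hpos in simp)
        moreover have "real N powr (- 1 / 2) = ?w"
          using half[of "real N"] N by (simp add: real_sqrt_divide)
        moreover have "?b powr (1 / 2) = sqrt ?b" using b_nonneg by (simp add: powr_half_sqrt)
        ultimately show ?thesis unfolding dN_def b_eq quarter by (simp only: real_sqrt_mult)
      qed
      have nm_eq: "dc.r.nm g = nrm N g" for g
        by (simp add: dc.r.nm_def nrm_def ridge_norm_def ridge_ip_def Q_def)
      have nmH_eq: "dc.rk.h.nm f = nrmH f" by (simp add: dc.rk.h.nm_def nrmH_def)
      have W_eq: "W N = hd.pair_sum dc.K N" by (simp add: fun_eq_iff W_def hd.pair_sum_def)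
      let ?f = "\<lambda>\<omega>. dc_krr H ip (lam N) N (s N) (G N \<omega>) (\<lambda>i. X i \<omega>) (\<lambda>i. f (X i \<omega>) + \<epsilon> i \<omega>)"
      have T_eq: "T N f \<omega> = dc.E (?f \<omega>) (?f \<omega>)" if \<omega>: "\<omega> \<in> space M" for \<omega>
      proof -
        have "?f \<omega> \<in> H"
          using dc.rk.Hmeas_mem[OF dc.dc_Hmeas[OF dc.G_in[OF \<omega>] f] \<omega>] .
        then show ?thesis
          unfolding T_def fbar_def Y_def nm_eq[symmetric] by (rule dc.r.nm_sq)
      qed
      have "1 - \<delta> \<le> measure M {\<omega> \<in> space M. z * sqrt (prob_space.variance M (hd.pair_sum dc.K N)) / (real N)\<^sup>2
          \<le> \<bar>dc.E (?f \<omega>) (?f \<omega>) - \<sigma>2 / (real N * h N)\<bar>}"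
        by (rule dc.power[OF \<delta> h1 Nh f C1 rpos rsmall dev_event dev_prob, where C=C])
           (use sep in \<open>simp_all add: C_def d_eq nm_eq nmH_eq\<close>)
      also have "{\<omega> \<in> space M. z * sqrt (prob_space.variance M (hd.pair_sum dc.K N)) / (real N)\<^sup>2
          \<le> \<bar>dc.E (?f \<omega>) (?f \<omega>) - \<sigma>2 / (real N * h N)\<bar>} = {\<omega> \<in> space M. \<psi> N f \<omega> = 1}"
        by (auto simp: \<psi>_def T_eq sdW_def W_eq z_def)
      finally show ?thesis unfolding Pr_def .
    qed
    then show ?case using N by auto
  qed
  then obtain N0 where N0: "\<And>N. N \<ge> N0 \<Longrightarrow> N \<ge> 1 \<and> (\<forall>f\<in>{f \<in> H. nrm N f \<ge> C * dN N f}. 1 - \<delta> \<le> Pr f N)"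
    unfolding eventually_sequentially by blast
  show "\<exists>C>0. \<exists>N0\<ge>1. \<forall>N\<ge>N0. (INF f\<in>{f \<in> H. nrm N f \<ge> C * dN N f}. ereal (Pr f N)) \<ge> ereal (1 - \<delta>)"
  proof (intro exI conjI allI impI)
    show "0 < C" by (simp add: C_def)
    show "1 \<le> max 1 N0" by simp
    fix N assume "max 1 N0 \<le> N"
    \<comment> \<open>If no \<open>f\<close> is separated, the infimum is taken over the empty set
      and equals infinity in \<open>ereal\<close>; otherwise the bound holds for each
      \<open>f\<close>.\<close>
    then show "ereal (1 - \<delta>) \<le> (INF f\<in>{f \<in> H. nrm N f \<ge> C * dN N f}. ereal (Pr f N))"
      using N0[of N] by (intro INF_greatest) auto
  qed
qed

end
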